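(* Let $\{\Gamma_i\}_{i\in\mathbb{N}}$ be a family of finite simplicial graphs, let $\{A(\Gamma_i)\}_{i\in\mathbb{N}}$ denote the corresponding family of right-angled Artin groups, and let $L$ be an arbitrary field. Then $\{\Gamma_i\}_{i\in\mathbb{N}}$ is a graph expander family if and only if all of the following hold: (1) The rank of $A(\Gamma_i)$ tends to infinity as $i$ tends to infinity. (2) The rank of the centralizer of each nontrivial element of $A(\Gamma_i)$ is bounded independently of $i$ (that is, there is a constant $M$ such that for all $i$ and all nontrivial $x\in A(\Gamma_i)$ the centralizer of $x$ in $A(\Gamma_i)$ has rank at most $M$). (3) The Cheeger constant of the family $\{(H^1(A(\Gamma_i),L),H^2(A(\Gamma_i),L),\smile)\}_{i\in\mathbb{N}}$ is bounded away from zero, that is, $\inf_i h_{V_i}>0$, where $h_{V_i}$ is the Cheeger constant of the triple $(V_i,W_i,q_i)=(H^1(A(\Gamma_i),L),H^2(A(\Gamma_i),L),\smile)$.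
   Context: The rank of a group is the smallest cardinality of a generating set. A simplicial graph is an undirected graph with no multiple edges and no loops. The right-angled Artin group on a finite simplicial graph $\Gamma$ is $A(\Gamma)=\langle \mathrm{Vert}(\Gamma)\mid [v,w]=1 \text{ for every } \{v,w\}\in\mathrm{Edge}(\Gamma)\rangle$. $H^i(A(\Gamma),L)$ is group cohomology with trivial coefficients in the field $L$, and $\smile$ is the cup product $H^1(A(\Gamma),L)\times H^1(A(\Gamma),L)\to H^2(A(\Gamma),L)$. Graph Cheeger constant: for nonempty $A\subset\mathrm{Vert}(\Gamma)$, let $\partial A$ be the set of vertices not in $A$ that are adjacent to some vertex of $A$, and $h_A=|\partial A|/|A|$. Then $h_\Gamma=\min_A h_A$, the minimum over nonempty $A\subset \mathrm{Vert}(\Gamma)$ with $|A|\le |\mathrm{Vert}(\Gamma)|/2$. Graph expander family: a sequence $\{\Gamma_i\}_{i\in\mathbb{N}}$ of finite graphs such that $|\mathrm{Vert}(\Gamma_i)|\to\infty$, the valence of each vertex of $\Gamma_i$ is bounded independently of $i$, and $\inf_i h_{\Gamma_i}>0$. (Connectedness is not assumed; it is a consequence of $h_{\Gamma_i}>0$.) Cheeger constant of a triple: let $V$ be a finite dimensional $L$-vector space, $W$ an $L$-vector space, $q\colon V\times V\to W$ a symmetric or anti-symmetric bilinear pairing. For a subspace $F\subset V$ with $0<\dim F\le(\dim V)/2$, let $C=\{v\in V\mid q(f,v)=0 \text{ for all } f\in F\}$ and $$h_F=\frac{\dim V-\dim F-\dim C+\dim(C\cap F)}{\dim F}.$$ Then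 $h_V=\inf_F h_F$ over all subspaces $F$ with $0<\dim F\le(\dim V)/2$. A minimum or infimum over the empty set (which occurs for graphs with at most one vertex) is taken to be $+\infty$. *)

theory Defs
  imports
    "HOL-Library.Extended_Real"
    "HOL-Algebra.Generated_Groups"
    "HOL-Algebra.AbelCoset"
    "Jordan_Normal_Form.Missing_VectorSpace"
begin

section \<open>Simplicial graphs and expanders\<close>

record 'v graph =
  verts :: "'v set"
  edges :: "'v set set"

definition finite_simplicial_graph :: "'v graph \<Rightarrow> bool" where
  "finite_simplicial_graph \<Gamma> \<longleftrightarrow>
     finite (verts \<Gamma>) \<and> edges \<Gamma> \<subseteq> {e. e \<subseteq> verts \<Gamma> \<and> card e = 2}"

definition valence :: "'v graph \<Rightarrow> 'v \<Rightarrow> nat" where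
  "valence \<Gamma> v = card {w \<in> verts \<Gamma>. {v, w} \<in> edges \<Gamma>}"

definition vertex_boundary :: "'v graph \<Rightarrow> 'v set \<Rightarrow> 'v set" where
  "vertex_boundary \<Gamma> A = {w \<in> verts \<Gamma> - A. \<exists>v\<in>A. {v, w} \<in> edges \<Gamma>}"

text \<open>In \<^typ>\<open>ereal\<close> the infimum of the empty set is \<open>\<infinity>\<close>; for a finite graph a nonempty
  index set is finite, so the infimum is then a minimum.\<close>

definition graph_cheeger :: "'v graph \<Rightarrow> ereal" where
  "graph_cheeger \<Gamma> =
     (INF A\<in>{A. A \<subseteq> verts \<Gamma> \<and> A \<noteq> {} \<and> real (card A) \<le> real (card (verts \<Gamma>)) / 2}.
        ereal (real (card (vertex_boundary \<Gamma> A)) / real (card A)))"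

definition graph_expander_family :: "(nat \<Rightarrow> 'v graph) \<Rightarrow> bool" where
  "graph_expander_family \<Gamma> \<longleftrightarrow>
     filterlim (\<lambda>i. card (verts (\<Gamma> i))) at_top sequentially \<and>
     (\<exists>d. \<forall>i. \<forall>v\<in>verts (\<Gamma> i). valence (\<Gamma> i) v \<le> d) \<and>
     0 < (INF i. graph_cheeger (\<Gamma> i))"


section \<open>Group presentations and right-angled Artin groups\<close>

text \<open>The letter \<open>(x, True)\<close> stands for the generator \<open>x\<close> and \<open>(x, False)\<close> for its inverse.\<close>

type_synonym 'v word = "('v \<times> bool) list"

abbreviation words :: "'v set \<Rightarrow> 'v word set" where
  "words S \<equiv> lists (S \<times> UNIV)"

inductive word_equiv :: "'v set \<Rightarrow> 'v word set \<Rightarrow> 'v word \<Rightarrow> 'v word \<Rightarrow> bool"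
  for S :: "'v set" and R :: "'v word set" where
  cancel: "x \<in> S \<Longrightarrow> word_equiv S R [(x, b), (x, \<not> b)] []"
| relator: "r \<in> R \<Longrightarrow> r \<in> words S \<Longrightarrow> word_equiv S R r []"
| refl: "u \<in> words S \<Longrightarrow> word_equiv S R u u"
| sym: "word_equiv S R u v \<Longrightarrow> word_equiv S R v u"
| trans: "word_equiv S R u v \<Longrightarrow> word_equiv S R v w \<Longrightarrow> word_equiv S R u w"
| append: "word_equiv S R u u' \<Longrightarrow> word_equiv S R v v' \<Longrightarrow> word_equiv S R (u @ v) (u' @ v')"

definition presented_group :: "'v set \<Rightarrow> 'v word set \<Rightarrow> 'v word set monoid" where
  "presented_group S R =
     \<lparr>carrier = words S // {(u, v). word_equiv S R u v},
      monoid.mult = (\<lambda>X Y. \<Union>u\<in>X. \<Union>v\<in>Y. {w. word_equiv S R (u @ v) w}),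
      one = {w. word_equiv S R [] w}\<rparr>"

definition commutator_word :: "'v \<Rightarrow> 'v \<Rightarrow> 'v word" where
  "commutator_word v w = [(v, True), (w, True), (v, False), (w, False)]"

definition raag :: "'v graph \<Rightarrow> 'v word set monoid" where
  "raag \<Gamma> = presented_group (verts \<Gamma>) {commutator_word v w | v w. {v, w} \<in> edges \<Gamma>}"


section \<open>Rank and centralizers\<close>

text \<open>All infinite ranks are identified with \<open>\<infinity>\<close>, the infimum of the empty set in \<^typ>\<open>enat\<close>.\<close>

definition group_rank :: "('g, 'm) monoid_scheme \<Rightarrow> enat" where
  "group_rank G =
     (INF S\<in>{S. S \<subseteq> carrier G \<and> finite S \<and> generate G S = carrier G}. enat (card S))"

definition centralizer :: "('g, 'm) monoid_scheme \<Rightarrow> 'g \<Rightarrow> 'g set" where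
  "centralizer G x = {y \<in> carrier G. y \<otimes>\<^bsub>G\<^esub> x = x \<otimes>\<^bsub>G\<^esub> y}"


section \<open>Group cohomology with trivial coefficients in a field\<close>

text \<open>Cohomology is that of the inhomogeneous bar complex: an \<open>n\<close>-cochain is a function
  from \<open>G\<^sup>n\<close> to \<open>L\<close>, with \<open>n\<close>-tuples represented by lists of length \<open>n\<close>.\<close>

definition tuples :: "('g, 'm) monoid_scheme \<Rightarrow> nat \<Rightarrow> 'g list set" where
  "tuples G n = {xs. set xs \<subseteq> carrier G \<and> length xs = n}"

definition cochains ::
  "('g, 'm) monoid_scheme \<Rightarrow> ('l, 'k) ring_scheme \<Rightarrow> nat \<Rightarrow> ('l, 'g list \<Rightarrow> 'l) module" where
  "cochains G L n = ring.func_space L (tuples G n)"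

text \<open>\<open>(x\<^sub>1, \<dots>, x\<^sub>n\<^sub>+\<^sub>1) \<mapsto> (x\<^sub>1, \<dots>, x\<^sub>i x\<^sub>i\<^sub>+\<^sub>1, \<dots>, x\<^sub>n\<^sub>+\<^sub>1)\<close> for \<open>1 \<le> i \<le> n\<close>; note that list positions
  are counted from 0.\<close>

definition merge_at :: "('g, 'm) monoid_scheme \<Rightarrow> nat \<Rightarrow> 'g list \<Rightarrow> 'g list" where
  "merge_at G i xs = take (i - 1) xs @ [xs ! (i - 1) \<otimes>\<^bsub>G\<^esub> xs ! i] @ drop (i + 1) xs"

definition coboundary ::
  "('g, 'm) monoid_scheme \<Rightarrow> ('l, 'k) ring_scheme \<Rightarrow> nat \<Rightarrow> ('g list \<Rightarrow> 'l) \<Rightarrow> 'g list \<Rightarrow> 'l" where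
  "coboundary G L n f = (\<lambda>xs\<in>tuples G (n + 1).
     f (tl xs)
     \<oplus>\<^bsub>L\<^esub> (\<Oplus>\<^bsub>L\<^esub>i\<in>{1..n}. ((\<ominus>\<^bsub>L\<^esub> \<one>\<^bsub>L\<^esub>) [^]\<^bsub>L\<^esub> i) \<otimes>\<^bsub>L\<^esub> f (merge_at G i xs))
     \<oplus>\<^bsub>L\<^esub> ((\<ominus>\<^bsub>L\<^esub> \<one>\<^bsub>L\<^esub>) [^]\<^bsub>L\<^esub> (n + 1)) \<otimes>\<^bsub>L\<^esub> f (butlast xs))"

definition cocycles ::
  "('g, 'm) monoid_scheme \<Rightarrow> ('l, 'k) ring_scheme \<Rightarrow> nat \<Rightarrow> ('g list \<Rightarrow> 'l) set" where
  "cocycles G L n =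
     {f \<in> carrier (cochains G L n). coboundary G L n f = \<zero>\<^bsub>cochains G L (n + 1)\<^esub>}"

fun coboundaries ::
  "('g, 'm) monoid_scheme \<Rightarrow> ('l, 'k) ring_scheme \<Rightarrow> nat \<Rightarrow> ('g list \<Rightarrow> 'l) set" where
  "coboundaries G L 0 = {\<zero>\<^bsub>cochains G L 0\<^esub>}"
| "coboundaries G L (Suc n) = coboundary G L n ` carrier (cochains G L n)"

text \<open>The multiplicative fields \<open>mult\<close> and \<open>one\<close> of a module record play no role.\<close>

definition quotient_module :: "('l, 'a) module \<Rightarrow> 'a set \<Rightarrow> ('l, 'a set) module" where
  "quotient_module M N =
     \<lparr>carrier = a_rcosets\<^bsub>M\<^esub> N,
      monoid.mult = (\<lambda>X Y. N),
      one = N,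
      zero = N,
      add = (\<lambda>X Y. X <+>\<^bsub>M\<^esub> Y),
      smult = (\<lambda>c X. \<Union>x\<in>X. N +>\<^bsub>M\<^esub> (c \<odot>\<^bsub>M\<^esub> x))\<rparr>"

definition cohomology ::
  "('g, 'm) monoid_scheme \<Rightarrow> ('l, 'k) ring_scheme \<Rightarrow> nat \<Rightarrow> ('l, ('g list \<Rightarrow> 'l) set) module" where
  "cohomology G L n =
     quotient_module ((cochains G L n)\<lparr>carrier := cocycles G L n\<rparr>) (coboundaries G L n)"

definition cochain_cup ::
  "('g, 'm) monoid_scheme \<Rightarrow> ('l, 'k) ring_scheme \<Rightarrow> nat \<Rightarrow> nat \<Rightarrow>
     ('g list \<Rightarrow> 'l) \<Rightarrow> ('g list \<Rightarrow> 'l) \<Rightarrow> 'g list \<Rightarrow> 'l" where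
  "cochain_cup G L p q f g = (\<lambda>xs\<in>tuples G (p + q). f (take p xs) \<otimes>\<^bsub>L\<^esub> g (drop p xs))"

text \<open>The induced product of cohomology classes. For classes of cocycles all cosets in the union
  coincide.\<close>

definition cup ::
  "('g, 'm) monoid_scheme \<Rightarrow> ('l, 'k) ring_scheme \<Rightarrow> nat \<Rightarrow> nat \<Rightarrow>
     ('g list \<Rightarrow> 'l) set \<Rightarrow> ('g list \<Rightarrow> 'l) set \<Rightarrow> ('g list \<Rightarrow> 'l) set" where
  "cup G L p q X Y =
     (\<Union>f\<in>X. \<Union>g\<in>Y. coboundaries G L (p + q) +>\<^bsub>cochains G L (p + q)\<^esub> cochain_cup G L p q f g)"


section \<open>Cheeger constant of a vector space with a pairing\<close>

locale pairing_triple =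
  V: vectorspace L V + W: vectorspace L W
  for L :: "('l, 'k) ring_scheme"
    and V :: "('l, 'a, 'x) module_scheme"
    and W :: "('l, 'b, 'y) module_scheme" +
  fixes q :: "'a \<Rightarrow> 'a \<Rightarrow> 'b"
  assumes fin_dim: "V.fin_dim"
    and linear_left: "v \<in> carrier V \<Longrightarrow> (\<lambda>u. q u v) \<in> module_hom L V W"
    and linear_right: "u \<in> carrier V \<Longrightarrow> q u \<in> module_hom L V W"
    and symmetric_or_antisymmetric:
      "(\<forall>u\<in>carrier V. \<forall>v\<in>carrier V. q u v = q v u) \<or>
       (\<forall>u\<in>carrier V. \<forall>v\<in>carrier V. q u v = \<ominus>\<^bsub>W\<^esub> q v u)"
begin

definition orthogonal :: "'a set \<Rightarrow> 'a set" where
  "orthogonal F = {v \<in> carrier V. \<forall>f\<in>F. q f v = \<zero>\<^bsub>W\<^esub>}"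

abbreviation sdim :: "'a set \<Rightarrow> real" where
  "sdim F \<equiv> real (vectorspace.dim L (V\<lparr>carrier := F\<rparr>))"

definition cheeger_ratio :: "'a set \<Rightarrow> real" where
  "cheeger_ratio F =
     (sdim (carrier V) - sdim F - sdim (orthogonal F) + sdim (orthogonal F \<inter> F)) / sdim F"

definition cheeger :: ereal where
  "cheeger =
     (INF F\<in>{F. VectorSpace.subspace L F V \<and> 0 < sdim F \<and> sdim F \<le> sdim (carrier V) / 2}.
        ereal (cheeger_ratio F))"

end

definition cohomology_cheeger :: "('g, 'm) monoid_scheme \<Rightarrow> ('l, 'k) ring_scheme \<Rightarrow> ereal" where
  "cohomology_cheeger G L =
     pairing_triple.cheeger L (cohomology G L 1) (cohomology G L 2) (cup G L 1 1)"

end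

theory Submission
  imports Defs "Jordan_Normal_Form.DL_Rank"
begin

text \<open>Each of the three conditions translates into one about the graphs, by a bound that depends neither
on the index nor on the field.

The rank of \<open>A(\<Gamma>)\<close> is the number of vertices (\<open>group_rank_raag\<close>). The vertices generate. For the
lower bound, every set \<open>P\<close> of vertices has a parity homomorphism to the group with two elements
that is nontrivial exactly on the generators in \<open>P\<close>, and a homomorphism is determined by its values
on a generating set \<open>S\<close>; so \<open>2\<^bsup>|V|\<^esup> \<le> 2\<^bsup>|S|\<^esup>\<close>. The argument works for any subgroup and the vertices
it contains (\<open>group_rank_ge\<close>).

Bounded valence means bounded rank of centralizers. The centralizer of a generator contains the
adjacent generators, so its rank is at least the valence (\<open>valence_le_group_rank_centralizer\<close>).
Conversely, valence at most \<open>d\<close> bounds the rank of every centralizer of a nontrivial element by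
\<open>3 d + 1\<close> (\<open>group_rank_centralizer_le\<close>). Centralizers of conjugate elements have the same rank, so
the element may be given by a cyclically reduced word \<open>u\<close>. If \<open>y\<close> commutes with \<open>u\<close>, then for a
suitable power the element \<open>u\<^sup>k y\<close> has a reduced word \<open>z\<close> for which \<open>u z\<close> and \<open>z u\<close> are reduced too,
hence equal up to commutation of letters (\<open>absorb_power\<close>). The letters of \<open>z\<close> outside \<open>u\<close> commute
with all letters of \<open>u\<close>: there are at most \<open>d\<close> such vertices. What remains of \<open>z\<close> consists of
letters of \<open>u\<close> and commutes with \<open>u\<close> as a trace. These traces form a monoid, and one of them is
determined by the multiplicities of a single letter \<open>a\<close> of \<open>u\<close> and of the at most \<open>2 d\<close> letters of
\<open>u\<close> that commute with \<open>a\<close> (\<open>commutant_eqI\<close>). So they generate a subgroup that embeds in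
\<open>\<int>\<^bsup>2 d + 1\<^esup>\<close>, and such a group needs at most \<open>2 d + 1\<close> generators.

For the cohomology, \<open>H\<^sup>1\<close> is the space of homomorphisms to \<open>L\<close>, and these are given by arbitrary
values on the vertices. The cup product of \<open>f\<close> and \<open>g\<close> vanishes if and only if
\<open>f\<^sub>a g\<^sub>b = f\<^sub>b g\<^sub>a\<close> for every edge \<open>{a, b}\<close> (\<open>cup_is_coboundary_iff\<close>): that is the condition for the
pair \<open>(f, g)\<close> to lift to a homomorphism to the Heisenberg group over \<open>L\<close>. So the third
condition concerns this relation on \<open>L\<^sup>V\<close> only. For the subspace of vectors supported on a set \<open>A\<close> of
vertices the ratio \<open>h\<^sub>F\<close> is \<open>|\<partial>A| / |A|\<close>, whence the Cheeger constant of the cup product is at most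
the one of the graph (\<open>cheeger_le_graph_cheeger\<close>).

In the other direction let \<open>F\<close> be any subspace and \<open>C\<close> its orthogonal space, so that the numerator
of \<open>h\<^sub>F\<close> is the codimension of \<open>C + F\<close>. Let \<open>U\<close> be the support of \<open>F\<close> and \<open>Z\<close> the set of common
zeros of \<open>C\<close>. The relation along edges forces the neighbours of \<open>U \<inter> Z\<close> to lie in \<open>Z\<close>, and the
neighbours of \<open>U - Z\<close> to lie in \<open>(U - Z) \<union> (Z - U)\<close>. Along an edge inside \<open>U - Z\<close> zeros of vectors
in \<open>C + F\<close> propagate; so for a maximal independent subset \<open>D\<close> of \<open>U - Z\<close> the codimension of
\<open>C + F\<close> is at least \<open>|U - Z - D| + |Z - U|\<close>. In a graph of valence at most \<open>d\<close> with Cheeger constant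
at least \<open>\<epsilon> > 0\<close>, both \<open>D\<close> and \<open>U \<inter> Z\<close> are then small compared with this codimension, or else
\<open>U \<inter> Z\<close> is nearly the whole graph and \<open>C\<close> is small. In all cases \<open>dim F\<close> is at most
\<open>(d + 1) (1 + 1 / \<epsilon>)\<close> times the codimension (\<open>expansion_bound\<close>, \<open>cheeger_ge\<close>).\<close>

section \<open>Traces: words up to commutation of letters\<close>

text \<open>Words are considered up to commutation of independent letters; their classes are known as
  traces. The involution \<open>bar\<close> stands for inversion of letters, as in the words for the elements of a
  right-angled Artin group, where letters are dependent if their vertices are not joined by an edge.\<close>
locale trace_alphabet =
  fixes dep :: "'a \<Rightarrow> 'a \<Rightarrow> bool"
    and bar :: "'a \<Rightarrow> 'a"
  assumes dep_refl [simp]: "dep a a"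
    and dep_sym: "dep a b \<Longrightarrow> dep b a"
    and bar_bar [simp]: "bar (bar a) = a"
    and bar_neq [simp]: "bar a \<noteq> a"
    and dep_bar [simp]: "dep (bar a) b \<longleftrightarrow> dep a b"
begin

lemma dep_bar_right [simp]: "dep a (bar b) \<longleftrightarrow> dep a b"
  using dep_bar dep_sym by blast

lemma dep_commute: "dep a b \<longleftrightarrow> dep b a"
  using dep_sym by blast

abbreviation proj :: "'a \<Rightarrow> 'a \<Rightarrow> 'a list \<Rightarrow> 'a list" where
  "proj a b \<equiv> filter (\<lambda>c. c = a \<or> c = b)"

text \<open>Equivalence of traces is usually defined as the congruence generated by \<open>a b = b a\<close> for independent
  letters. Two words are equivalent in that sense if and only if their projections to any two
  dependent letters agree. With projections as the definition, cancellation is immediate, and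
  questions about commuting traces reduce to commuting words over two letters.\<close>
definition trace_eq :: "'a list \<Rightarrow> 'a list \<Rightarrow> bool" (infix "\<approx>" 50) where
  "u \<approx> v \<longleftrightarrow> (\<forall>a b. dep a b \<longrightarrow> proj a b u = proj a b v)"

lemma trace_eq_refl [simp]: "u \<approx> u"
  by (simp add: trace_eq_def)

lemma trace_eq_sym: "u \<approx> v \<Longrightarrow> v \<approx> u"
  by (simp add: trace_eq_def)

lemma trace_eq_trans [trans]: "u \<approx> v \<Longrightarrow> v \<approx> w \<Longrightarrow> u \<approx> w"
  by (simp add: trace_eq_def)

lemma trace_eq_Cons_iff [simp]: "c # u \<approx> c # v \<longleftrightarrow> u \<approx> v"
  by (auto simp: trace_eq_def)

lemma trace_eq_cancel_left [simp]: "w @ u \<approx> w @ v \<longleftrightarrow> u \<approx> v"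
  by (auto simp: trace_eq_def)

lemma trace_eq_cancel_right [simp]: "u @ w \<approx> v @ w \<longleftrightarrow> u \<approx> v"
  by (auto simp: trace_eq_def)

lemma trace_eq_count: assumes "u \<approx> v" shows "count_list u a = count_list v a"
proof -
  have "count_list w a = length (proj a a w)" for w
    by (induction w) auto
  moreover have "proj a a u = proj a a v"
    using assms dep_refl unfolding trace_eq_def by blast
  ultimately show ?thesis
    by metis
qed

lemma trace_eq_mset: "u \<approx> v \<Longrightarrow> mset u = mset v"
  by (rule multiset_eqI) (simp add: count_mset trace_eq_count)

lemma trace_eq_set: "u \<approx> v \<Longrightarrow> set u = set v"
  by (metis set_mset_mset trace_eq_mset)

lemma trace_eq_length: "u \<approx> v \<Longrightarrow> length u = length v"
  by (metis size_mset trace_eq_mset)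

lemma trace_eq_Nil_iff [simp]: "u \<approx> [] \<longleftrightarrow> u = []" "[] \<approx> u \<longleftrightarrow> u = []"
  using trace_eq_length by fastforce+

lemma move_front: "\<forall>c\<in>set s. \<not> dep a c \<Longrightarrow> s @ a # t \<approx> a # s @ t"
proof (induction s)
  case (Cons c s)
  have *: "c # a # r \<approx> a # c # r" for r
    using Cons.prems by (auto simp: trace_eq_def dep_commute)
  have "c # s @ a # t \<approx> c # a # s @ t"
    using Cons by simp
  also have "\<dots> \<approx> a # c # s @ t"
    by (rule *)
  finally show ?case by simp
qed simp

lemma commute_words:
  assumes "\<forall>a\<in>set s. \<forall>c\<in>set t. \<not> dep a c"
  shows "s @ t \<approx> t @ s"
  unfolding trace_eq_def
proof (intro allI impI)
  fix a b assume "dep a b"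
  then have "proj a b s = [] \<or> proj a b t = []"
    using assms dep_refl dep_commute unfolding filter_empty_conv by metis
  then show "proj a b (s @ t) = proj a b (t @ s)"
    by auto
qed

text \<open>The word \<open>w\<close> is equivalent to one with first letter \<open>a\<close>. Read off from projections the
  notion is visibly invariant; \<open>begins_iff\<close> and \<open>begins_remove1\<close> give the usual description.\<close>
definition begins :: "'a \<Rightarrow> 'a list \<Rightarrow> bool" where
  "begins a w \<longleftrightarrow> (\<forall>b. dep a b \<longrightarrow> proj a b w \<noteq> [] \<and> hd (proj a b w) = a)"

definition ends :: "'a \<Rightarrow> 'a list \<Rightarrow> bool" where
  "ends a w \<longleftrightarrow> (\<forall>b. dep a b \<longrightarrow> proj a b w \<noteq> [] \<and> last (proj a b w) = a)"

lemma begins_cong: "u \<approx> v \<Longrightarrow> begins a u \<longleftrightarrow> begins a v"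
  by (auto simp: begins_def trace_eq_def)

lemma ends_cong: "u \<approx> v \<Longrightarrow> ends a u \<longleftrightarrow> ends a v"
  by (auto simp: ends_def trace_eq_def)

lemma ends_iff_begins_rev: "ends a w \<longleftrightarrow> begins a (rev w)"
  unfolding ends_def begins_def rev_filter [symmetric] by (simp add: hd_rev)

lemma begins_iff:
  "begins a w \<longleftrightarrow> (\<exists>s t. w = s @ a # t \<and> (\<forall>c\<in>set s. \<not> dep a c))"
proof
  assume b: "begins a w"
  then have "a \<in> set w"
    using dep_refl unfolding begins_def filter_empty_conv by blast
  then obtain s t where st: "w = s @ a # t" "a \<notin> set s"
    using split_list_first by force
  have "\<not> dep a c" if "c \<in> set s" for c
  proof
    assume "dep a c"
    then have "hd (proj a c w) = a"
      using b by (simp add: begins_def)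
    moreover have "proj a c s \<noteq> []"
      using that by (auto simp: filter_empty_conv)
    ultimately have "hd (proj a c s) = a"
      by (simp add: st(1))
    with \<open>proj a c s \<noteq> []\<close> have "a \<in> set (proj a c s)"
      by (metis hd_in_set)
    then show False
      using st(2) by simp
  qed
  with st show "\<exists>s t. w = s @ a # t \<and> (\<forall>c\<in>set s. \<not> dep a c)"
    by blast
next
  assume "\<exists>s t. w = s @ a # t \<and> (\<forall>c\<in>set s. \<not> dep a c)"
  then obtain s t where st: "w = s @ a # t" "\<forall>c\<in>set s. \<not> dep a c"
    by blast
  have "proj a b s = []" if "dep a b" for b
    using st(2) that by (auto simp: filter_empty_conv)
  then show "begins a w"
    by (simp add: begins_def st(1))
qed

lemma beginsE:
  assumes "begins a w"
  obtains s t where "w = s @ a # t" "\<forall>c\<in>set s. \<not> dep a c"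
  using assms unfolding begins_iff by blast

lemma begins_Nil [simp]: "\<not> begins a []"
  by (simp add: begins_iff)

lemma begins_Cons_self [simp]: "begins a (a # w)"
  by (simp add: begins_def)

lemma begins_in_set: "begins a w \<Longrightarrow> a \<in> set w"
  by (auto simp: begins_iff)

lemma ends_in_set: "ends a w \<Longrightarrow> a \<in> set w"
  by (auto simp: ends_iff_begins_rev dest: begins_in_set)

lemma begins_Cons_indep:
  assumes "\<not> dep a c" shows "begins a (c # w) \<longleftrightarrow> begins a w"
proof -
  have *: "proj a b (c # w) = proj a b w" if "dep a b" for b
    using that assms by auto
  show ?thesis
    by (simp only: begins_def * cong: imp_cong)
qed

lemma begins_append_left: "begins a u \<Longrightarrow> begins a (u @ v)"
  by (auto simp: begins_def)

lemma begins_append_indep: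
  "\<forall>c\<in>set u. \<not> dep a c \<Longrightarrow> begins a (u @ v) \<longleftrightarrow> begins a v"
  by (induction u) (auto simp: begins_Cons_indep)

text \<open>The first occurrence of \<open>a\<close> lies either in \<open>u\<close> or in \<open>v\<close>, and in the second case has to be moved
  past all of \<open>u\<close>.\<close>
lemma begins_append_iff:
  "begins a (u @ v) \<longleftrightarrow> begins a u \<or> (\<forall>c\<in>set u. \<not> dep a c) \<and> begins a v"
proof (cases "\<forall>c\<in>set u. \<not> dep a c")
  case True
  then have "\<not> begins a u"
    using begins_in_set by fastforce
  with True show ?thesis
    by (simp add: begins_append_indep)
next
  case False
  have "begins a u" if "begins a (u @ v)"
  proof -
    obtain s t where st: "u @ v = s @ a # t" "\<forall>c\<in>set s. \<not> dep a c"
      using \<open>begins a (u @ v)\<close> by (rule beginsE)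
    from st(1) consider r where "u = s @ r" "r @ v = a # t" | r where "u @ r = s"
      unfolding append_eq_append_conv2 by blast
    then show ?thesis
    proof cases
      case 1
      then show ?thesis
        using st False by (cases r) (auto simp: begins_iff)
    next
      case 2
      then show ?thesis
        using st(2) False by auto
    qed
  qed
  with False show ?thesis
    using begins_append_left by blast
qed

lemma ends_Cons: "ends a u \<Longrightarrow> ends a (c # u)"
  by (simp add: ends_iff_begins_rev begins_append_left)

lemma begins_remove1: 
  assumes "begins a w" shows "w \<approx> a # remove1 a w"
proof -
  obtain s t where st: "w = s @ a # t" "\<forall>c\<in>set s. \<not> dep a c"
    using assms by (rule beginsE)
  then have "remove1 a w = s @ t"
    by (auto simp: remove1_append)
  with st show ?thesis
    by (simp add: move_front)
qed

text \<open>No pair of inverse letters can be brought together by commutations.\<close>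
fun reduced :: "'a list \<Rightarrow> bool" where
  "reduced [] = True"
| "reduced (a # w) = (reduced w \<and> \<not> begins (bar a) w)"

lemma reduced_move_front:
  "\<forall>c\<in>set s. \<not> dep a c \<Longrightarrow> reduced (s @ a # t) \<longleftrightarrow> reduced (a # s @ t)"
proof (induction s)
  case (Cons c s)
  have ca: "\<not> dep a c" "\<not> dep c a"
    using Cons.prems by (auto simp: dep_commute)
  have "begins (bar c) (s @ a # t) \<longleftrightarrow> begins (bar c) (a # s @ t)"
    using Cons.prems by (intro begins_cong move_front) auto
  also have "\<dots> \<longleftrightarrow> begins (bar c) (s @ t)"
    using ca by (simp add: begins_Cons_indep)
  finally have 1: "begins (bar c) (s @ a # t) \<longleftrightarrow> begins (bar c) (s @ t)" .
  have "reduced (c # s @ a # t) \<longleftrightarrow> reduced (s @ t) \<and> \<not> begins (bar a) (s @ t) \<and> \<not> begins (bar c) (s @ t)"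
    using Cons 1 by auto
  then show ?case
    using ca by (auto simp: begins_Cons_indep)
qed simp

text \<open>The recursion of \<open>reduced\<close> follows one representative of the trace. Moving the first letter of \<open>u\<close> to the
  front of \<open>v\<close> reduces the claim to shorter words.\<close>
lemma reduced_cong: "u \<approx> v \<Longrightarrow> reduced u \<longleftrightarrow> reduced v"
proof (induction u arbitrary: v)
  case (Cons a u)
  have "begins a v"
    using begins_cong[OF Cons.prems, of a] by simp
  then obtain s t where st: "v = s @ a # t" "\<forall>c\<in>set s. \<not> dep a c"
    by (rule beginsE)
  have "a # u \<approx> a # s @ t"
    using Cons.prems st move_front trace_eq_trans by blast
  then have ut: "u \<approx> s @ t"
    by simp
  have "reduced v \<longleftrightarrow> reduced (a # s @ t)"
    using st reduced_move_front by blast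
  also have "\<dots> \<longleftrightarrow> reduced (a # u)"
    using Cons.IH[OF ut] begins_cong[OF ut] by simp
  finally show ?case by simp
qed simp

text \<open>A cancellation in \<open>u @ v\<close> pairs a last letter of \<open>u\<close> with a first letter of \<open>v\<close>.\<close>
lemma reduced_append:
  assumes "reduced u" "reduced v" "\<And>a. ends a u \<Longrightarrow> \<not> begins (bar a) v"
  shows "reduced (u @ v)"
  using assms
proof (induction u)
  case (Cons c u)
  have "reduced (u @ v)"
    using Cons by (auto intro: ends_Cons)
  moreover have "\<not> begins (bar c) (u @ v)"
  proof
    assume "begins (bar c) (u @ v)"
    moreover have "\<not> begins (bar c) u"
      using Cons.prems by simp
    ultimately have *: "\<forall>x\<in>set u. \<not> dep c x" "begins (bar c) v"
      by (auto simp: begins_append_iff)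
    then have "ends c (c # u)"
      unfolding ends_iff_begins_rev by (auto simp: begins_iff)
    then show False
      using Cons.prems(3) *(2) by blast
  qed
  ultimately show ?case by simp
qed simp

lemma reduced_appendD1: "reduced (u @ v) \<Longrightarrow> reduced u"
  by (induction u) (auto dest: begins_append_left)

text \<open>Left multiplication of reduced words by a letter. Van der Waerden's method makes this an action of
  the right-angled Artin group on reduced traces, and thereby proves that reduced words for the same element
  are equivalent.\<close>
definition letter_act :: "'a \<Rightarrow> 'a list \<Rightarrow> 'a list" where
  "letter_act a w = (if begins (bar a) w then remove1 (bar a) w else a # w)"

definition normal_form :: "'a list \<Rightarrow> 'a list" where
  "normal_form w = foldr letter_act w []"

lemma normal_form_simps [simp]:
  "normal_form [] = []" "normal_form (a # w) = letter_act a (normal_form w)"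
  by (simp_all add: normal_form_def)

lemma reduced_letter_act: "reduced w \<Longrightarrow> reduced (letter_act a w)"
proof -
  assume r: "reduced w"
  show ?thesis
  proof (cases "begins (bar a) w")
    case True
    then have "reduced (bar a # remove1 (bar a) w)"
      using r reduced_cong[OF begins_remove1] by blast
    with True show ?thesis
      by (simp add: letter_act_def)
  qed (simp add: letter_act_def r)
qed

lemma reduced_foldr_letter_act: "reduced w \<Longrightarrow> reduced (foldr letter_act u w)"
  by (induction u) (auto intro: reduced_letter_act)

lemma reduced_normal_form [simp]: "reduced (normal_form w)"
  by (simp add: normal_form_def reduced_foldr_letter_act)

lemma letter_act_cong: 
  assumes "u \<approx> v" shows "letter_act a u \<approx> letter_act a v"
proof (cases "begins (bar a) u")
  case True
  then have "bar a # remove1 (bar a) u \<approx> bar a # remove1 (bar a) v"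
    using assms begins_cong begins_remove1 trace_eq_sym trace_eq_trans by meson
  then show ?thesis
    using True begins_cong[OF assms] by (simp add: letter_act_def)
next
  case False
  then show ?thesis
    using assms begins_cong[OF assms] by (simp add: letter_act_def)
qed

lemma foldr_letter_act_cong: "v \<approx> w \<Longrightarrow> foldr letter_act u v \<approx> foldr letter_act u w"
  by (induction u) (auto intro: letter_act_cong)

lemma letter_act_inverse:
  assumes "reduced w" shows "letter_act a (letter_act (bar a) w) \<approx> w"
proof (cases "begins a w")
  case True
  then have "reduced (a # remove1 a w)"
    using assms reduced_cong[OF begins_remove1] by blast
  with True show ?thesis
    using begins_remove1 trace_eq_sym by (auto simp: letter_act_def)
qed (simp add: letter_act_def)

text \<open>Neither letter affects whether a word can be made to begin with the other one or its inverse, so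
  the four cases of cancellation are independent of the order.\<close>
lemma letter_act_commute:
  assumes "\<not> dep a b"
  shows "letter_act a (letter_act b w) \<approx> letter_act b (letter_act a w)"
proof -
  have ba: "\<not> dep b a"
    using assms dep_commute by blast
  have ne: "bar a \<noteq> b" "bar b \<noteq> a"
    using assms dep_refl dep_bar_right by metis+
  have swap: "x # y # u \<approx> y # x # u" if "\<not> dep x y" for x y u
    using move_front[of "[x]" y u] that by (auto simp: dep_commute)
  have still: "begins (bar x) (remove1 (bar y) w) \<longleftrightarrow> begins (bar x) w"
    if "begins (bar y) w" "\<not> dep x y" for x y
    using begins_cong[OF begins_remove1[OF that(1)], of "bar x"] that by (simp add: begins_Cons_indep)
  have drop: "remove1 (bar x) (y # u) = y # remove1 (bar x) u" if "\<not> dep x y" for x y u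
    using that by auto
  consider "begins (bar a) w" "begins (bar b) w" | "begins (bar a) w" "\<not> begins (bar b) w"
    | "\<not> begins (bar a) w" "begins (bar b) w" | "\<not> begins (bar a) w" "\<not> begins (bar b) w"
    by blast
  then show ?thesis
  proof cases
    case 1
    let ?r = "remove1 (bar a) (remove1 (bar b) w)" and ?q = "remove1 (bar b) (remove1 (bar a) w)"
    have "?r = ?q"
      by (rule remove1_commute)
    then show ?thesis
      using 1 still assms ba by (simp add: letter_act_def)
  next
    case 2
    then show ?thesis
      using still[of a b] still[of b a] assms ba ne by (simp add: letter_act_def begins_Cons_indep drop)
  next
    case 3
    then show ?thesis
      using still[of a b] still[of b a] assms ba ne by (simp add: letter_act_def begins_Cons_indep drop)
  next
    case 4
    then show ?thesis
      using assms ba by (simp add: letter_act_def begins_Cons_indep swap)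
  qed
qed

lemma normal_form_reduced: "reduced w \<Longrightarrow> normal_form w = w"
  by (induction w) (auto simp: letter_act_def)

lemma length_letter_act: "length (letter_act a w) \<le> Suc (length w)"
  by (auto simp: letter_act_def length_remove1)

lemma length_foldr_letter_act: "length (foldr letter_act u w) \<le> length u + length w"
  by (induction u) (auto intro: le_trans[OF length_letter_act])

lemma length_normal_form: "length (normal_form w) \<le> length w"
  using length_foldr_letter_act[of w "[]"] by (simp add: normal_form_def)

text \<open>Each letter acts by lengthening or shortening a word by one, so a word loses length precisely when some
  letter cancels.\<close>
lemma reduced_iff_length: "reduced w \<longleftrightarrow> length (normal_form w) = length w"
proof
  show "length (normal_form w) = length w" if "reduced w"
    using that by (simp add: normal_form_reduced)
  show "reduced w" if "length (normal_form w) = length w"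
    using that
  proof (induction w)
    case (Cons a w)
    have "length (normal_form w) = length w"
      using Cons.prems length_letter_act[of a "normal_form w"] length_normal_form[of w] by simp
    with Cons.IH have r: "reduced w" by simp
    have "\<not> begins (bar a) w"
    proof
      assume b: "begins (bar a) w"
      then have "bar a \<in> set w"
        by (rule begins_in_set)
      then show False
        using Cons.prems r b by (simp add: normal_form_reduced letter_act_def length_remove1 split: if_splits)
    qed
    with r show ?case by simp
  qed simp
qed

end

section \<open>Commuting traces\<close>

text \<open>Commuting words are powers of a common word, hence have proportional letter counts.\<close>
lemma commuting_words_count:
  assumes "p @ q = q @ p"
  shows "count_list p a * count_list q b = count_list p b * count_list q a"
proof -
  obtain m n zs where "concat (replicate m zs) = p" "concat (replicate n zs) = q"
    using comm_append_are_replicate[OF assms] by blast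
  moreover have "count_list (concat (replicate k zs)) c = k * count_list zs c" for k c
    by (induction k) auto
  ultimately have "count_list p c = m * count_list zs c" "count_list q c = n * count_list zs c" for c
    by blast+
  then show ?thesis
    by simp
qed

lemma commuting_words_hd: "\<lbrakk>p @ q = q @ p; p \<noteq> []; q \<noteq> []\<rbrakk> \<Longrightarrow> hd p = hd q"
  by (cases p; cases q) auto

lemma commuting_words_last: "\<lbrakk>p @ q = q @ p; p \<noteq> []; q \<noteq> []\<rbrakk> \<Longrightarrow> last p = last q"
  by (metis last_appendR)

text \<open>Both words are prefixes of a sufficiently high power of \<open>u\<close>.\<close>
lemma commuting_words_eqI:
  assumes "p @ u = u @ p" "q @ u = u @ q" "length p = length q" "u \<noteq> []"
  shows "p = q"
proof -
  let ?N = "concat (replicate (length p) u)"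
  have comm: "r @ concat (replicate k u) = concat (replicate k u) @ r" if "r @ u = u @ r" for r k
  proof (induction k)
    case (Suc k)
    have "r @ u @ concat (replicate k u) = u @ r @ concat (replicate k u)"
      using that by (metis append.assoc)
    then show ?case
      using Suc by simp
  qed simp
  have "length ?N = length p * length u"
    by (simp add: length_concat sum_list_replicate)
  then have "length p \<le> length ?N"
    using assms(4) by (cases u) auto
  then have "take (length p) (?N @ p) = take (length p) (?N @ q)"
    by simp
  then have "take (length p) (p @ ?N) = take (length p) (q @ ?N)"
    by (simp only: comm[OF assms(1)] comm[OF assms(2)])
  then show ?thesis
    using assms(3) by simp
qed

context trace_alphabet
begin

lemma commuting_traces_proj:
  "\<lbrakk>u @ w \<approx> w @ u; dep a b\<rbrakk> \<Longrightarrow> proj a b w @ proj a b u = proj a b u @ proj a b w"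
  by (simp add: trace_eq_def)

lemma commuting_traces_begins:
  assumes "u @ w \<approx> w @ u" "a \<in> set u" "begins a w"
  shows "begins a u"
  unfolding begins_def
proof (intro allI impI)
  fix b assume ab: "dep a b"
  have "proj a b w @ proj a b u = proj a b u @ proj a b w"
    using assms(1) ab by (rule commuting_traces_proj)
  moreover have "proj a b w \<noteq> []" "hd (proj a b w) = a"
    using assms(3) ab by (auto simp: begins_def)
  moreover have "proj a b u \<noteq> []"
    using assms(2) by (auto simp: filter_empty_conv)
  ultimately show "proj a b u \<noteq> [] \<and> hd (proj a b u) = a"
    using commuting_words_hd by fastforce
qed

lemma commuting_traces_ends:
  assumes "u @ w \<approx> w @ u" "a \<in> set u" "ends a w"
  shows "ends a u"
  unfolding ends_def
proof (intro allI impI)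
  fix b assume ab: "dep a b"
  have "proj a b w @ proj a b u = proj a b u @ proj a b w"
    using assms(1) ab by (rule commuting_traces_proj)
  moreover have "proj a b w \<noteq> []" "last (proj a b w) = a"
    using assms(3) ab by (auto simp: ends_def)
  moreover have "proj a b u \<noteq> []"
    using assms(2) by (auto simp: filter_empty_conv)
  ultimately show "proj a b u \<noteq> [] \<and> last (proj a b u) = a"
    using commuting_words_last by fastforce
qed

text \<open>In the projection to \<open>a\<close> and \<open>c\<close> the counts of the letters would be proportional; but \<open>c\<close> occurs in
  \<open>w\<close> and not in \<open>u\<close>, whereas \<open>a\<close> occurs in \<open>u\<close>.\<close>
lemma commuting_traces_outside:
  assumes "u @ w \<approx> w @ u" "c \<in> set w" "c \<notin> set u" "a \<in> set u"
  shows "\<not> dep a c"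
proof
  assume ac: "dep a c"
  have "count_list (proj a c w) a * count_list (proj a c u) c
      = count_list (proj a c w) c * count_list (proj a c u) a"
    using commuting_traces_proj[OF assms(1) ac] by (rule commuting_words_count)
  moreover have "count_list (proj a c v) d = count_list v d" if "d \<in> {a, c}" for v d
    using that by (induction v) auto
  ultimately have "count_list w a * count_list u c = count_list w c * count_list u a"
    by simp
  moreover have "count_list u c = 0" "count_list w c \<noteq> 0" "count_list u a \<noteq> 0"
    using assms by (auto simp: count_list_0_iff)
  ultimately show False
    by simp
qed

text \<open>The letters of \<open>w\<close> outside \<open>u\<close> are independent of those of \<open>u\<close>, so they can be collected at the end; cancelling
  them leaves a trace that commutes with \<open>u\<close>.\<close>
lemma commuting_traces_split:
  assumes "u @ w \<approx> w @ u"
  defines "w1 \<equiv> filter (\<lambda>c. c \<in> set u) w" and "w2 \<equiv> filter (\<lambda>c. c \<notin> set u) w"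
  shows "w \<approx> w1 @ w2" "u @ w1 \<approx> w1 @ u" "\<And>a c. a \<in> set u \<Longrightarrow> c \<in> set w2 \<Longrightarrow> \<not> dep a c"
proof -
  show out: "\<not> dep a c" if "a \<in> set u" "c \<in> set w2" for a c
    using commuting_traces_outside[OF assms(1)] that by (auto simp: w2_def)
  show split: "w \<approx> w1 @ w2"
    unfolding trace_eq_def
  proof (intro allI impI)
    fix a b assume ab: "dep a b"
    have "\<not> (\<exists>c\<in>set w. (c = a \<or> c = b) \<and> c \<in> set u) \<or> \<not> (\<exists>c\<in>set w. (c = a \<or> c = b) \<and> c \<notin> set u)"
      using commuting_traces_outside[OF assms(1)] ab dep_commute by metis
    then show "proj a b w = proj a b (w1 @ w2)"
    proof
      assume *: "\<not> (\<exists>c\<in>set w. (c = a \<or> c = b) \<and> c \<in> set u)"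
      then have "proj a b w1 = []" "proj a b w2 = proj a b w"
        unfolding w1_def w2_def filter_filter by (auto simp: filter_empty_conv intro!: filter_cong)
      then show ?thesis by simp
    next
      assume *: "\<not> (\<exists>c\<in>set w. (c = a \<or> c = b) \<and> c \<notin> set u)"
      then have "proj a b w2 = []" "proj a b w1 = proj a b w"
        unfolding w1_def w2_def filter_filter by (auto simp: filter_empty_conv intro!: filter_cong)
      then show ?thesis by simp
    qed
  qed
  have "(u @ w1) @ w2 \<approx> u @ w"
    using trace_eq_sym[OF split] by simp
  also have "\<dots> \<approx> w @ u"
    by (rule assms(1))
  also have "\<dots> \<approx> w1 @ w2 @ u"
    using split by (metis append.assoc trace_eq_cancel_right)
  also have "\<dots> \<approx> (w1 @ u) @ w2"
    using commute_words[of w2 u] out dep_commute by (metis append.assoc trace_eq_cancel_left)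
  finally show "u @ w1 \<approx> w1 @ u"
    by (simp only: trace_eq_cancel_right)
qed

text \<open>For letters that depend on \<open>a\<close> the counts in \<open>w\<close> are proportional to those in \<open>u\<close>, with a ratio fixed by the
  count of \<open>a\<close>. So \<open>w\<close> and \<open>w'\<close> agree in all counts. Then each of their projections is a word
  of known length that commutes with the projection of \<open>u\<close>, and \<open>commuting_words_eqI\<close> applies.\<close>
lemma commuting_traces_eqI:
  assumes w: "u @ w \<approx> w @ u" "set w \<subseteq> set u" and w': "u @ w' \<approx> w' @ u" "set w' \<subseteq> set u"
    and a: "a \<in> set u"
    and count: "\<And>b. b \<in> set u \<Longrightarrow> b = a \<or> \<not> dep a b \<Longrightarrow> count_list w b = count_list w' b"
  shows "w \<approx> w'"
proof -
  have count_proj: "count_list (proj c d v) e = count_list v e" if "e \<in> {c, d}" for c d e v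
    using that by (induction v) auto
  have ratio: "count_list v b * count_list u a = count_list v a * count_list u b"
    if "u @ v \<approx> v @ u" "dep a b" for v b
    using commuting_words_count[OF commuting_traces_proj[OF that], of b a] by (simp add: count_proj)
  have count': "count_list w b = count_list w' b" for b
  proof (cases "b \<in> set u \<and> dep a b")
    case True
    have "count_list w a = count_list w' a"
      using count a by blast
    then have "count_list w b * count_list u a = count_list w' b * count_list u a"
      using ratio[OF w(1)] ratio[OF w'(1)] True by metis
    moreover have "count_list u a \<noteq> 0"
      using a by (simp add: count_list_0_iff)
    ultimately show ?thesis by simp
  next
    case False
    then show ?thesis
      using count w(2) w'(2) by (metis count_list_0_iff subsetD)
  qed
  show ?thesis
    unfolding trace_eq_def
  proof (intro allI impI)
    fix c d assume cd: "dep c d"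
    have length_proj: "length (proj c d v) = count_list v c + (if c = d then 0 else count_list v d)" for v
      by (induction v) auto
    show "proj c d w = proj c d w'"
    proof (cases "proj c d u = []")
      case True
      then have "proj c d w = []" "proj c d w' = []"
        using w(2) w'(2) by (auto simp: filter_empty_conv)
      then show ?thesis by simp
    next
      case False
      show ?thesis
        using commuting_traces_proj[OF w(1) cd] commuting_traces_proj[OF w'(1) cd] _ False
        by (rule commuting_words_eqI) (simp add: length_proj count')
    qed
  qed
qed

definition cyclically_reduced :: "'a list \<Rightarrow> bool" where
  "cyclically_reduced u \<longleftrightarrow> reduced u \<and> (\<forall>a. ends a u \<longrightarrow> \<not> begins (bar a) u)"

text \<open>Reduced words over the letters of \<open>u\<close> that commute with \<open>u\<close> as traces. In the group generated by the
  letters they will account for the centralizer of \<open>u\<close>, up to letters that commute with all of \<open>u\<close>.\<close>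
definition commutant :: "'a list \<Rightarrow> 'a list set" where
  "commutant u = {w. reduced w \<and> set w \<subseteq> set u \<and> u @ w \<approx> w @ u}"

lemma Nil_in_commutant [simp]: "[] \<in> commutant u"
  by (simp add: commutant_def)

text \<open>A cancellation between \<open>v\<close> and \<open>w\<close> involves a last letter of \<open>v\<close> and a first letter of \<open>w\<close>. Both words commute
  with \<open>u\<close>, so these would be a last and a first letter of \<open>u\<close>, against cyclic reducedness.\<close>
lemma append_in_commutant:
  assumes u: "cyclically_reduced u" and v: "v \<in> commutant u" and w: "w \<in> commutant u"
  shows "v @ w \<in> commutant u"
proof -
  have "reduced (v @ w)"
  proof (rule reduced_append)
    show "\<not> begins (bar a) w" if "ends a v" for a
    proof
      assume b: "begins (bar a) w"
      have "a \<in> set u" "bar a \<in> set u"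
        using v w ends_in_set[OF that] begins_in_set[OF b] by (auto simp: commutant_def)
      then have "ends a u" "begins (bar a) u"
        using v w that b by (auto simp: commutant_def intro: commuting_traces_begins commuting_traces_ends)
      then show False
        using u by (simp add: cyclically_reduced_def)
    qed
  qed (use v w in \<open>auto simp: commutant_def\<close>)
  moreover have "u @ v @ w \<approx> (v @ w) @ u"
  proof -
    have "(u @ v) @ w \<approx> (v @ u) @ w"
      using v unfolding trace_eq_cancel_right by (simp add: commutant_def)
    also have "(v @ u) @ w \<approx> v @ w @ u"
      using w by (simp add: commutant_def)
    finally show ?thesis by simp
  qed
  ultimately show ?thesis
    using v w by (auto simp: commutant_def)
qed

lemma commutant_eqI:
  assumes "v \<in> commutant u" "w \<in> commutant u" "a \<in> set u"
    and "\<And>b. b \<in> set u \<Longrightarrow> b = a \<or> \<not> dep a b \<Longrightarrow> count_list v b = count_list w b"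
  shows "v \<approx> w"
  using assms by (intro commuting_traces_eqI[of u v w a]) (auto simp: commutant_def)

lemma self_in_commutant: "reduced u \<Longrightarrow> u \<in> commutant u"
  by (simp add: commutant_def)

text \<open>A trace that fails to be cyclically reduced is the conjugate of a shorter one; the two occurrences
  are distinct because \<open>bar a \<noteq> a\<close>.\<close>
lemma cancel_ends:
  assumes "begins (bar a) u" "ends a u"
  obtains s where "u \<approx> bar a # s @ [a]"
proof -
  let ?r = "remove1 (bar a) u"
  have u: "u \<approx> bar a # ?r"
    using assms(1) by (rule begins_remove1)
  have "ends a ?r"
    unfolding ends_def
  proof (intro allI impI)
    fix b assume ab: "dep a b"
    have "ends a (bar a # ?r)"
      using ends_cong[OF u] assms(2) by simp
    then have "last (proj a b (bar a # ?r)) = a" "proj a b (bar a # ?r) \<noteq> []"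
      using ab by (simp_all add: ends_def)
    then show "proj a b ?r \<noteq> [] \<and> last (proj a b ?r) = a"
      using bar_neq[of a] by (auto split: if_splits)
  qed
  then have "begins a (rev ?r)"
    by (simp add: ends_iff_begins_rev)
  then obtain s t where st: "rev ?r = s @ a # t" "\<forall>c\<in>set s. \<not> dep a c"
    by (rule beginsE)
  then have "?r = rev t @ [a] @ rev s"
    by (metis append.assoc append_Cons append_Nil rev.simps(2) rev_append rev_rev_ident)
  moreover have "[a] @ rev s \<approx> rev s @ [a]"
    using st(2) by (intro commute_words) auto
  ultimately have "?r \<approx> rev t @ rev s @ [a]"
    by simp
  then have "bar a # ?r \<approx> bar a # (rev t @ rev s) @ [a]"
    by simp
  with u that show thesis
    using trace_eq_trans by blast
qed

lemma power_in_commutant: 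
  assumes "cyclically_reduced u" shows "concat (replicate k u) \<in> commutant u"
proof (induction k)
  case (Suc k)
  then show ?case
    using append_in_commutant[OF assms self_in_commutant] assms by (simp add: cyclically_reduced_def)
qed simp

end

section \<open>Groups given by presentations\<close>

text \<open>These rules unfold membership in \<open>lists\<close> into a quantifier over the letters of a word; below, words are
  taken apart by the rules for concatenation.\<close>
declare in_listsD [rule del] in_listsI [rule del]

definition word_class :: "'v set \<Rightarrow> 'v word set \<Rightarrow> 'v word \<Rightarrow> 'v word set" where
  "word_class S R u = {w. word_equiv S R u w}"

definition inverse_word :: "'v word \<Rightarrow> 'v word" where
  "inverse_word w = rev (map (\<lambda>(x, b). (x, \<not> b)) w)"

lemma inverse_word_simps [simp]:
  "inverse_word [] = []" "inverse_word ((x, b) # w) = inverse_word w @ [(x, \<not> b)]"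
  by (simp_all add: inverse_word_def)

lemma inverse_word_in_words: "w \<in> words S \<Longrightarrow> inverse_word w \<in> words S"
  by (induction w) auto

lemma length_inverse_word [simp]: "length (inverse_word w) = length w"
  by (simp add: inverse_word_def)

lemma word_equiv_words: "word_equiv S R u v \<Longrightarrow> u \<in> words S \<and> v \<in> words S"
  by (induction rule: word_equiv.induct) auto

lemma word_equiv_inverse_left: "w \<in> words S \<Longrightarrow> word_equiv S R (inverse_word w @ w) []"
proof (induction w)
  case (Cons c w)
  obtain x b where c: "c = (x, b)" by force
  have x: "x \<in> S" and w: "w \<in> words S"
    using Cons c by auto
  have "word_equiv S R [(x, \<not> b), (x, b)] []"
    using word_equiv.cancel[OF x, of R "\<not> b"] by simp
  from word_equiv.append[OF this word_equiv.refl[OF w]]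
  have "word_equiv S R ([(x, \<not> b), (x, b)] @ w) ([] @ w)" .
  from word_equiv.append[OF word_equiv.refl[OF inverse_word_in_words[OF w]] this]
  have "word_equiv S R (inverse_word w @ [(x, \<not> b), (x, b)] @ w) (inverse_word w @ w)"
    by simp
  from word_equiv.trans[OF this Cons.IH[OF w]] show ?case
    by (simp add: c)
qed (simp add: word_equiv.refl)

text \<open>On words outside \<open>words S\<close> the relation is not reflexive, which accounts for the assumption.\<close>
lemma word_class_eq_iff:
  assumes "u \<in> words S"
  shows "word_class S R u = word_class S R v \<longleftrightarrow> word_equiv S R u v"
proof
  assume "word_class S R u = word_class S R v"
  moreover have "u \<in> word_class S R u"
    using assms by (simp add: word_class_def word_equiv.refl)
  ultimately have "word_equiv S R v u"
    by (simp add: word_class_def)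
  then show "word_equiv S R u v"
    by (rule word_equiv.sym)
next
  assume uv: "word_equiv S R u v"
  show "word_class S R u = word_class S R v"
    unfolding word_class_def
    by (rule Collect_cong, rule iffI, erule word_equiv.trans[OF word_equiv.sym[OF uv]],
        erule word_equiv.trans[OF uv])
qed

lemma presented_group_carrier: "carrier (presented_group S R) = word_class S R ` words S"
  by (auto simp: presented_group_def quotient_def word_class_def)

lemma word_class_closed [simp]: "u \<in> words S \<Longrightarrow> word_class S R u \<in> carrier (presented_group S R)"
  by (simp add: presented_group_carrier)

lemma presented_group_one: "\<one>\<^bsub>presented_group S R\<^esub> = word_class S R []"
  by (simp add: presented_group_def word_class_def)

lemma word_class_mult:
  assumes "u \<in> words S" "v \<in> words S"
  shows "word_class S R u \<otimes>\<^bsub>presented_group S R\<^esub> word_class S R v = word_class S R (u @ v)"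
proof -
  have *: "word_class S R (u @ v) = word_class S R (u' @ v')"
    if "u' \<in> word_class S R u" "v' \<in> word_class S R v" for u' v'
    using word_class_eq_iff[of "u @ v" S R "u' @ v'"] that assms
    by (simp add: word_class_def word_equiv.append)
  have "word_class S R u \<otimes>\<^bsub>presented_group S R\<^esub> word_class S R v
      = (\<Union>u'\<in>word_class S R u. \<Union>v'\<in>word_class S R v. word_class S R (u' @ v'))"
    by (simp add: presented_group_def word_class_def)
  also have "\<dots> = (\<Union>u'\<in>word_class S R u. \<Union>v'\<in>word_class S R v. word_class S R (u @ v))"
    by (intro SUP_cong HOL.refl *[symmetric])
  also have "\<dots> = word_class S R (u @ v)"
  proof -
    have "u \<in> word_class S R u" "v \<in> word_class S R v"
      using assms by (simp_all add: word_class_def word_equiv.refl)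
    then show ?thesis
      by auto
  qed
  finally show ?thesis .
qed

theorem presented_group_is_group: "group (presented_group S R)"
proof (rule groupI)
  show "\<exists>y\<in>carrier (presented_group S R). y \<otimes>\<^bsub>presented_group S R\<^esub> x = \<one>\<^bsub>presented_group S R\<^esub>"
    if x: "x \<in> carrier (presented_group S R)" for x
  proof -
    obtain w where w: "w \<in> words S" "x = word_class S R w"
      using x by (auto simp: presented_group_carrier)
    have "word_class S R (inverse_word w) \<otimes>\<^bsub>presented_group S R\<^esub> x = \<one>\<^bsub>presented_group S R\<^esub>"
      using w word_equiv_inverse_left[OF w(1)] inverse_word_in_words[OF w(1)]
      by (simp add: word_class_mult presented_group_one word_class_eq_iff)
    then show ?thesis
      by (rule bexI[OF _ word_class_closed[OF inverse_word_in_words[OF w(1)]]])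
  qed
qed (auto simp: presented_group_carrier word_class_mult presented_group_one)

lemma inv_word_class:
  assumes "w \<in> words S"
  shows "inv\<^bsub>presented_group S R\<^esub> word_class S R w = word_class S R (inverse_word w)"
proof -
  interpret group "presented_group S R"
    by (rule presented_group_is_group)
  show ?thesis
    using assms word_equiv_inverse_left[OF assms] inverse_word_in_words[OF assms]
    by (intro inv_equality) (auto simp: word_class_mult presented_group_one word_class_eq_iff)
qed

abbreviation generator_class :: "'v set \<Rightarrow> 'v word set \<Rightarrow> 'v \<Rightarrow> 'v word set" where
  "generator_class S R x \<equiv> word_class S R [(x, True)]"

lemma word_class_in_generate:
  assumes "w \<in> words S" "T \<subseteq> S" "fst ` set w \<subseteq> T"
  shows "word_class S R w \<in> generate (presented_group S R) (generator_class S R ` T)"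
  using assms(1,3)
proof (induction w)
  case Nil
  then show ?case
    using generate.one[of "presented_group S R"] by (simp add: presented_group_one)
next
  case (Cons c w)
  obtain x b where c: "c = (x, b)" by force
  have w: "w \<in> words S"
    using Cons.hyps by simp
  have x: "x \<in> T" "x \<in> S"
    using Cons.prems assms(2) c by auto
  have "word_class S R [(x, b)] \<in> generate (presented_group S R) (generator_class S R ` T)"
  proof (cases b)
    case True
    then show ?thesis
      using x by (auto intro: generate.incl)
  next
    case False
    then have "word_class S R [(x, b)] = inv\<^bsub>presented_group S R\<^esub> generator_class S R x"
      using x by (simp add: inv_word_class)
    then show ?thesis
      using x by (auto intro: generate.inv)
  qed
  then have "word_class S R [(x, b)] \<otimes>\<^bsub>presented_group S R\<^esub> word_class S R w
      \<in> generate (presented_group S R) (generator_class S R ` T)"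
    using Cons w by (intro generate.eng) auto
  then show ?case
    using x w c by (simp add: word_class_mult)
qed

context group
begin

definition evaluate :: "('v \<Rightarrow> 'a) \<Rightarrow> 'v word \<Rightarrow> 'a" where
  "evaluate f w = foldr (\<lambda>(x, b) a. (if b then f x else inv f x) \<otimes> a) w \<one>"

lemma evaluate_simps [simp]:
  "evaluate f [] = \<one>"
  "evaluate f ((x, b) # w) = (if b then f x else inv f x) \<otimes> evaluate f w"
  by (simp_all add: evaluate_def)

lemma evaluate_closed: "\<lbrakk>f \<in> S \<rightarrow> carrier G; w \<in> words S\<rbrakk> \<Longrightarrow> evaluate f w \<in> carrier G"
  by (induction w) (auto simp: Pi_iff)

lemma evaluate_append:
  assumes "f \<in> S \<rightarrow> carrier G" "v \<in> words S" "w \<in> words S"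
  shows "evaluate f (v @ w) = evaluate f v \<otimes> evaluate f w"
  using assms(2)
proof (induction v)
  case (Cons c v)
  then show ?case
    using assms(1,3) evaluate_closed[OF assms(1)] by (cases c) (auto simp: m_assoc Pi_iff)
qed (use evaluate_closed[OF assms(1,3)] in simp)

lemma evaluate_word_equiv:
  assumes "f \<in> S \<rightarrow> carrier G"
    and "\<And>r. r \<in> R \<Longrightarrow> r \<in> words S \<Longrightarrow> evaluate f r = \<one>"
    and "word_equiv S R u v"
  shows "evaluate f u = evaluate f v"
  using assms(3)
proof (induction rule: word_equiv.induct)
  case (cancel x b)
  then show ?case
    using assms(1) by (auto simp: Pi_iff)
next
  case (append u u' v v')
  then show ?case
    using word_equiv_words[OF append.hyps(1)] word_equiv_words[OF append.hyps(2)]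
    by (simp add: evaluate_append[OF assms(1)])
qed (use assms(2) in auto)

text \<open>The universal property of a presentation.\<close>
theorem presented_group_hom:
  assumes "f \<in> S \<rightarrow> carrier G"
    and "\<And>r. r \<in> R \<Longrightarrow> r \<in> words S \<Longrightarrow> evaluate f r = \<one>"
  obtains h where "h \<in> hom (presented_group S R) G"
    and "\<And>w. w \<in> words S \<Longrightarrow> h (word_class S R w) = evaluate f w"
proof -
  define h where "h X = evaluate f (SOME w. w \<in> X)" for X
  have h: "h (word_class S R w) = evaluate f w" if w: "w \<in> words S" for w
  proof -
    have "word_equiv S R w (SOME v. v \<in> word_class S R w)"
      using someI_ex[of "\<lambda>v. v \<in> word_class S R w"] word_equiv.refl[OF w]
      by (auto simp: word_class_def)
    then show ?thesis
      using evaluate_word_equiv[OF assms] by (simp add: h_def)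
  qed
  have "h \<in> hom (presented_group S R) G"
    using assms(1) by (auto simp: hom_def presented_group_carrier h word_class_mult evaluate_append evaluate_closed)
  with h that show thesis by blast
qed

end

text \<open>The uniqueness part of the universal property.\<close>
lemma hom_presented_group_eq_evaluate:
  assumes K: "group K" and h: "h \<in> hom (presented_group S R) K" and w: "w \<in> words S"
  shows "h (word_class S R w) = group.evaluate K (\<lambda>x. h (generator_class S R x)) w"
proof -
  interpret h: group_hom "presented_group S R" K h
    using K h presented_group_is_group by (simp add: group_hom_def group_hom_axioms_def)
  show ?thesis
    using w
  proof (induction w)
    case Nil
    then show ?case
      using h.hom_one by (simp add: presented_group_one)
  next
    case (Cons c w)
    obtain x b where c: "c = (x, b)" by force
    have x: "x \<in> S" and w: "w \<in> words S"
      using Cons c by auto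
    have "h (word_class S R [(x, b)]) = (if b then h (generator_class S R x) else inv\<^bsub>K\<^esub> h (generator_class S R x))"
      using x h.hom_inv[of "generator_class S R x"] by (simp add: inv_word_class)
    moreover have "h (word_class S R (c # w)) = h (word_class S R [(x, b)]) \<otimes>\<^bsub>K\<^esub> h (word_class S R w)"
      using x w c h.hom_mult[of "word_class S R [(x, b)]" "word_class S R w"] by (simp add: word_class_mult)
    ultimately show ?case
      using Cons.IH w c by simp
  qed
qed

section \<open>Generating sets, ranks and centralizers in groups\<close>

context group
begin

lemma subgroup_centralizer:
  assumes "x \<in> carrier G" shows "subgroup (centralizer G x) G"
proof
  show "y \<otimes> z \<in> centralizer G x" if "y \<in> centralizer G x" "z \<in> centralizer G x" for y z
  proof -
    have yz: "y \<in> carrier G" "z \<in> carrier G" "y \<otimes> x = x \<otimes> y" "z \<otimes> x = x \<otimes> z"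
      using that by (auto simp: centralizer_def)
    then have "y \<otimes> z \<otimes> x = y \<otimes> (z \<otimes> x)"
      using assms by (intro m_assoc)
    also have "\<dots> = (y \<otimes> x) \<otimes> z"
      by (simp only: yz(4) m_assoc[OF yz(1) assms yz(2)])
    also have "\<dots> = x \<otimes> (y \<otimes> z)"
      by (simp only: yz(3) m_assoc[OF assms yz(1,2)])
    finally show ?thesis
      using yz(1,2) by (simp add: centralizer_def)
  qed
  show "inv y \<in> centralizer G x" if "y \<in> centralizer G x" for y
  proof -
    have y: "y \<in> carrier G" "y \<otimes> x = x \<otimes> y"
      using that by (auto simp: centralizer_def)
    have "inv y \<otimes> x = inv y \<otimes> (x \<otimes> y) \<otimes> inv y"
      using y(1) assms by (simp add: m_assoc)
    also have "\<dots> = inv y \<otimes> (y \<otimes> x) \<otimes> inv y"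
      by (simp add: y(2))
    also have "\<dots> = x \<otimes> inv y"
      using y(1) assms by (simp add: m_assoc [symmetric])
    finally show ?thesis
      using y(1) by (simp add: centralizer_def)
  qed
qed (use assms in \<open>auto simp: centralizer_def\<close>)

text \<open>A subgroup of \<open>\<int>\<^sup>n\<close> has at most \<open>n\<close> generators. Peel off one coordinate: its kernel is generated by
  \<open>n - 1\<close> elements, and one element with the least positive value of the coordinate is added.\<close>
lemma generators_of_int_coordinates:
  fixes c :: "'i \<Rightarrow> 'a \<Rightarrow> int"
  assumes "finite B" "subgroup H G"
    and add: "\<And>b x y. \<lbrakk>b \<in> B; x \<in> H; y \<in> H\<rbrakk> \<Longrightarrow> c b (x \<otimes> y) = c b x + c b y"
    and inj: "\<And>x. x \<in> H \<Longrightarrow> \<forall>b\<in>B. c b x = 0 \<Longrightarrow> x = \<one>"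
  shows "\<exists>T. T \<subseteq> H \<and> finite T \<and> card T \<le> card B \<and> generate G T = H"
  using assms
proof (induction B arbitrary: H rule: finite_induct)
  case empty
  then have "H = {\<one>}"
    using subgroup.one_closed by fastforce
  then show ?case
    by (intro exI[of _ "{}"]) (simp add: generate_empty)
next
  case (insert b B)
  interpret H: subgroup H G by (rule insert.prems(1))
  have addb: "c b (x \<otimes> y) = c b x + c b y" if "x \<in> H" "y \<in> H" for x y
    using insert.prems(2) that by blast
  have c1: "c b \<one> = 0"
    using addb[of \<one> \<one>] by simp
  have cinv: "c b (inv x) = - c b x" if "x \<in> H" for x
    using addb[of x "inv x"] that c1 by (simp add: eq_neg_iff_add_eq_0 add.commute)
  define K where "K = {x \<in> H. c b x = 0}"
  have K: "subgroup K G"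
    by unfold_locales (auto simp: K_def c1 addb cinv)
  obtain T where T: "T \<subseteq> K" "finite T" "card T \<le> card B" "generate G T = K"
    using insert.IH[OF K] insert.prems(2,3) by (auto simp: K_def)
  have cpow: "c b (x [^] (n::int)) = n * c b x" if x: "x \<in> H" for x n
  proof -
    have xn: "x [^] (m::nat) \<in> H" for m
      by (induction m) (auto simp: x)
    have *: "c b (x [^] m) = int m * c b x" for m :: nat
      by (induction m) (auto simp: c1 addb x xn algebra_simps)
    show ?thesis
    proof (cases n)
      case (nonneg m)
      then show ?thesis
        by (simp only: nonneg int_pow_int *)
    next
      case (neg m)
      then show ?thesis
        by (simp only: neg int_pow_neg_int[OF H.mem_carrier[OF x]] cinv[OF xn] * mult_minus_left)
    qed
  qed
  \<comment> \<open>The values of \<open>c b\<close> form a subgroup of the integers; it is generated by its least positive element.\<close>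
  have "\<exists>h\<in>H. \<forall>x\<in>H. c b h dvd c b x"
  proof (cases "\<exists>x\<in>H. c b x \<noteq> 0")
    case True
    then obtain x where x: "x \<in> H" "c b x \<noteq> 0" by blast
    have "\<exists>n. 0 < n \<and> (\<exists>h\<in>H. c b h = int n)"
    proof (cases "c b x > 0")
      case True
      then show ?thesis
        using x by (intro exI[of _ "nat (c b x)"]) auto
    next
      case False
      then show ?thesis
        using x cinv[OF x(1)] by (intro exI[of _ "nat (- c b x)"] conjI bexI[of _ "inv x"]) auto
    qed
    then obtain n where n: "0 < n" "\<exists>h\<in>H. c b h = int n"
      and least: "\<And>m. m < n \<Longrightarrow> \<not> (0 < m \<and> (\<exists>h\<in>H. c b h = int m))"
      unfolding exists_least_iff[of "\<lambda>n. 0 < n \<and> (\<exists>h\<in>H. c b h = int n)"] by blast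
    obtain h where h: "h \<in> H" "c b h = int n"
      using n(2) by blast
    have "c b h dvd c b y" if y: "y \<in> H" for y
    proof -
      let ?z = "y \<otimes> h [^] (- (c b y div int n))"
      have hz: "h [^] (- (c b y div int n)) \<in> H"
        using h(1) by (meson H.subgroup_axioms subgroup_int_pow_closed)
      have "c b ?z = c b y mod int n"
        using y h hz cpow[OF h(1)] by (simp add: addb minus_div_mult_eq_mod [symmetric])
      moreover have "0 \<le> c b y mod int n" "c b y mod int n < int n"
        using n(1) by auto
      moreover have "?z \<in> H"
        using y hz by blast
      moreover have "\<not> (0 < nat (c b y mod int n) \<and> (\<exists>h\<in>H. c b h = int (nat (c b y mod int n))))"
        using n(1) by (intro least) (simp add: nat_less_iff)
      ultimately have "\<not> 0 < nat (c b y mod int n)"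
        by (metis int_nat_eq)
      with \<open>0 \<le> c b y mod int n\<close> have "c b y mod int n = 0"
        by simp
      then show ?thesis
        using h(2) by auto
    qed
    with h show ?thesis by blast
  next
    case False
    then show ?thesis
      by (intro bexI[of _ \<one>]) auto
  qed
  then obtain h where h: "h \<in> H" "\<And>x. x \<in> H \<Longrightarrow> c b h dvd c b x"
    by blast
  have "generate G (insert h T) = H"
  proof
    have "insert h T \<subseteq> H"
      using h(1) T(1) K_def by blast
    then show "generate G (insert h T) \<subseteq> H"
      by (rule generate_subgroup_incl[OF _ insert.prems(1)])
    show "H \<subseteq> generate G (insert h T)"
    proof
      fix x assume x: "x \<in> H"
      obtain m where m: "c b x = c b h * m"
        using h(2)[OF x] by blast
      have hm: "h [^] m \<in> H"
        using h(1) by (meson H.subgroup_axioms subgroup_int_pow_closed)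
      have "c b (x \<otimes> inv (h [^] m)) = 0"
        using x hm h(1) by (simp add: addb cinv cpow m)
      then have "x \<otimes> inv (h [^] m) \<in> K"
        using x hm by (simp add: K_def)
      then have 1: "x \<otimes> inv (h [^] m) \<in> generate G (insert h T)"
        using T(4) mono_generate[of T "insert h T"] by blast
      have ins: "insert h T \<subseteq> carrier G"
        using h(1) T(1) K_def H.subset by blast
      have 2: "h [^] m \<in> generate G (insert h T)"
        using generate_is_subgroup[OF ins] generate.incl[of h "insert h T"]
        by (meson insertI1 subgroup_int_pow_closed)
      have "x = (x \<otimes> inv (h [^] m)) \<otimes> h [^] m"
        using x hm by (simp add: m_assoc)
      then show "x \<in> generate G (insert h T)"
        using generate.eng[OF 1 2] by simp
    qed
  qed
  moreover have "card (insert h T) \<le> card (insert b B)"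
    using T insert.hyps by (simp add: card_insert_if)
  ultimately show ?case
    using T(1,2) h(1) K_def by (intro exI[of _ "insert h T"]) auto
qed

text \<open>The elements \<open>x y\<^sup>-\<^sup>1\<close> with \<open>x\<close> and \<open>y\<close> in the submonoid form the group of quotients. The counts
  extend to it as differences and embed it in a power of \<open>\<int>\<close>.\<close>
lemma generators_of_commutative_submonoid:
  fixes c :: "'i \<Rightarrow> 'a \<Rightarrow> nat"
  assumes "finite B" and Q: "Q \<subseteq> carrier G" "\<one> \<in> Q" "\<And>x y. x \<in> Q \<Longrightarrow> y \<in> Q \<Longrightarrow> x \<otimes> y \<in> Q"
    and comm: "\<And>x y. x \<in> Q \<Longrightarrow> y \<in> Q \<Longrightarrow> x \<otimes> y = y \<otimes> x"
    and add: "\<And>b x y. \<lbrakk>b \<in> B; x \<in> Q; y \<in> Q\<rbrakk> \<Longrightarrow> c b (x \<otimes> y) = c b x + c b y"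
    and inj: "\<And>x y. \<lbrakk>x \<in> Q; y \<in> Q; \<forall>b\<in>B. c b x = c b y\<rbrakk> \<Longrightarrow> x = y"
  shows "\<exists>T. T \<subseteq> carrier G \<and> finite T \<and> card T \<le> card B \<and> generate G T = generate G Q"
proof -
  \<comment> \<open>The group of quotients.\<close>
  define H where "H = {x \<otimes> inv y | x y. x \<in> Q \<and> y \<in> Q}"
  have carr [simp]: "x \<in> carrier G" if "x \<in> Q" for x
    using Q(1) that by blast
  have inv_comm: "inv y \<otimes> x = x \<otimes> inv y" if "x \<in> Q" "y \<in> Q" for x y
  proof -
    have "inv y \<otimes> x = inv y \<otimes> (x \<otimes> y) \<otimes> inv y"
      using that by (simp add: m_assoc)
    also have "\<dots> = inv y \<otimes> (y \<otimes> x) \<otimes> inv y"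
      using comm that by simp
    also have "\<dots> = x \<otimes> inv y"
      using that by (simp add: m_assoc [symmetric])
    finally show ?thesis .
  qed
  have mult: "(x \<otimes> inv y) \<otimes> (x' \<otimes> inv y') = (x \<otimes> x') \<otimes> inv (y \<otimes> y')"
    if "x \<in> Q" "y \<in> Q" "x' \<in> Q" "y' \<in> Q" for x y x' y'
  proof -
    have "(x \<otimes> inv y) \<otimes> (x' \<otimes> inv y') = x \<otimes> (inv y \<otimes> x') \<otimes> inv y'"
      using that by (simp add: m_assoc)
    also have "\<dots> = x \<otimes> (x' \<otimes> inv y) \<otimes> inv y'"
      using inv_comm that by simp
    also have "\<dots> = (x \<otimes> x') \<otimes> inv (y' \<otimes> y)"
      using that by (simp add: m_assoc inv_mult_group)
    finally show ?thesis
      using comm that by simp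
  qed
  have cancel: "(p \<otimes> inv q) \<otimes> (q \<otimes> r) = p \<otimes> r" if "p \<in> Q" "q \<in> Q" "r \<in> Q" for p q r
  proof -
    have "inv q \<otimes> (q \<otimes> r) = r"
      using that by (simp add: m_assoc [symmetric])
    then show ?thesis
      using that by (simp add: m_assoc)
  qed
  have eq: "x \<otimes> y' = x' \<otimes> y" if "x \<otimes> inv y = x' \<otimes> inv y'" "x \<in> Q" "y \<in> Q" "x' \<in> Q" "y' \<in> Q" for x y x' y'
    using cancel[OF that(2,3,5)] cancel[OF that(4,5,3)] that(1) comm[OF that(3,5)] by simp
  have H: "subgroup H G"
  proof
    show "x \<otimes> y \<in> H" if "x \<in> H" "y \<in> H" for x y
      using that mult Q(3) unfolding H_def by blast
    show "inv x \<in> H" if x: "x \<in> H" for x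
    proof -
      obtain p q where pq: "x = p \<otimes> inv q" "p \<in> Q" "q \<in> Q"
        using x H_def by blast
      then have "inv x = q \<otimes> inv p"
        by (simp add: inv_mult_group)
      then show ?thesis
        using pq H_def by blast
    qed
    show "\<one> \<in> H"
      using Q(2) unfolding H_def by force
  qed (auto simp: H_def)
  have QH: "Q \<subseteq> H"
  proof
    fix x assume "x \<in> Q"
    moreover then have "x = x \<otimes> inv \<one>" by simp
    ultimately show "x \<in> H"
      using Q(2) unfolding H_def by blast
  qed
  have gen: "generate G Q = H"
  proof
    show "generate G Q \<subseteq> H"
      by (rule generate_subgroup_incl[OF QH H])
    show "H \<subseteq> generate G Q"
      by (auto simp: H_def intro: generate.eng generate.incl generate.inv)
  qed
  \<comment> \<open>The difference of counts does not depend on how \<open>h\<close> is written as a quotient.\<close>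
  define e where "e b h = (THE n. \<exists>x y. x \<in> Q \<and> y \<in> Q \<and> h = x \<otimes> inv y \<and> n = int (c b x) - int (c b y))" for b h
  have e: "e b (x \<otimes> inv y) = int (c b x) - int (c b y)" if "b \<in> B" "x \<in> Q" "y \<in> Q" for b x y
    unfolding e_def
  proof (rule the_equality)
    show "n = int (c b x) - int (c b y)"
      if n: "\<exists>x' y'. x' \<in> Q \<and> y' \<in> Q \<and> x \<otimes> inv y = x' \<otimes> inv y' \<and> n = int (c b x') - int (c b y')" for n
    proof -
      obtain x' y' where xy: "x' \<in> Q" "y' \<in> Q" "x \<otimes> inv y = x' \<otimes> inv y'" "n = int (c b x') - int (c b y')"
        using n by blast
      have "c b (x \<otimes> y') = c b (x' \<otimes> y)"
        using eq[OF xy(3)] xy that \<open>x \<in> Q\<close> \<open>y \<in> Q\<close> by simp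
      then have "c b x + c b y' = c b x' + c b y"
        using add \<open>b \<in> B\<close> \<open>x \<in> Q\<close> \<open>y \<in> Q\<close> xy by simp
      then show ?thesis
        using xy(4) by simp
    qed
  qed (use that in blast)
  have "\<exists>T. T \<subseteq> H \<and> finite T \<and> card T \<le> card B \<and> generate G T = H"
  proof (rule generators_of_int_coordinates[OF assms(1) H])
    show "e b (x \<otimes> y) = e b x + e b y" if b: "b \<in> B" and xy: "x \<in> H" "y \<in> H" for b x y
    proof -
      obtain p q r s where pq: "x = p \<otimes> inv q" "p \<in> Q" "q \<in> Q" "y = r \<otimes> inv s" "r \<in> Q" "s \<in> Q"
        using xy H_def by blast
      then have "e b (x \<otimes> y) = int (c b (p \<otimes> r)) - int (c b (q \<otimes> s))"
        using e[OF b Q(3) Q(3)] mult by simp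
      then show ?thesis
        using pq b by (simp add: e add)
    qed
    show "x = \<one>" if x: "x \<in> H" "\<forall>b\<in>B. e b x = 0" for x
    proof -
      obtain p q where pq: "x = p \<otimes> inv q" "p \<in> Q" "q \<in> Q"
        using x H_def by blast
      then have "p = q"
        using x(2) by (intro inj) (auto simp: e)
      then show ?thesis
        using pq by simp
    qed
  qed
  then show ?thesis
    unfolding gen using subgroup.subset[OF H] by blast
qed

end

lemma (in group) conjugation_hom:
  assumes "g \<in> carrier G" shows "group_hom G G (\<lambda>h. g \<otimes> h \<otimes> inv g)"
proof (unfold_locales, rule homI)
  show "g \<otimes> (x \<otimes> y) \<otimes> inv g = (g \<otimes> x \<otimes> inv g) \<otimes> (g \<otimes> y \<otimes> inv g)"
    if "x \<in> carrier G" "y \<in> carrier G" for x y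
  proof -
    have "inv g \<otimes> (g \<otimes> (y \<otimes> inv g)) = y \<otimes> inv g"
      using assms that by (simp add: m_assoc [symmetric])
    then show ?thesis
      using assms that by (simp add: m_assoc)
  qed
qed (use assms in simp)

lemma (in group) centralizer_conjugate:
  assumes g: "g \<in> carrier G" and y: "y \<in> carrier G"
  shows "centralizer G (g \<otimes> y \<otimes> inv g) = (\<lambda>h. g \<otimes> h \<otimes> inv g) ` centralizer G y"
    (is "_ = ?c ` _")
proof -
  interpret c: group_hom G G ?c
    by (rule conjugation_hom[OF g])
  have inj: "h = k" if "?c h = ?c k" "h \<in> carrier G" "k \<in> carrier G" for h k
    using that g by simp
  have comm: "?c h \<in> centralizer G (?c y) \<longleftrightarrow> h \<in> centralizer G y" if h: "h \<in> carrier G" for h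
  proof -
    have "?c (h \<otimes> y) = ?c (y \<otimes> h) \<longleftrightarrow> h \<otimes> y = y \<otimes> h"
      by (rule iffI, rule inj) (simp_all only: h y m_closed)
    then have "?c h \<otimes> ?c y = ?c y \<otimes> ?c h \<longleftrightarrow> h \<otimes> y = y \<otimes> h"
      by (simp only: c.hom_mult[OF h y] c.hom_mult[OF y h])
    then show ?thesis
      by (simp only: centralizer_def mem_Collect_eq h c.hom_closed[OF h] simp_thms)
  qed
  show ?thesis
  proof
    show "?c ` centralizer G y \<subseteq> centralizer G (?c y)"
      using comm by (auto simp: centralizer_def)
    show "centralizer G (?c y) \<subseteq> ?c ` centralizer G y"
    proof
      fix z assume z: "z \<in> centralizer G (?c y)"
      let ?h = "inv g \<otimes> z \<otimes> g"
      have zc: "z \<in> carrier G"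
        using z by (simp add: centralizer_def)
      have "?c ?h = (g \<otimes> inv g) \<otimes> z \<otimes> (g \<otimes> inv g)"
        using g zc by (simp only: m_assoc m_closed inv_closed)
      then have "z = ?c ?h"
        using g zc by simp
      moreover have "?h \<in> carrier G"
        using g zc by simp
      ultimately show "z \<in> ?c ` centralizer G y"
        using z comm by (metis imageI)
    qed
  qed
qed

lemma (in group) group_rank_le:
  assumes "subgroup H G" "finite T" "generate G T = H" "T \<subseteq> H"
  shows "group_rank (G\<lparr>carrier := H\<rparr>) \<le> enat (card T)"
  unfolding group_rank_def using assms generate_consistent[OF assms(4,1)]
  by (intro INF_lower) auto

section \<open>The word problem in right-angled Artin groups\<close>

definition letter_dep :: "'v graph \<Rightarrow> 'v \<times> bool \<Rightarrow> 'v \<times> bool \<Rightarrow> bool" where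
  "letter_dep \<Gamma> a b \<longleftrightarrow> {fst a, fst b} \<notin> edges \<Gamma>"

definition letter_bar :: "'v \<times> bool \<Rightarrow> 'v \<times> bool" where
  "letter_bar a = (fst a, \<not> snd a)"

lemma letter_bar_simp [simp]: "letter_bar (x, b) = (x, \<not> b)"
  by (simp add: letter_bar_def)

definition raag_relators :: "'v graph \<Rightarrow> 'v word set" where
  "raag_relators \<Gamma> = {commutator_word v w | v w. {v, w} \<in> edges \<Gamma>}"

lemma raag_eq: "raag \<Gamma> = presented_group (verts \<Gamma>) (raag_relators \<Gamma>)"
  by (simp add: raag_def raag_relators_def)

locale simplicial_graph =
  fixes \<Gamma> :: "'v graph"
  assumes simplicial: "finite_simplicial_graph \<Gamma>"
begin

lemma finite_verts [simp]: "finite (verts \<Gamma>)"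
  using simplicial by (simp add: finite_simplicial_graph_def)

lemma edgeD: "{v, w} \<in> edges \<Gamma> \<Longrightarrow> v \<in> verts \<Gamma> \<and> w \<in> verts \<Gamma> \<and> v \<noteq> w"
  using simplicial by (fastforce simp: finite_simplicial_graph_def)

sublocale trace_alphabet "letter_dep \<Gamma>" letter_bar
proof
  show "letter_dep \<Gamma> a a" for a
    using edgeD[of "fst a" "fst a"] by (auto simp: letter_dep_def)
  show "letter_bar a \<noteq> a" for a
    by (cases a) (simp add: letter_bar_def)
qed (auto simp: letter_dep_def letter_bar_def insert_commute)

notation trace_eq (infix "\<approx>" 50)

abbreviation relators :: "'v word set" where
  "relators \<equiv> raag_relators \<Gamma>"

abbreviation elt :: "'v word \<Rightarrow> 'v word set" where
  "elt \<equiv> word_class (verts \<Gamma>) relators"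

abbreviation G :: "'v word set monoid" where
  "G \<equiv> raag \<Gamma>"

sublocale group G
  unfolding raag_eq by (rule presented_group_is_group)

lemma raag_carrierE:
  assumes "x \<in> carrier G" obtains w where "w \<in> words (verts \<Gamma>)" "x = elt w"
  using assms by (auto simp: raag_eq presented_group_carrier)

lemma elt_closed [simp]: "w \<in> words (verts \<Gamma>) \<Longrightarrow> elt w \<in> carrier G"
  by (simp add: raag_eq)

lemma elt_mult: "\<lbrakk>u \<in> words (verts \<Gamma>); v \<in> words (verts \<Gamma>)\<rbrakk> \<Longrightarrow> elt u \<otimes>\<^bsub>G\<^esub> elt v = elt (u @ v)"
  by (simp add: raag_eq word_class_mult)

lemma elt_Cons:
  assumes "a \<in> verts \<Gamma> \<times> UNIV" "w \<in> words (verts \<Gamma>)"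
  shows "elt (a # w) = elt [a] \<otimes>\<^bsub>G\<^esub> elt w"
  using elt_mult[of "[a]" w] assms by simp

lemma elt_Nil: "elt [] = \<one>\<^bsub>G\<^esub>"
  by (simp add: raag_eq presented_group_one)

lemma elt_inv: "w \<in> words (verts \<Gamma>) \<Longrightarrow> inv\<^bsub>G\<^esub> elt w = elt (inverse_word w)"
  by (simp add: raag_eq inv_word_class)

lemma elt_eq_iff: "u \<in> words (verts \<Gamma>) \<Longrightarrow> elt u = elt v \<longleftrightarrow> word_equiv (verts \<Gamma>) relators u v"
  by (rule word_class_eq_iff)

lemma elt_cancel: "x \<in> verts \<Gamma> \<Longrightarrow> elt [(x, b), (x, \<not> b)] = \<one>\<^bsub>G\<^esub>"
  unfolding elt_Nil [symmetric] by (subst elt_eq_iff) (auto intro: word_equiv.cancel)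

lemma generators_commute:
  assumes "{v, w} \<in> edges \<Gamma>"
  shows "elt [(v, True)] \<otimes>\<^bsub>G\<^esub> elt [(w, True)] = elt [(w, True)] \<otimes>\<^bsub>G\<^esub> elt [(v, True)]"
proof -
  have vw: "v \<in> verts \<Gamma>" "w \<in> verts \<Gamma>"
    using edgeD[OF assms] by auto
  let ?x = "elt [(v, True)]" and ?y = "elt [(w, True)]"
  have xy: "?x \<in> carrier G" "?y \<in> carrier G"
    using vw by simp_all
  have "commutator_word v w \<in> words (verts \<Gamma>)"
    using vw by (simp add: commutator_word_def)
  then have "elt (commutator_word v w) = \<one>\<^bsub>G\<^esub>"
    unfolding elt_Nil [symmetric] using assms
    by (subst elt_eq_iff) (auto intro!: word_equiv.relator simp: raag_relators_def)
  moreover have "?x \<otimes>\<^bsub>G\<^esub> ?y \<otimes>\<^bsub>G\<^esub> inv\<^bsub>G\<^esub> ?x \<otimes>\<^bsub>G\<^esub> inv\<^bsub>G\<^esub> ?y = elt (commutator_word v w)"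
    using vw by (simp add: elt_inv elt_mult commutator_word_def)
  ultimately have one: "?x \<otimes>\<^bsub>G\<^esub> ?y \<otimes>\<^bsub>G\<^esub> inv\<^bsub>G\<^esub> (?y \<otimes>\<^bsub>G\<^esub> ?x) = \<one>\<^bsub>G\<^esub>"
    using xy by (simp add: inv_mult_group m_assoc [symmetric])
  have "?x \<otimes>\<^bsub>G\<^esub> ?y = (?x \<otimes>\<^bsub>G\<^esub> ?y \<otimes>\<^bsub>G\<^esub> inv\<^bsub>G\<^esub> (?y \<otimes>\<^bsub>G\<^esub> ?x)) \<otimes>\<^bsub>G\<^esub> (?y \<otimes>\<^bsub>G\<^esub> ?x)"
    using xy by (simp add: m_assoc)
  then show ?thesis
    unfolding one using xy by simp
qed

lemma letters_commute:
  assumes "\<not> letter_dep \<Gamma> a c"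
  shows "elt [a] \<otimes>\<^bsub>G\<^esub> elt [c] = elt [c] \<otimes>\<^bsub>G\<^esub> elt [a]"
proof -
  obtain v b w b' where ac: "a = (v, b)" "c = (w, b')"
    by (metis surj_pair)
  have e: "{v, w} \<in> edges \<Gamma>"
    using assms ac by (simp add: letter_dep_def)
  have vw: "v \<in> verts \<Gamma>" "w \<in> verts \<Gamma>"
    using edgeD[OF e] by auto
  have inv_commute: "inv\<^bsub>G\<^esub> x \<otimes>\<^bsub>G\<^esub> y = y \<otimes>\<^bsub>G\<^esub> inv\<^bsub>G\<^esub> x"
    if xy: "x \<in> carrier G" "y \<in> carrier G" and comm: "x \<otimes>\<^bsub>G\<^esub> y = y \<otimes>\<^bsub>G\<^esub> x" for x y
  proof -
    have "x \<in> centralizer G y"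
      using xy comm by (simp add: centralizer_def)
    then have "inv\<^bsub>G\<^esub> x \<in> centralizer G y"
      by (rule subgroup.m_inv_closed[OF subgroup_centralizer[OF xy(2)]])
    then show ?thesis
      by (simp add: centralizer_def)
  qed
  have inv_letter: "elt [(x, False)] = inv\<^bsub>G\<^esub> elt [(x, True)]" if "x \<in> verts \<Gamma>" for x
    using that by (simp add: elt_inv)
  have 1: "elt [(v, b)] \<otimes>\<^bsub>G\<^esub> elt [(w, True)] = elt [(w, True)] \<otimes>\<^bsub>G\<^esub> elt [(v, b)]"
  proof (cases b)
    case False
    then show ?thesis
      using inv_commute[OF _ _ generators_commute[OF e]] vw by (simp add: inv_letter)
  qed (simp add: generators_commute[OF e])
  show ?thesis
  proof (cases b')
    case False
    then show ?thesis
      using inv_commute[OF _ _ 1[symmetric]] vw by (simp add: inv_letter ac)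
  qed (simp add: ac 1)
qed

lemma elt_move_front:
  "\<lbrakk>\<forall>c\<in>set s. \<not> letter_dep \<Gamma> a c; s @ a # t \<in> words (verts \<Gamma>)\<rbrakk> \<Longrightarrow> elt (s @ a # t) = elt (a # s @ t)"
proof (induction s)
  case (Cons c s)
  have w: "[c] \<in> words (verts \<Gamma>)" "[a] \<in> words (verts \<Gamma>)" "s @ t \<in> words (verts \<Gamma>)" "s @ a # t \<in> words (verts \<Gamma>)"
    using Cons.prems(2) by auto
  have "elt ((c # s) @ a # t) = elt [c] \<otimes>\<^bsub>G\<^esub> elt (s @ a # t)"
    using w by (simp add: elt_mult)
  also have "elt (s @ a # t) = elt [a] \<otimes>\<^bsub>G\<^esub> elt (s @ t)"
    using Cons w by (simp add: elt_mult)
  also have "elt [c] \<otimes>\<^bsub>G\<^esub> (elt [a] \<otimes>\<^bsub>G\<^esub> elt (s @ t)) = elt [a] \<otimes>\<^bsub>G\<^esub> (elt [c] \<otimes>\<^bsub>G\<^esub> elt (s @ t))"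
    using letters_commute[of a c] Cons.prems(1) w
    by (metis list.set_intros(1) m_assoc elt_closed)
  also have "\<dots> = elt (a # (c # s) @ t)"
    using w by (simp add: elt_mult)
  finally show ?case .
qed simp

lemma trace_eq_words: "u \<approx> v \<Longrightarrow> u \<in> words (verts \<Gamma>) \<Longrightarrow> v \<in> words (verts \<Gamma>)"
  using trace_eq_set by (auto simp: in_lists_conv_set)

lemma trace_eq_imp_elt_eq: "u \<approx> v \<Longrightarrow> u \<in> words (verts \<Gamma>) \<Longrightarrow> elt u = elt v"
proof (induction u arbitrary: v)
  case (Cons a u)
  have "begins a v"
    using begins_cong[OF Cons.prems(1), of a] by simp
  then obtain s t where st: "v = s @ a # t" "\<forall>c\<in>set s. \<not> letter_dep \<Gamma> a c"
    by (rule beginsE)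
  have v: "v \<in> words (verts \<Gamma>)"
    using Cons.prems by (rule trace_eq_words)
  have "a # u \<approx> a # s @ t"
    using trace_eq_trans[OF Cons.prems(1)] move_front[OF st(2)] st(1) by blast
  then have "elt u = elt (s @ t)"
    using Cons by simp
  then have "elt [a] \<otimes>\<^bsub>G\<^esub> elt u = elt [a] \<otimes>\<^bsub>G\<^esub> elt (s @ t)"
    by simp
  then have "elt (a # u) = elt (a # s @ t)"
    using Cons.prems(2) v st(1) by (simp add: elt_mult)
  also have "\<dots> = elt v"
    using elt_move_front[OF st(2)] v st(1) by simp
  finally show ?case .
qed simp

lemma letter_act_words: "\<lbrakk>a \<in> verts \<Gamma> \<times> UNIV; w \<in> words (verts \<Gamma>)\<rbrakk> \<Longrightarrow> letter_act a w \<in> words (verts \<Gamma>)"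
  using set_remove1_subset by (fastforce simp: letter_act_def in_lists_conv_set)

lemma normal_form_words: "w \<in> words (verts \<Gamma>) \<Longrightarrow> normal_form w \<in> words (verts \<Gamma>)"
  by (induction w) (auto intro: letter_act_words)

lemma elt_letter_act:
  assumes "a \<in> verts \<Gamma> \<times> UNIV" "w \<in> words (verts \<Gamma>)"
  shows "elt (letter_act a w) = elt (a # w)"
proof (cases "begins (letter_bar a) w")
  case True
  let ?r = "remove1 (letter_bar a) w"
  have w: "w \<approx> letter_bar a # ?r"
    using True by (rule begins_remove1)
  have r: "letter_bar a # ?r \<in> words (verts \<Gamma>)" "[a, letter_bar a] \<in> words (verts \<Gamma>)"
    using trace_eq_words[OF w assms(2)] assms(1) by (auto simp: letter_bar_def)
  have "a # w \<approx> [a, letter_bar a] @ ?r"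
    using w by simp
  then have "elt (a # w) = elt ([a, letter_bar a] @ ?r)"
    using assms by (intro trace_eq_imp_elt_eq) auto
  also have "\<dots> = elt [a, letter_bar a] \<otimes>\<^bsub>G\<^esub> elt ?r"
    using r elt_mult by fastforce
  also have "elt [a, letter_bar a] = \<one>\<^bsub>G\<^esub>"
    using assms(1) elt_cancel[of "fst a" "snd a"] by (auto simp: letter_bar_def)
  finally show ?thesis
    using True r by (simp add: letter_act_def)
qed (simp add: letter_act_def)

lemma elt_normal_form: "w \<in> words (verts \<Gamma>) \<Longrightarrow> elt (normal_form w) = elt w"
proof (induction w)
  case (Cons a w)
  then have a: "a \<in> verts \<Gamma> \<times> UNIV" and w: "w \<in> words (verts \<Gamma>)"
    by auto
  have "elt (normal_form (a # w)) = elt (a # normal_form w)"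
    using a w by (simp add: elt_letter_act normal_form_words)
  also have "\<dots> = elt [a] \<otimes>\<^bsub>G\<^esub> elt (normal_form w)"
    by (rule elt_Cons[OF a normal_form_words[OF w]])
  also have "elt (normal_form w) = elt w"
    using Cons.IH w by simp
  also have "elt [a] \<otimes>\<^bsub>G\<^esub> elt w = elt (a # w)"
    by (rule elt_Cons[OF a w, symmetric])
  finally show ?case .
qed simp

text \<open>The action of words on reduced traces factors through the group: relations of the presentation act
  trivially.\<close>
lemma word_equiv_foldr_letter_act:
  assumes "word_equiv (verts \<Gamma>) relators u v" "reduced w"
  shows "foldr letter_act u w \<approx> foldr letter_act v w"
  using assms
proof (induction arbitrary: w rule: word_equiv.induct)
  case (cancel x b)
  then show ?case
    using letter_act_inverse[of w "(x, b)"] by simp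
next
  case (relator r)
  then obtain x y where r: "r = commutator_word x y" "{x, y} \<in> edges \<Gamma>"
    unfolding raag_relators_def by blast
  have nd: "\<not> letter_dep \<Gamma> (y, True) (x, False)"
    using r(2) by (simp add: letter_dep_def insert_commute)
  let ?w = "letter_act (y, False) w"
  \<comment> \<open>The commutator acts trivially: swap the actions of \<open>y\<close> and \<open>x\<^sup>-\<^sup>1\<close>, then cancel twice.\<close>
  have red: "reduced ?w"
    using relator by (intro reduced_letter_act)
  have "letter_act (x, True) (letter_act (y, True) (letter_act (x, False) ?w))
      \<approx> letter_act (x, True) (letter_act (x, False) (letter_act (y, True) ?w))"
    by (rule letter_act_cong[OF letter_act_commute[OF nd]])
  moreover have "letter_act (x, True) (letter_act (x, False) (letter_act (y, True) ?w)) \<approx> letter_act (y, True) ?w"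
    using letter_act_inverse[of "letter_act (y, True) ?w" "(x, True)"] red
    by (simp add: reduced_letter_act)
  moreover have "letter_act (y, True) ?w \<approx> w"
    using letter_act_inverse[of w "(y, True)"] relator by simp
  ultimately have "letter_act (x, True) (letter_act (y, True) (letter_act (x, False) ?w)) \<approx> w"
    using trace_eq_trans by blast
  then show ?case
    by (simp add: r(1) commutator_word_def)
next
  case (sym u v)
  then show ?case by (blast intro: trace_eq_sym)
next
  case (trans u v x)
  then show ?case by (blast intro: trace_eq_trans)
next
  case (append u u' v v')
  have "foldr letter_act u (foldr letter_act v w) \<approx> foldr letter_act u (foldr letter_act v' w)"
    by (rule foldr_letter_act_cong[OF append.IH(2)[OF append.prems]])
  also have "\<dots> \<approx> foldr letter_act u' (foldr letter_act v' w)"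
    by (rule append.IH(1)[OF reduced_foldr_letter_act[OF append.prems]])
  finally show ?case by simp
qed simp

text \<open>The normal form is the result of acting on the empty word, so it depends on the group element only.\<close>
theorem normal_form_unique:
  assumes "u \<in> words (verts \<Gamma>)" "elt u = elt v"
  shows "normal_form u \<approx> normal_form v"
  using word_equiv_foldr_letter_act[of u v "[]"] assms by (simp add: elt_eq_iff normal_form_def)

corollary reduced_unique:
  assumes "reduced u" "reduced v" "u \<in> words (verts \<Gamma>)" "elt u = elt v"
  shows "u \<approx> v"
  using normal_form_unique[OF assms(3,4)] assms(1,2) by (simp add: normal_form_reduced)

text \<open>Word length in the group: by \<open>length_normal_form\<close> and \<open>normal_form_unique\<close> no shorter word represents the same
  element.\<close>
definition word_length :: "'v word \<Rightarrow> nat" where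
  "word_length w = length (normal_form w)"

lemma word_length_cong: "\<lbrakk>u \<in> words (verts \<Gamma>); elt u = elt v\<rbrakk> \<Longrightarrow> word_length u = word_length v"
  using normal_form_unique trace_eq_length by (simp add: word_length_def)

lemma word_length_le: "word_length w \<le> length w"
  by (simp add: word_length_def length_normal_form)

lemma word_length_append:
  assumes "u \<in> words (verts \<Gamma>)" "v \<in> words (verts \<Gamma>)"
  shows "word_length (u @ v) \<le> word_length u + word_length v"
proof -
  have "elt (u @ v) = elt (normal_form u @ normal_form v)"
    using assms by (simp add: elt_mult [symmetric] elt_normal_form normal_form_words)
  then have "word_length (u @ v) = word_length (normal_form u @ normal_form v)"
    using assms by (intro word_length_cong) auto
  also have "\<dots> \<le> length (normal_form u @ normal_form v)"
    by (rule word_length_le)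
  finally show ?thesis
    by (simp add: word_length_def)
qed

end

section \<open>Ranks and centralizers in right-angled Artin groups\<close>

context simplicial_graph
begin

lemma commutant_words: "\<lbrakk>w \<in> commutant u; u \<in> words (verts \<Gamma>)\<rbrakk> \<Longrightarrow> w \<in> words (verts \<Gamma>)"
  by (auto simp: commutant_def in_lists_conv_set)

lemma trace_commute_imp_centralizer:
  assumes "u @ w \<approx> w @ u" "u \<in> words (verts \<Gamma>)" "w \<in> words (verts \<Gamma>)"
  shows "elt w \<in> centralizer G (elt u)"
  using trace_eq_imp_elt_eq[OF assms(1)] assms(2,3) by (simp add: centralizer_def elt_mult)

lemma commutant_centralize:
  assumes "w \<in> commutant u" "u \<in> words (verts \<Gamma>)" shows "elt w \<in> centralizer G (elt u)"
  using assms commutant_words[OF assms] by (intro trace_commute_imp_centralizer) (auto simp: commutant_def)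

text \<open>The lengths of \<open>u\<^sup>k y\<close> grow by at most \<open>|u|\<close> in each step and differ from \<open>k |u|\<close> by at most \<open>|y|\<close>.
  So at some \<open>k\<close> the growth is the largest possible, which means that the reduced word \<open>z\<close> of \<open>u\<^sup>k y\<close>
  extends to a reduced word \<open>u z\<close>. As \<open>z u\<close> represents the same element and has the same length it is reduced
  as well, and reduced words of one element are equivalent.\<close>
lemma absorb_power:
  assumes u: "cyclically_reduced u" "u \<in> words (verts \<Gamma>)"
    and y: "y \<in> words (verts \<Gamma>)" "elt y \<in> centralizer G (elt u)"
  obtains k z where "z \<in> words (verts \<Gamma>)" "reduced z" "elt z = elt (concat (replicate k u) @ y)" "u @ z \<approx> z @ u"
proof -
  \<comment> \<open>The word of the power \<open>u\<^sup>k\<close>, which is reduced since \<open>u\<close> is cyclically reduced.\<close>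
  define P where "P k = concat (replicate k u)" for k
  have P_commutant: "P k \<in> commutant u" for k
    unfolding P_def using u(1) by (rule power_in_commutant)
  have P_words: "P k \<in> words (verts \<Gamma>)" for k
    by (rule commutant_words[OF P_commutant u(2)])
  have lenP: "length (P k) = k * length u" for k
    by (simp add: P_def length_concat sum_list_replicate)
  have bound: "k * length u \<le> word_length (P k @ y) + length y" for k
  proof -
    have iy: "inverse_word y \<in> words (verts \<Gamma>)"
      by (rule inverse_word_in_words[OF y(1)])
    have "elt (P k) = elt ((P k @ y) @ inverse_word y)"
      using P_words[of k] y(1) iy by (simp add: elt_mult [symmetric] elt_inv [symmetric] m_assoc)
    then have "word_length (P k) = word_length ((P k @ y) @ inverse_word y)"
      using P_words by (intro word_length_cong)
    also have "\<dots> \<le> word_length (P k @ y) + word_length (inverse_word y)"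
      using P_words y(1) iy by (intro word_length_append) auto
    also have "\<dots> \<le> word_length (P k @ y) + length y"
      using word_length_le[of "inverse_word y"] by simp
    finally show ?thesis
      using P_commutant[of k] by (simp add: word_length_def normal_form_reduced commutant_def lenP)
  qed
  \<comment> \<open>The excess length of \<open>u ^ k y\<close> over \<open>u ^ k\<close> is bounded below; take \<open>k\<close> where it is least.\<close>
  define f where "f k = word_length (P k @ y) + length y - k * length u" for k
  obtain k where k: "\<And>j. f k \<le> f j"
    using ex_has_least_nat[of "\<lambda>_. True" 0 f] by blast
  define z where "z = normal_form (P k @ y)"
  have z: "z \<in> words (verts \<Gamma>)" "reduced z" "elt z = elt (P k @ y)"
    using P_words[of k] y(1) by (simp_all add: z_def normal_form_words elt_normal_form)
  have uz: "elt (u @ z) = elt (P (Suc k) @ y)"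
    using z u(2) y(1) P_words[of k] by (simp add: elt_mult [symmetric] P_def m_assoc)
  \<comment> \<open>As the excess does not drop at \<open>k + 1\<close>, the step from \<open>k\<close> to \<open>k + 1\<close> adds the full length of \<open>u\<close>.\<close>
  have len: "word_length (u @ z) \<ge> length (u @ z)"
  proof -
    have "word_length (P (Suc k) @ y) \<ge> length u + word_length (P k @ y)"
      using k[of "Suc k"] bound[of k] bound[of "Suc k"] by (simp add: f_def)
    moreover have "word_length (u @ z) = word_length (P (Suc k) @ y)"
      using uz u(2) z(1) by (intro word_length_cong) auto
    ultimately show ?thesis
      by (simp add: z_def word_length_def)
  qed
  have "elt (P k) \<in> centralizer G (elt u)"
    by (rule commutant_centralize[OF P_commutant u(2)])
  then have "elt z \<in> centralizer G (elt u)"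
    using z(3) y P_words[of k] subgroup.m_closed[OF subgroup_centralizer[OF elt_closed[OF u(2)]]]
    by (simp add: elt_mult [symmetric])
  then have eq: "elt (u @ z) = elt (z @ u)"
    using u(2) z(1) by (simp add: centralizer_def elt_mult)
  then have "word_length (u @ z) = word_length (z @ u)"
    using u(2) z(1) by (intro word_length_cong) auto
  then have "reduced (u @ z)" "reduced (z @ u)"
    using len word_length_le[of "u @ z"] word_length_le[of "z @ u"]
    by (auto simp: reduced_iff_length word_length_def)
  then have "u @ z \<approx> z @ u"
    using u(2) z(1) eq by (intro reduced_unique) auto
  with z that show thesis
    by (simp add: P_def)
qed

definition link :: "'v word \<Rightarrow> 'v set" where
  "link u = {v \<in> verts \<Gamma>. \<forall>a\<in>set u. {fst a, v} \<in> edges \<Gamma>}"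

text \<open>Up to a power of \<open>u\<close>, an element of the centralizer is a trace that commutes with \<open>u\<close>, and such a trace splits
  into a part over the letters of \<open>u\<close> and a part over the vertices adjacent to all of \<open>u\<close>.\<close>
lemma centralizer_eq_generate:
  assumes u: "cyclically_reduced u" "u \<in> words (verts \<Gamma>)"
  shows "centralizer G (elt u) = generate G (elt ` commutant u \<union> generator_class (verts \<Gamma>) relators ` link u)"
    (is "?C = generate G (?Q \<union> ?L)")
proof
  have sub: "subgroup ?C G"
    by (rule subgroup_centralizer[OF elt_closed[OF u(2)]])
  have "elt [(v, True)] \<in> ?C" if "v \<in> link u" for v
  proof (rule trace_commute_imp_centralizer)
    show "u @ [(v, True)] \<approx> [(v, True)] @ u"
      using that by (intro commute_words) (auto simp: link_def letter_dep_def)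
  qed (use u(2) that in \<open>auto simp: link_def\<close>)
  then have "?Q \<union> ?L \<subseteq> ?C"
    using commutant_centralize[OF _ u(2)] by blast
  then show "generate G (?Q \<union> ?L) \<subseteq> ?C"
    by (rule generate_subgroup_incl[OF _ sub])
  show "?C \<subseteq> generate G (?Q \<union> ?L)"
  proof
    fix x assume x: "x \<in> ?C"
    then have "x \<in> carrier G"
      by (simp add: centralizer_def)
    then obtain y where y: "y \<in> words (verts \<Gamma>)" "x = elt y"
      by (rule raag_carrierE)
    obtain k z where z: "z \<in> words (verts \<Gamma>)" "reduced z" "elt z = elt (concat (replicate k u) @ y)"
        "u @ z \<approx> z @ u"
      using absorb_power[OF u y(1)] x y(2) by metis
    let ?p = "concat (replicate k u)"
    have p: "?p \<in> commutant u"
      by (rule power_in_commutant[OF u(1)])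
    have pw: "?p \<in> words (verts \<Gamma>)"
      by (rule commutant_words[OF p u(2)])
    define z1 where "z1 = filter (\<lambda>c. c \<in> set u) z"
    define z2 where "z2 = filter (\<lambda>c. c \<notin> set u) z"
    have split: "z \<approx> z1 @ z2" "u @ z1 \<approx> z1 @ u" "\<And>a c. a \<in> set u \<Longrightarrow> c \<in> set z2 \<Longrightarrow> \<not> letter_dep \<Gamma> a c"
      using commuting_traces_split[OF z(4)] by (auto simp: z1_def z2_def)
    have zw: "z1 \<in> words (verts \<Gamma>)" "z2 \<in> words (verts \<Gamma>)"
      using z(1) by (simp_all add: z1_def z2_def in_lists_conv_set)
    have "reduced z1"
      using z(2) reduced_cong[OF split(1)] reduced_appendD1 by blast
    then have z1: "z1 \<in> commutant u"
      using split(2) by (auto simp: commutant_def z1_def)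
    have "fst ` set z2 \<subseteq> link u"
      using split(3) zw(2) by (auto simp: link_def letter_dep_def in_lists_conv_set)
    then have z2: "elt z2 \<in> generate G ?L"
      using word_class_in_generate[OF zw(2), of "link u"] by (auto simp: raag_eq link_def)
    have "x = inv\<^bsub>G\<^esub> elt ?p \<otimes>\<^bsub>G\<^esub> (elt ?p \<otimes>\<^bsub>G\<^esub> x)"
      using y pw by (simp add: m_assoc [symmetric])
    also have "elt ?p \<otimes>\<^bsub>G\<^esub> x = elt z1 \<otimes>\<^bsub>G\<^esub> elt z2"
      using z y pw zw trace_eq_imp_elt_eq[OF split(1)] by (simp add: elt_mult)
    finally have x_eq: "x = inv\<^bsub>G\<^esub> elt ?p \<otimes>\<^bsub>G\<^esub> (elt z1 \<otimes>\<^bsub>G\<^esub> elt z2)" .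
    have "elt z2 \<in> generate G (?Q \<union> ?L)"
      using z2 mono_generate[of ?L "?Q \<union> ?L"] by blast
    then show "x \<in> generate G (?Q \<union> ?L)"
      unfolding x_eq using p z1 by (intro generate.eng generate.inv) (auto intro: generate.incl)
  qed
qed

text \<open>Letter counts are additive on the monoid of the commutant and, for \<open>a\<close> and the letters independent of \<open>a\<close>,
  determine its elements. This also shows that the monoid is commutative.\<close>
lemma commutant_generated:
  assumes u: "cyclically_reduced u" "u \<in> words (verts \<Gamma>)" and a: "a \<in> set u"
  obtains T where "T \<subseteq> carrier G" "finite T" "card T \<le> card (insert a {b \<in> set u. \<not> letter_dep \<Gamma> a b})"
    "generate G T = generate G (elt ` commutant u)"
proof -
  let ?B = "insert a {b \<in> set u. \<not> letter_dep \<Gamma> a b}"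
  define c where "c b X = count_list (SOME w. w \<in> commutant u \<and> elt w = X) b" for b X
  have c: "c b (elt w) = count_list w b" if w: "w \<in> commutant u" for b w
  proof -
    let ?v = "SOME v. v \<in> commutant u \<and> elt v = elt w"
    have v: "?v \<in> commutant u \<and> elt ?v = elt w"
      by (rule someI[of "\<lambda>v. v \<in> commutant u \<and> elt v = elt w" w]) (use w in simp)
    then have "?v \<approx> w"
      using w u(2) commutant_words by (intro reduced_unique) (auto simp: commutant_def)
    then show ?thesis
      unfolding c_def by (rule trace_eq_count)
  qed
  have mult: "elt v \<otimes>\<^bsub>G\<^esub> elt w = elt (v @ w)" if "v \<in> commutant u" "w \<in> commutant u" for v w
    using that u(2) commutant_words by (intro elt_mult) auto
  have app: "v @ w \<in> commutant u" if "v \<in> commutant u" "w \<in> commutant u" for v w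
    using append_in_commutant[OF u(1) that] .
  have eqI: "elt v = elt w" if vw: "v \<in> commutant u" "w \<in> commutant u" and "\<forall>b\<in>?B. count_list v b = count_list w b" for v w
  proof -
    have "v \<approx> w"
      by (rule commutant_eqI[OF vw a]) (use that(3) in auto)
    then show ?thesis
      by (rule trace_eq_imp_elt_eq[OF _ commutant_words[OF vw(1) u(2)]])
  qed
  have "\<exists>T. T \<subseteq> carrier G \<and> finite T \<and> card T \<le> card ?B \<and> generate G T = generate G (elt ` commutant u)"
  proof (rule generators_of_commutative_submonoid[where c = c])
    show "elt ` commutant u \<subseteq> carrier G"
      using u(2) commutant_words by auto
    show "\<one>\<^bsub>G\<^esub> \<in> elt ` commutant u"
      using elt_Nil Nil_in_commutant by (metis imageI)
  next
    fix x y assume "x \<in> elt ` commutant u" "y \<in> elt ` commutant u"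
    then obtain v w where vw: "v \<in> commutant u" "w \<in> commutant u" "x = elt v" "y = elt w"
      by blast
    show "x \<otimes>\<^bsub>G\<^esub> y \<in> elt ` commutant u"
      using vw app by (simp add: mult)
    show "x \<otimes>\<^bsub>G\<^esub> y = y \<otimes>\<^bsub>G\<^esub> x"
      unfolding vw(3,4) mult[OF vw(1,2)] mult[OF vw(2,1)]
      by (rule eqI[OF app[OF vw(1,2)] app[OF vw(2,1)]]) simp
    show "c b (x \<otimes>\<^bsub>G\<^esub> y) = c b x + c b y" if "b \<in> ?B" for b
      by (simp add: vw(3,4) mult[OF vw(1,2)] c[OF app[OF vw(1,2)]] c[OF vw(1)] c[OF vw(2)])
    show "x = y" if "\<forall>b\<in>?B. c b x = c b y"
      unfolding vw(3,4)
      by (rule eqI[OF vw(1,2)]) (use that in \<open>simp only: vw(3,4) c[OF vw(1)] c[OF vw(2)]\<close>)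
  qed simp
  with that show thesis by blast
qed

text \<open>Letters of \<open>u\<close> independent of \<open>a\<close> belong to neighbours of the vertex of \<open>a\<close>, with two letters for each
  vertex.\<close>
lemma card_generators_bound:
  assumes d: "\<forall>v\<in>verts \<Gamma>. valence \<Gamma> v \<le> d" and a: "a \<in> set u" and u: "u \<in> words (verts \<Gamma>)"
  shows "card (insert a {b \<in> set u. \<not> letter_dep \<Gamma> a b}) \<le> 2 * d + 1" "card (link u) \<le> d"
proof -
  let ?N = "{w \<in> verts \<Gamma>. {fst a, w} \<in> edges \<Gamma>}"
  have N: "card ?N \<le> d" "finite ?N"
    using d a u by (auto simp: valence_def in_lists_conv_set)
  have "{b \<in> set u. \<not> letter_dep \<Gamma> a b} \<subseteq> ?N \<times> UNIV"
    using u by (auto simp: letter_dep_def in_lists_conv_set)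
  then have "card {b \<in> set u. \<not> letter_dep \<Gamma> a b} \<le> card (?N \<times> (UNIV :: bool set))"
    using N(2) by (intro card_mono) auto
  also have "\<dots> \<le> 2 * d"
    using N(1) by (simp add: card_cartesian_product)
  finally show "card (insert a {b \<in> set u. \<not> letter_dep \<Gamma> a b}) \<le> 2 * d + 1"
    by (simp add: card_insert_if)
  have "link u \<subseteq> ?N"
    using a by (auto simp: link_def)
  then have "card (link u) \<le> card ?N"
    by (rule card_mono[OF N(2)])
  with N(1) show "card (link u) \<le> d"
    by linarith
qed

text \<open>Take a shortest word among all words for conjugates of \<open>x\<close>.\<close>
lemma cyclically_reduced_conjugate:
  assumes x: "x \<in> carrier G" "x \<noteq> \<one>\<^bsub>G\<^esub>"
  obtains g u where "g \<in> carrier G" "u \<in> words (verts \<Gamma>)" "u \<noteq> []" "cyclically_reduced u"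
    "x = g \<otimes>\<^bsub>G\<^esub> elt u \<otimes>\<^bsub>G\<^esub> inv\<^bsub>G\<^esub> g"
proof -
  define X where "X u \<longleftrightarrow> u \<in> words (verts \<Gamma>) \<and> (\<exists>g\<in>carrier G. x = g \<otimes>\<^bsub>G\<^esub> elt u \<otimes>\<^bsub>G\<^esub> inv\<^bsub>G\<^esub> g)" for u
  obtain w where "w \<in> words (verts \<Gamma>)" "x = elt w"
    using x(1) by (rule raag_carrierE)
  then have "X w"
    unfolding X_def using x(1) by (auto intro!: bexI[of _ "\<one>\<^bsub>G\<^esub>"])
  then obtain u where u: "X u" and least: "\<And>v. X v \<Longrightarrow> length u \<le> length v"
    using ex_has_least_nat[of X w length] by blast
  obtain g where g: "g \<in> carrier G" "x = g \<otimes>\<^bsub>G\<^esub> elt u \<otimes>\<^bsub>G\<^esub> inv\<^bsub>G\<^esub> g" and uw: "u \<in> words (verts \<Gamma>)"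
    using u X_def by blast
  have "X (normal_form u)"
    using u uw by (simp add: X_def elt_normal_form normal_form_words)
  then have red: "reduced u"
    using least[of "normal_form u"] length_normal_form[of u] by (simp add: reduced_iff_length)
  have "\<not> begins (letter_bar a) u" if a: "ends a u" for a
  proof
    assume "begins (letter_bar a) u"
    then obtain s where s: "u \<approx> letter_bar a # s @ [a]"
      using a by (rule cancel_ends)
    have w: "letter_bar a # s @ [a] \<in> words (verts \<Gamma>)"
      by (rule trace_eq_words[OF s uw])
    then have sw: "[letter_bar a] \<in> words (verts \<Gamma>)" "[a] \<in> words (verts \<Gamma>)" "s \<in> words (verts \<Gamma>)"
      by auto
    let ?h = "elt [letter_bar a]"
    have "inverse_word [letter_bar a] = [a]"
      by (cases a) simp
    then have inv_h: "elt [a] = inv\<^bsub>G\<^esub> ?h"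
      using sw by (simp add: elt_inv)
    have "elt u = elt (letter_bar a # s @ [a])"
      by (rule trace_eq_imp_elt_eq[OF s uw])
    also have "\<dots> = ?h \<otimes>\<^bsub>G\<^esub> elt s \<otimes>\<^bsub>G\<^esub> elt [a]"
      using sw by (simp add: elt_mult)
    finally have "x = g \<otimes>\<^bsub>G\<^esub> (?h \<otimes>\<^bsub>G\<^esub> elt s \<otimes>\<^bsub>G\<^esub> inv\<^bsub>G\<^esub> ?h) \<otimes>\<^bsub>G\<^esub> inv\<^bsub>G\<^esub> g"
      unfolding inv_h using g(2) by simp
    also have "\<dots> = (g \<otimes>\<^bsub>G\<^esub> ?h) \<otimes>\<^bsub>G\<^esub> elt s \<otimes>\<^bsub>G\<^esub> inv\<^bsub>G\<^esub> (g \<otimes>\<^bsub>G\<^esub> ?h)"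
      using g(1) sw by (simp add: inv_mult_group m_assoc)
    finally have "X s"
      unfolding X_def using sw g(1) by (intro conjI bexI[of _ "g \<otimes>\<^bsub>G\<^esub> ?h"]) auto
    then show False
      using least[of s] trace_eq_length[OF s] by simp
  qed
  then have "cyclically_reduced u"
    using red by (simp add: cyclically_reduced_def)
  moreover have "u \<noteq> []"
    using g x(2) by (auto simp: elt_Nil)
  ultimately show thesis
    using that g uw by blast
qed

theorem group_rank_centralizer_le:
  assumes d: "\<forall>v\<in>verts \<Gamma>. valence \<Gamma> v \<le> d" and x: "x \<in> carrier G" "x \<noteq> \<one>\<^bsub>G\<^esub>"
  shows "group_rank (G\<lparr>carrier := centralizer G x\<rparr>) \<le> enat (3 * d + 1)"
proof -
  obtain g u where gu: "g \<in> carrier G" "u \<in> words (verts \<Gamma>)" "u \<noteq> []" "cyclically_reduced u"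
      "x = g \<otimes>\<^bsub>G\<^esub> elt u \<otimes>\<^bsub>G\<^esub> inv\<^bsub>G\<^esub> g"
    using x by (rule cyclically_reduced_conjugate)
  obtain a where a: "a \<in> set u"
    using gu(3) by (cases u) auto
  let ?B = "insert a {b \<in> set u. \<not> letter_dep \<Gamma> a b}" and ?L = "generator_class (verts \<Gamma>) relators ` link u"
  obtain T where T: "T \<subseteq> carrier G" "finite T" "card T \<le> card ?B" "generate G T = generate G (elt ` commutant u)"
    using gu(4,2) a by (rule commutant_generated)
  have L: "?L \<subseteq> carrier G" "finite ?L" "card ?L \<le> card (link u)"
    by (auto simp: link_def intro!: card_image_le)
  have Q: "elt ` commutant u \<subseteq> carrier G"
    using gu(2) commutant_words by auto
  have gen: "generate G (T \<union> ?L) = centralizer G (elt u)"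
    unfolding centralizer_eq_generate[OF gu(4,2)]
  proof
    have "T \<subseteq> generate G (elt ` commutant u \<union> ?L)"
      using T(4) generate.incl[of _ T G] mono_generate[of "elt ` commutant u" "elt ` commutant u \<union> ?L"] by blast
    then show "generate G (T \<union> ?L) \<subseteq> generate G (elt ` commutant u \<union> ?L)"
      using Q L(1) by (intro generate_subgroup_incl generate_is_subgroup) (auto intro: generate.incl)
    have "elt ` commutant u \<subseteq> generate G (T \<union> ?L)"
      using T(4) generate.incl[of _ "elt ` commutant u" G] mono_generate[of T "T \<union> ?L"] by blast
    then show "generate G (elt ` commutant u \<union> ?L) \<subseteq> generate G (T \<union> ?L)"
      using T(1) L(1) by (intro generate_subgroup_incl generate_is_subgroup) (auto intro: generate.incl)
  qed
  let ?c = "\<lambda>h. g \<otimes>\<^bsub>G\<^esub> h \<otimes>\<^bsub>G\<^esub> inv\<^bsub>G\<^esub> g"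
  interpret c: group_hom G G ?c
    by (rule conjugation_hom[OF gu(1)])
  have "generate G (?c ` (T \<union> ?L)) = ?c ` generate G (T \<union> ?L)"
    using T(1) L(1) by (intro c.generate_img) auto
  also have "\<dots> = centralizer G x"
    unfolding gen gu(5) using gu(1,2) by (intro centralizer_conjugate[symmetric]) auto
  finally have gen': "generate G (?c ` (T \<union> ?L)) = centralizer G x" .
  have "group_rank (G\<lparr>carrier := centralizer G x\<rparr>) \<le> enat (card (?c ` (T \<union> ?L)))"
  proof (rule group_rank_le[OF subgroup_centralizer[OF x(1)] _ gen'])
    show "?c ` (T \<union> ?L) \<subseteq> centralizer G x"
      unfolding gen' [symmetric] by (auto intro: generate.incl)
  qed (use T(2) L(2) in auto)
  moreover have "card (?c ` (T \<union> ?L)) \<le> card (T \<union> ?L)"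
    using T(2) L(2) by (intro card_image_le) auto
  moreover have "card (T \<union> ?L) \<le> card T + card ?L"
    by (rule card_Un_le)
  moreover have "card T + card ?L \<le> 3 * d + 1"
    using T(3) L(3) card_generators_bound[OF d a gu(2)] by simp
  ultimately show ?thesis
    by (meson enat_ord_simps(1) le_trans order_trans)
qed

text \<open>The number modulo two of letters from \<open>P\<close>. The target is the group of Booleans with
  exclusive or.\<close>
lemma exists_parity_hom:
  "\<exists>h. (\<forall>x\<in>carrier G. \<forall>y\<in>carrier G. h (x \<otimes>\<^bsub>G\<^esub> y) = (h x \<noteq> h y)) \<and> (\<forall>v\<in>verts \<Gamma>. h (elt [(v, True)]) = (v \<in> P))"
proof -
  define Z where "Z = \<lparr>carrier = (UNIV :: bool set), monoid.mult = (\<noteq>), one = False\<rparr>"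
  have Z_mult: "x \<otimes>\<^bsub>Z\<^esub> y = (x \<noteq> y)" "\<one>\<^bsub>Z\<^esub> = False" for x y
    by (simp_all add: Z_def)
  have Z: "group Z"
    by (rule groupI) (auto simp: Z_def)
  interpret Z: group Z by (rule Z)
  have inv_Z: "inv\<^bsub>Z\<^esub> b = b" for b
    by (rule Z.inv_equality) (auto simp: Z_def)
  have f: "(\<lambda>v. v \<in> P) \<in> verts \<Gamma> \<rightarrow> carrier Z"
    by (simp add: Z_def)
  have "Z.evaluate (\<lambda>v. v \<in> P) r = \<one>\<^bsub>Z\<^esub>" if "r \<in> relators" for r
    using that by (auto simp: raag_relators_def commutator_word_def inv_Z) (auto simp: Z_def)
  then obtain h where h: "h \<in> hom (presented_group (verts \<Gamma>) relators) Z"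
      "\<And>w. w \<in> words (verts \<Gamma>) \<Longrightarrow> h (word_class (verts \<Gamma>) relators w) = Z.evaluate (\<lambda>v. v \<in> P) w"
    using Z.presented_group_hom[OF f] by metis
  have "h (elt [(v, True)]) = (v \<in> P)" if "v \<in> verts \<Gamma>" for v
    using h(2)[of "[(v, True)]"] that by (simp add: Z_mult)
  moreover have "h (x \<otimes>\<^bsub>G\<^esub> y) = (h x \<noteq> h y)" if "x \<in> carrier G" "y \<in> carrier G" for x y
    using hom_mult[OF h(1)] that unfolding raag_eq Z_mult by blast
  ultimately show ?thesis
    by (intro exI[of _ h] conjI ballI)
qed

text \<open>The parity homomorphisms of the subsets of \<open>B\<close> differ on \<open>H\<close>, as they differ on the generators in \<open>B\<close>. So they
  already differ on any set \<open>S\<close> that generates \<open>H\<close>, and there are at most \<open>2\<^bsup>|S|\<^esup>\<close> maps from \<open>S\<close> to the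
  Booleans.\<close>
theorem group_rank_ge:
  assumes H: "subgroup H G" and B: "B \<subseteq> verts \<Gamma>" "generator_class (verts \<Gamma>) relators ` B \<subseteq> H"
  shows "enat (card B) \<le> group_rank (G\<lparr>carrier := H\<rparr>)"
  unfolding group_rank_def
proof (rule INF_greatest)
  fix S assume "S \<in> {S. S \<subseteq> carrier (G\<lparr>carrier := H\<rparr>) \<and> finite S \<and>
    generate (G\<lparr>carrier := H\<rparr>) S = carrier (G\<lparr>carrier := H\<rparr>)}"
  then have S: "S \<subseteq> H" "finite S" "generate G S = H"
    using generate_consistent[OF _ H] by auto
  have "\<forall>P. \<exists>h. (\<forall>x\<in>carrier G. \<forall>y\<in>carrier G. h (x \<otimes>\<^bsub>G\<^esub> y) = (h x \<noteq> h y))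
      \<and> (\<forall>v\<in>verts \<Gamma>. h (elt [(v, True)]) = (v \<in> P))"
    by (rule allI) (rule exists_parity_hom)
  from choice[OF this] obtain h where h: "\<forall>P. (\<forall>x\<in>carrier G. \<forall>y\<in>carrier G. h P (x \<otimes>\<^bsub>G\<^esub> y) = (h P x \<noteq> h P y))
      \<and> (\<forall>v\<in>verts \<Gamma>. h P (elt [(v, True)]) = (v \<in> P))" ..
  then have h_mult: "h P (x \<otimes>\<^bsub>G\<^esub> y) = (h P x \<noteq> h P y)" if "x \<in> carrier G" "y \<in> carrier G" for P x y
    using that by blast
  have h_gen: "h P (elt [(v, True)]) = (v \<in> P)" if "v \<in> verts \<Gamma>" for P v
    using h that by blast
  have h1: "\<not> h P \<one>\<^bsub>G\<^esub>" for P
    using h_mult[of "\<one>\<^bsub>G\<^esub>" "\<one>\<^bsub>G\<^esub>" P] by simp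
  have hinv: "h P (inv\<^bsub>G\<^esub> x) = h P x" if "x \<in> carrier G" for P x
    using h_mult[of "inv\<^bsub>G\<^esub> x" x P] h1[of P] that by simp
  have inj: "inj_on (\<lambda>P. {s \<in> S. h P s}) (Pow B)"
  proof (rule inj_onI)
    fix P P' assume P: "P \<in> Pow B" "P' \<in> Pow B" and eq: "{s \<in> S. h P s} = {s \<in> S. h P' s}"
    have "h P x = h P' x" if "x \<in> generate G S" for x
      using that
    proof (induction rule: generate.induct)
      case (incl x)
      then show ?case using eq by blast
    next
      case (inv x)
      then have "x \<in> carrier G" "h P x = h P' x"
        using eq S(1) subgroup.subset[OF H] by blast+
      then show ?case by (simp add: hinv)
    next
      case (eng x y)
      then have "x \<in> carrier G" "y \<in> carrier G"
        using S(3) subgroup.subset[OF H] by blast+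
      then show ?case
        using eng h_mult by simp
    qed (simp add: h1)
    then have "v \<in> P \<longleftrightarrow> v \<in> P'" if "v \<in> B" for v
    proof -
      have v: "elt [(v, True)] \<in> generate G S" "v \<in> verts \<Gamma>"
        using B that S(3) by auto
      show ?thesis
        using \<open>\<And>x. x \<in> generate G S \<Longrightarrow> h P x = h P' x\<close>[OF v(1)] h_gen[OF v(2)] by simp
    qed
    then show "P = P'"
      using P by blast
  qed
  have "card (Pow B) \<le> card (Pow S)"
    using S(2) by (intro card_inj_on_le[OF inj]) auto
  moreover have "finite B"
    using B(1) finite_verts finite_subset by blast
  ultimately show "enat (card B) \<le> enat (card S)"
    using S(2) by (simp add: card_Pow)
qed

corollary group_rank_raag: "group_rank G = enat (card (verts \<Gamma>))"
proof (rule antisym)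
  let ?S = "generator_class (verts \<Gamma>) relators ` verts \<Gamma>"
  have "x \<in> generate G ?S" if x: "x \<in> carrier G" for x
  proof -
    obtain w where w: "w \<in> words (verts \<Gamma>)" "x = elt w"
      using x by (rule raag_carrierE)
    have "fst ` set w \<subseteq> verts \<Gamma>"
      using w(1) by (auto simp: in_lists_conv_set)
    then show ?thesis
      using word_class_in_generate[OF w(1) subset_refl] w(2) by (simp add: raag_eq)
  qed
  moreover have S: "?S \<subseteq> carrier G"
    by (simp add: image_subset_iff)
  ultimately have gen: "generate G ?S = carrier G"
    using generate_incl[OF S] by blast
  have "group_rank (G\<lparr>carrier := carrier G\<rparr>) \<le> enat (card ?S)"
    using gen S by (intro group_rank_le subgroup_self) auto
  also have "\<dots> \<le> enat (card (verts \<Gamma>))"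
    by (simp add: card_image_le)
  finally show "group_rank G \<le> enat (card (verts \<Gamma>))"
    by simp
  show "enat (card (verts \<Gamma>)) \<le> group_rank G"
    using group_rank_ge[OF subgroup_self subset_refl S] by simp
qed

corollary valence_le_group_rank_centralizer:
  assumes v: "v \<in> verts \<Gamma>"
  shows "enat (valence \<Gamma> v) \<le> group_rank (G\<lparr>carrier := centralizer G (elt [(v, True)])\<rparr>)"
  unfolding valence_def
proof (rule group_rank_ge[OF subgroup_centralizer])
  show "generator_class (verts \<Gamma>) relators ` {w \<in> verts \<Gamma>. {v, w} \<in> edges \<Gamma>} \<subseteq> centralizer G (elt [(v, True)])"
    using generators_commute by (auto simp: centralizer_def)
qed (use v in auto)

lemma generator_nontrivial: "v \<in> verts \<Gamma> \<Longrightarrow> elt [(v, True)] \<noteq> \<one>\<^bsub>G\<^esub>"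
  using reduced_unique[of "[(v, True)]" "[]"] by (auto simp: elt_Nil [symmetric])

end

section \<open>Quotient modules and dimensions of subspaces\<close>

lemma A_RCOSETS_eq: "a_rcosets\<^bsub>M\<^esub> N = (\<lambda>v. N +>\<^bsub>M\<^esub> v) ` carrier M"
  by (auto simp: A_RCOSETS_def RCOSETS_def a_r_coset_def)

context module
begin

lemma submodule_abelian_subgroup:
  assumes "submodule R N M" shows "abelian_subgroup N M"
proof (rule abelian_subgroupI3)
  interpret N: submodule R N M by (rule assms)
  show "additive_subgroup N M"
  proof (rule additive_subgroup.intro, rule M.add.subgroupI)
    show "\<ominus>\<^bsub>M\<^esub> v \<in> N" if "v \<in> N" for v
    proof -
      have "\<ominus>\<^bsub>M\<^esub> v = (\<ominus>\<^bsub>R\<^esub> \<one>\<^bsub>R\<^esub>) \<odot>\<^bsub>M\<^esub> v"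
        using that N.subset smult_minus_1 by auto
      then show ?thesis
        using that by simp
    qed
    show "N \<noteq> {}"
      using N.zero_closed by blast
  qed (use N.subset in auto)
qed (rule M.abelian_group_axioms)

lemma submodule_coset_eq_iff:
  assumes "submodule R N M" "v \<in> carrier M" "w \<in> carrier M"
  shows "N +>\<^bsub>M\<^esub> v = N +>\<^bsub>M\<^esub> w \<longleftrightarrow> v \<ominus>\<^bsub>M\<^esub> w \<in> N"
proof -
  interpret N: abelian_subgroup N M
    by (rule submodule_abelian_subgroup[OF assms(1)])
  show ?thesis
    using N.a_rcos_module[OF assms(3,2)] N.a_repr_independence'[OF _ assms(3), of v] N.a_rcos_self[OF assms(2)]
    by (metis M.minus_eq)
qed

end

locale module_quotient = module R M
  for R :: "('r, 'k) ring_scheme" and M :: "('r, 'a) module" +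
  fixes N :: "'a set"
  assumes N: "submodule R N M"
begin

lemma quotient_smult:
  assumes c: "c \<in> carrier R" and v: "v \<in> carrier M"
  shows "c \<odot>\<^bsub>quotient_module M N\<^esub> (N +>\<^bsub>M\<^esub> v) = N +>\<^bsub>M\<^esub> (c \<odot>\<^bsub>M\<^esub> v)"
proof -
  interpret N: submodule R N M by (rule N)
  interpret A: abelian_subgroup N M
    by (rule submodule_abelian_subgroup[OF N])
  have *: "N +>\<^bsub>M\<^esub> (c \<odot>\<^bsub>M\<^esub> w) = N +>\<^bsub>M\<^esub> (c \<odot>\<^bsub>M\<^esub> v)" if w: "w \<in> N +>\<^bsub>M\<^esub> v" for w
  proof -
    obtain n where n: "n \<in> N" "w = n \<oplus>\<^bsub>M\<^esub> v"
      using w by (auto simp: a_r_coset_def r_coset_def)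
    then have nc: "n \<in> carrier M" and wc: "w \<in> carrier M"
      using N.subset v by auto
    have "w \<ominus>\<^bsub>M\<^esub> v = n"
      using n(2) nc v by (simp add: M.minus_eq M.a_assoc M.r_neg)
    moreover have "c \<odot>\<^bsub>M\<^esub> w \<ominus>\<^bsub>M\<^esub> c \<odot>\<^bsub>M\<^esub> v = c \<odot>\<^bsub>M\<^esub> (w \<ominus>\<^bsub>M\<^esub> v)"
      using c wc v by (simp add: M.minus_eq smult_r_distr smult_r_minus)
    ultimately have "c \<odot>\<^bsub>M\<^esub> w \<ominus>\<^bsub>M\<^esub> c \<odot>\<^bsub>M\<^esub> v \<in> N"
      using c n(1) by simp
    then show ?thesis
      using c v wc by (simp add: submodule_coset_eq_iff[OF N])
  qed
  have "c \<odot>\<^bsub>quotient_module M N\<^esub> (N +>\<^bsub>M\<^esub> v) = (\<Union>w\<in>N +>\<^bsub>M\<^esub> v. N +>\<^bsub>M\<^esub> (c \<odot>\<^bsub>M\<^esub> w))"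
    by (simp add: quotient_module_def)
  also have "\<dots> = (\<Union>w\<in>N +>\<^bsub>M\<^esub> v. N +>\<^bsub>M\<^esub> (c \<odot>\<^bsub>M\<^esub> v))"
    by (intro SUP_cong HOL.refl *)
  also have "\<dots> = N +>\<^bsub>M\<^esub> (c \<odot>\<^bsub>M\<^esub> v)"
    using A.a_rcos_self[OF v] by (intro UN_constant_eq) auto
  finally show ?thesis .
qed

lemma quotient_add:
  assumes "v \<in> carrier M" "w \<in> carrier M"
  shows "(N +>\<^bsub>M\<^esub> v) \<oplus>\<^bsub>quotient_module M N\<^esub> (N +>\<^bsub>M\<^esub> w) = N +>\<^bsub>M\<^esub> (v \<oplus>\<^bsub>M\<^esub> w)"
  using abelian_subgroup.a_rcos_sum[OF submodule_abelian_subgroup[OF N]] assms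
  by (simp add: quotient_module_def)

lemma quotient_carrier: "carrier (quotient_module M N) = (\<lambda>v. N +>\<^bsub>M\<^esub> v) ` carrier M"
  by (simp add: quotient_module_def A_RCOSETS_eq)

lemma quotient_zero:
  "\<zero>\<^bsub>quotient_module M N\<^esub> = N +>\<^bsub>M\<^esub> \<zero>\<^bsub>M\<^esub>"
  by (simp add: quotient_module_def M.a_coset_add_zero[OF submodule.subset[OF N]])

theorem quotient_module_is_module:
  "module R (quotient_module M N)"
proof (rule module_criteria)
  have comb: "\<exists>v\<in>carrier M. X = N +>\<^bsub>M\<^esub> v" if "X \<in> carrier (quotient_module M N)" for X
    using that by (auto simp: quotient_carrier)
  have closed: "N +>\<^bsub>M\<^esub> v \<in> carrier (quotient_module M N)" if "v \<in> carrier M" for v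
    using that by (simp add: quotient_carrier)
  note simps = quotient_add quotient_smult quotient_zero closed
  show "\<forall>X\<in>carrier (quotient_module M N). \<exists>Y\<in>carrier (quotient_module M N).
      X \<oplus>\<^bsub>quotient_module M N\<^esub> Y = \<zero>\<^bsub>quotient_module M N\<^esub>"
  proof
    fix X assume "X \<in> carrier (quotient_module M N)"
    then obtain v where v: "v \<in> carrier M" "X = N +>\<^bsub>M\<^esub> v"
      using comb by blast
    then show "\<exists>Y\<in>carrier (quotient_module M N). X \<oplus>\<^bsub>quotient_module M N\<^esub> Y = \<zero>\<^bsub>quotient_module M N\<^esub>"
      by (intro bexI[of _ "N +>\<^bsub>M\<^esub> (\<ominus>\<^bsub>M\<^esub> v)"]) (simp_all add: simps M.r_neg)
  qed
qed (auto simp: quotient_carrier quotient_add quotient_smult quotient_zero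
  M.a_ac smult_assoc1 smult_l_distr smult_r_distr R.is_cring)

lemma quotient_projection_hom:
  "(\<lambda>v. N +>\<^bsub>M\<^esub> v) \<in> module_hom R M (quotient_module M N)"
  by (auto simp: module_hom_def quotient_carrier quotient_add quotient_smult)

lemma quotient_projection_eq_zero:
  assumes v: "v \<in> carrier M"
  shows "N +>\<^bsub>M\<^esub> v = \<zero>\<^bsub>quotient_module M N\<^esub> \<longleftrightarrow> v \<in> N"
proof -
  have "\<ominus>\<^bsub>M\<^esub> \<zero>\<^bsub>M\<^esub> = \<zero>\<^bsub>M\<^esub>"
    using M.r_neg[of "\<zero>\<^bsub>M\<^esub>"] by simp
  then have "v \<ominus>\<^bsub>M\<^esub> \<zero>\<^bsub>M\<^esub> = v"
    using v by (metis M.minus_eq M.r_zero)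
  then show ?thesis
    unfolding quotient_zero submodule_coset_eq_iff[OF N v M.zero_closed] by (rule arg_cong)
qed

end

lemma quotient_is_vectorspace:
  fixes V :: "('k, 'v) module"
  assumes "subspace K N V" shows "vectorspace K (quotient_module V N)"
proof -
  interpret vectorspace K V
    by (rule subspace.vs[OF assms])
  interpret module_quotient K V N
    by (intro module_quotient.intro module_quotient_axioms.intro module_axioms subspace.submod[OF assms])
  show ?thesis
    using quotient_module_is_module field_axioms by (simp add: vectorspace_def)
qed

context vectorspace
begin

lemma subspace_subset: "subspace K W V \<Longrightarrow> W \<subseteq> carrier V"
  by (simp add: subspace_def submodule_def)

lemma subspaceI:
  assumes "W \<subseteq> carrier V" "\<zero>\<^bsub>V\<^esub> \<in> W" "\<And>v w. v \<in> W \<Longrightarrow> w \<in> W \<Longrightarrow> v \<oplus>\<^bsub>V\<^esub> w \<in> W"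
    "\<And>c v. c \<in> carrier K \<Longrightarrow> v \<in> W \<Longrightarrow> c \<odot>\<^bsub>V\<^esub> v \<in> W"
  shows "subspace K W V"
  by (intro subspace.intro submodule.intro vectorspace_axioms module_axioms assms)

lemma subspace_fin_dim:
  assumes fd: "fin_dim" and W: "subspace K W V"
  shows "vectorspace.fin_dim K (vs W)"
proof -
  interpret W: vectorspace K "vs W"
    by (rule subspace_is_vs[OF W])
  have sub: "submodule K W V"
    using W by simp
  have "\<exists>A. finite A \<and> maximal A (\<lambda>S. S \<subseteq> carrier (vs W) \<and> W.lin_indpt S)"
  proof (rule maximal_exists)
    show "finite A \<and> card A \<le> dim" if "A \<subseteq> carrier (vs W) \<and> W.lin_indpt A" for A
    proof -
      have "lin_indpt A"
        using that span_li_not_depend(2)[of A W] sub by simp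
      moreover have "A \<subseteq> carrier V"
        using that subspace_subset[OF W] by auto
      ultimately show ?thesis
        using li_le_dim[OF fd] by blast
    qed
    show "{} \<subseteq> carrier (vs W) \<and> W.lin_indpt {}"
      by (auto simp: W.lin_dep_def)
  qed
  then obtain A where A: "finite A" "maximal A (\<lambda>S. S \<subseteq> carrier (vs W) \<and> W.lin_indpt S)"
    by blast
  have "A \<subseteq> carrier (vs W)"
    using A(2) unfolding maximal_def by blast
  then show ?thesis
    unfolding W.fin_dim_def using A W.max_li_is_gen by blast
qed

lemma dim_subspace_le:
  assumes "fin_dim" "subspace K W V" shows "vectorspace.dim K (vs W) \<le> dim"
  using subspace_dim[OF assms(2,1) subspace_fin_dim[OF assms]] .

end

lemma module_hom_restrict:
  assumes "f \<in> module_hom R M N" "H \<subseteq> carrier M" shows "f \<in> module_hom R (M\<lparr>carrier := H\<rparr>) N"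
  using assms by (auto simp: module_hom_def subset_iff)

text \<open>Rank-nullity with trivial kernel.\<close>
lemma (in linear_map) dim_le_of_inj:
  assumes "V.fin_dim" "W.fin_dim" "\<And>v. v \<in> carrier V \<Longrightarrow> T v = \<zero>\<^bsub>W\<^esub> \<Longrightarrow> v = \<zero>\<^bsub>V\<^esub>"
  shows "V.dim \<le> W.dim"
proof -
  have "kerT = {\<zero>\<^bsub>V\<^esub>}"
    using assms(3) by (auto simp: ker_def)
  then have "inj_on T (carrier V)"
    using Ke0_imp_inj by simp
  then have "vectorspace.dim K (V.vs kerT) = 0"
    by (rule inj_imp_dim_ker0)
  then have "V.dim = vectorspace.dim K (W.vs imT)"
    using rank_nullity[OF assms(1)] by simp
  also have "\<dots> \<le> W.dim"
    by (rule W.dim_subspace_le[OF assms(2) imT_is_subspace])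
  finally show ?thesis .
qed

text \<open>The quotient construction takes module records without extension fields, to which the type of
  \<open>V\<close> is restricted here.\<close>
locale plain_vectorspace = vectorspace K V
  for K :: "('k, 'm) ring_scheme" and V :: "('k, 'v) module"
begin

lemma dim_quotient_image:
  assumes fd: "fin_dim" and N: "subspace K N V" and H: "subspace K H V"
  shows "vectorspace.dim K ((quotient_module V N)\<lparr>carrier := (\<lambda>v. N +>\<^bsub>V\<^esub> v) ` H\<rparr>) + vectorspace.dim K (vs (N \<inter> H))
    = vectorspace.dim K (vs H)"
proof -
  interpret Q: vectorspace K "quotient_module V N"
    by (rule quotient_is_vectorspace[OF N])
  interpret H: vectorspace K "vs H"
    by (rule subspace_is_vs[OF H])
  interpret MQ: module_quotient K V N
    by (intro module_quotient.intro module_quotient_axioms.intro module_axioms subspace.submod[OF N])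
  interpret T: linear_map K "vs H" "quotient_module V N" "\<lambda>v. N +>\<^bsub>V\<^esub> v"
  proof unfold_locales
    show "(\<lambda>v. N +>\<^bsub>V\<^esub> v) \<in> module_hom K (vs H) (quotient_module V N)"
      by (rule module_hom_restrict[OF MQ.quotient_projection_hom subspace_subset[OF H]])
  qed
  have "T.ker = N \<inter> H"
    using MQ.quotient_projection_eq_zero subspace_subset[OF H] by (auto simp: T.ker_def)
  moreover have "T.im = (\<lambda>v. N +>\<^bsub>V\<^esub> v) ` H"
    by (simp add: T.im_def)
  ultimately show ?thesis
    using T.rank_nullity[OF subspace_fin_dim[OF fd H]] by simp
qed

text \<open>Project along \<open>W1\<close>: the images of \<open>W2\<close> and of \<open>W1 + W2\<close> coincide, with kernels \<open>W1 \<inter> W2\<close> and \<open>W1\<close>.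
  Rank-nullity for both gives the formula.\<close>
theorem dim_sum_add_dim_inter:
  assumes fd: "fin_dim" and W: "subspace K W1 V" "subspace K W2 V"
  shows "vectorspace.dim K (vs (subspace_sum W1 W2)) + vectorspace.dim K (vs (W1 \<inter> W2))
    = vectorspace.dim K (vs W1) + vectorspace.dim K (vs W2)"
proof -
  let ?H = "subspace_sum W1 W2" and ?p = "\<lambda>v. W1 +>\<^bsub>V\<^esub> v"
  have H: "subspace K ?H V"
    by (rule sum_is_subspace[OF W])
  have sub: "submodule K W1 V"
    using W(1) by simp
  have "?p ` ?H = ?p ` W2"
  proof
    show "?p ` W2 \<subseteq> ?p ` ?H"
      using in_sum_vs[OF W(2,1)] vsum_comm[OF W] by blast
    show "?p ` ?H \<subseteq> ?p ` W2"
    proof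
      fix X assume "X \<in> ?p ` ?H"
      then obtain v w where vw: "v \<in> W1" "w \<in> W2" "X = ?p (v \<oplus>\<^bsub>V\<^esub> w)"
        by (auto simp: submodule_sum_def)
      have c: "v \<in> carrier V" "w \<in> carrier V"
        using vw W subspace_subset by auto
      have "v \<oplus>\<^bsub>V\<^esub> w \<ominus>\<^bsub>V\<^esub> w = v"
        using c by (simp add: M.minus_eq M.a_assoc M.r_neg)
      then have "?p (v \<oplus>\<^bsub>V\<^esub> w) = ?p w"
        using submodule_coset_eq_iff[OF sub M.a_closed[OF c] c(2)] vw(1) by simp
      then show "X \<in> ?p ` W2"
        using vw by blast
    qed
  qed
  moreover have "W1 \<inter> ?H = W1"
    using in_sum_vs[OF W] by blast
  ultimately show ?thesis
    using dim_quotient_image[OF fd W(1) H] dim_quotient_image[OF fd W] by simp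
qed

end

section \<open>Vector spaces with coordinates\<close>

text \<open>A vector space with an isomorphism to \<open>K\<^sup>B\<close>, given by the coordinates of vectors. The values of a
  homomorphism on the vertices will be the coordinates on \<open>H\<^sup>1\<close>.\<close>
locale coordinate_space = vectorspace K V
  for K :: "('k, 'm) ring_scheme" and V :: "('k, 'v, 'x) module_scheme" +
  fixes B :: "'i set" and coord :: "'v \<Rightarrow> 'i \<Rightarrow> 'k"
  assumes finite_B: "finite B"
    and coord_closed [simp]: "v \<in> carrier V \<Longrightarrow> b \<in> B \<Longrightarrow> coord v b \<in> carrier K"
    and coord_add: "\<lbrakk>v \<in> carrier V; w \<in> carrier V; b \<in> B\<rbrakk> \<Longrightarrow> coord (v \<oplus>\<^bsub>V\<^esub> w) b = coord v b \<oplus>\<^bsub>K\<^esub> coord w b"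
    and coord_smult: "\<lbrakk>c \<in> carrier K; v \<in> carrier V; b \<in> B\<rbrakk> \<Longrightarrow> coord (c \<odot>\<^bsub>V\<^esub> v) b = c \<otimes>\<^bsub>K\<^esub> coord v b"
    and coord_inj: "\<lbrakk>v \<in> carrier V; w \<in> carrier V; \<And>b. b \<in> B \<Longrightarrow> coord v b = coord w b\<rbrakk> \<Longrightarrow> v = w"
    and coord_surj: "f \<in> B \<rightarrow> carrier K \<Longrightarrow> \<exists>v\<in>carrier V. \<forall>b\<in>B. coord v b = f b"
begin

lemma coord_zero: "b \<in> B \<Longrightarrow> coord \<zero>\<^bsub>V\<^esub> b = \<zero>\<^bsub>K\<^esub>"
  using coord_smult[of "\<zero>\<^bsub>K\<^esub>" "\<zero>\<^bsub>V\<^esub>" b] by simp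

lemma zeroI: "\<lbrakk>v \<in> carrier V; \<And>b. b \<in> B \<Longrightarrow> coord v b = \<zero>\<^bsub>K\<^esub>\<rbrakk> \<Longrightarrow> v = \<zero>\<^bsub>V\<^esub>"
  by (rule coord_inj) (simp_all add: coord_zero)

definition of_coords :: "('i \<Rightarrow> 'k) \<Rightarrow> 'v" where
  "of_coords f = (SOME v. v \<in> carrier V \<and> (\<forall>b\<in>B. coord v b = f b))"

lemma of_coords:
  assumes "f \<in> B \<rightarrow> carrier K"
  shows "of_coords f \<in> carrier V" "\<And>b. b \<in> B \<Longrightarrow> coord (of_coords f) b = f b"
proof -
  have "\<exists>v. v \<in> carrier V \<and> (\<forall>b\<in>B. coord v b = f b)"
    using coord_surj[OF assms] by blast
  then have "of_coords f \<in> carrier V \<and> (\<forall>b\<in>B. coord (of_coords f) b = f b)"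
    unfolding of_coords_def by (rule someI_ex)
  then show "of_coords f \<in> carrier V" "\<And>b. b \<in> B \<Longrightarrow> coord (of_coords f) b = f b"
    by blast+
qed

definition unit_vector :: "'i \<Rightarrow> 'v" where
  "unit_vector a = of_coords (\<lambda>b. if b = a then \<one>\<^bsub>K\<^esub> else \<zero>\<^bsub>K\<^esub>)"

lemma unit_vector_closed [simp]: "unit_vector a \<in> carrier V"
  unfolding unit_vector_def by (rule of_coords) simp

lemma coord_unit_vector: "b \<in> B \<Longrightarrow> coord (unit_vector a) b = (if b = a then \<one>\<^bsub>K\<^esub> else \<zero>\<^bsub>K\<^esub>)"
  unfolding unit_vector_def by (rule of_coords) simp

lemma inj_unit_vector: "inj_on unit_vector B"
proof (rule inj_onI)
  fix a b assume ab: "a \<in> B" "b \<in> B" "unit_vector a = unit_vector b"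
  then have "coord (unit_vector b) a = \<one>\<^bsub>K\<^esub>"
    using coord_unit_vector[OF ab(1), of a] by simp
  then show "a = b"
    using coord_unit_vector[OF ab(1), of b] by (auto split: if_splits)
qed

text \<open>A linear combination in which at most one term contributes to the coordinate \<open>b\<close>.\<close>
lemma coord_lincomb:
  assumes "finite S" "S \<subseteq> carrier V" "a \<in> S \<rightarrow> carrier K" "b \<in> B"
    and "\<And>w. w \<in> S \<Longrightarrow> w \<noteq> w0 \<Longrightarrow> coord w b = \<zero>\<^bsub>K\<^esub>"
  shows "coord (lincomb a S) b = (if w0 \<in> S then a w0 \<otimes>\<^bsub>K\<^esub> coord w0 b else \<zero>\<^bsub>K\<^esub>)"
  using assms
proof (induction S rule: finite_induct)
  case empty
  then show ?case by (simp add: coord_zero)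
next
  case (insert w S)
  have w: "w \<in> carrier V" "S \<subseteq> carrier V" "a \<in> S \<rightarrow> carrier K" "a w \<in> carrier K"
    using insert.prems by auto
  have "coord (lincomb a (insert w S)) b = coord (a w \<odot>\<^bsub>V\<^esub> w \<oplus>\<^bsub>V\<^esub> lincomb a S) b"
    using lincomb_insert2[OF insert.hyps(1) w(2) insert.prems(2) insert.hyps(2) w(1)] by simp
  also have "\<dots> = a w \<otimes>\<^bsub>K\<^esub> coord w b \<oplus>\<^bsub>K\<^esub> coord (lincomb a S) b"
    using w insert.prems(3) by (simp add: coord_add coord_smult lincomb_closed)
  also have "coord (lincomb a S) b = (if w0 \<in> S then a w0 \<otimes>\<^bsub>K\<^esub> coord w0 b else \<zero>\<^bsub>K\<^esub>)"
    using insert.IH[OF w(2,3) insert.prems(3)] insert.prems(4) by blast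
  finally have step: "coord (lincomb a (insert w S)) b
      = a w \<otimes>\<^bsub>K\<^esub> coord w b \<oplus>\<^bsub>K\<^esub> (if w0 \<in> S then a w0 \<otimes>\<^bsub>K\<^esub> coord w0 b else \<zero>\<^bsub>K\<^esub>)" .
  show ?case
  proof (cases "w = w0")
    case True
    then show ?thesis
      unfolding step using insert.hyps(2) insert.prems(3) w by simp
  next
    case False
    then have "a w \<otimes>\<^bsub>K\<^esub> coord w b = \<zero>\<^bsub>K\<^esub>"
      using insert.prems(4)[of w] w(4) by simp
    moreover have "a w0 \<otimes>\<^bsub>K\<^esub> coord w0 b \<in> carrier K" if w0: "w0 \<in> S"
      using coord_closed[OF subsetD[OF w(2) w0] insert.prems(3)] Pi_mem[OF w(3) w0] by simp
    ultimately show ?thesis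
      using False by (simp add: step)
  qed
qed

lemma basis_unit_vectors: "basis (unit_vector ` B)"
proof (rule basis_criterion[THEN iffD2], goal_cases)
  case 3
  let ?E = "unit_vector ` B"
  have E: "finite ?E" "?E \<subseteq> carrier V"
    using finite_B by auto
  have key: "coord (lincomb a ?E) b = a (unit_vector b)" if "a \<in> ?E \<rightarrow> carrier K" "b \<in> B" for a b
  proof -
    have "coord (lincomb a ?E) b
        = (if unit_vector b \<in> ?E then a (unit_vector b) \<otimes>\<^bsub>K\<^esub> coord (unit_vector b) b else \<zero>\<^bsub>K\<^esub>)"
    proof (rule coord_lincomb[OF E that])
      show "coord w b = \<zero>\<^bsub>K\<^esub>" if w: "w \<in> ?E" "w \<noteq> unit_vector b" for w
        using w coord_unit_vector[OF \<open>b \<in> B\<close>] by auto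
    qed
    moreover have "a (unit_vector b) \<in> carrier K"
      using that by (auto simp: Pi_iff)
    ultimately show ?thesis
      using that(2) by (simp add: coord_unit_vector)
  qed
  show ?case
  proof (intro allI impI ex1I)
    fix v assume v: "v \<in> carrier V"
    \<comment> \<open>The coefficients of a vector are its coordinates, transported to the set of unit vectors.\<close>
    let ?a = "\<lambda>w\<in>?E. coord v (inv_into B unit_vector w)"
    have a: "?a (unit_vector b) = coord v b" if "b \<in> B" for b
      using that inv_into_f_f[OF inj_unit_vector that] by simp
    have aE: "?a \<in> ?E \<rightarrow>\<^sub>E carrier K"
      using v a by auto
    have "lincomb ?a ?E = v"
    proof (rule coord_inj)
      show "lincomb ?a ?E \<in> carrier V"
        using E(2) aE by (intro lincomb_closed) auto
      show "coord (lincomb ?a ?E) b = coord v b" if b: "b \<in> B" for b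
        using key[OF _ b, of ?a] aE a[OF b] by (simp add: PiE_def)
    qed (rule v)
    with aE show "?a \<in> ?E \<rightarrow>\<^sub>E carrier K \<and> lincomb ?a ?E = v"
      by (rule conjI)
    fix c assume c: "c \<in> ?E \<rightarrow>\<^sub>E carrier K \<and> lincomb c ?E = v"
    show "c = ?a"
    proof (rule extensionalityI[of _ ?E])
      fix w assume "w \<in> ?E"
      then obtain b where b: "b \<in> B" "w = unit_vector b"
        by blast
      have "c w = coord v b"
        using key[OF _ b(1), of c] c b(2) by (simp add: PiE_def)
      then show "c w = ?a w"
        using a[OF b(1)] b(2) by simp
    qed (use c in \<open>auto simp: PiE_def\<close>)
  qed
qed (use finite_B in auto)

lemma dim_eq_card: "dim = card B"
  using dim_basis[OF _ basis_unit_vectors] finite_B card_image[OF inj_unit_vector] by simp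

lemma finite_dimensional: "fin_dim"
  unfolding fin_dim_def
  by (intro exI[of _ "unit_vector ` B"] conjI) (use basis_unit_vectors finite_B in \<open>simp_all add: basis_def\<close>)

definition coord_subspace :: "'i set \<Rightarrow> 'v set" where
  "coord_subspace A = {v \<in> carrier V. \<forall>b\<in>B - A. coord v b = \<zero>\<^bsub>K\<^esub>}"

lemma subspace_coord_subspace: "subspace K (coord_subspace A) V"
  by (rule subspaceI) (auto simp: coord_subspace_def coord_zero coord_add coord_smult)

lemma coord_subspace_inter: "coord_subspace A \<inter> coord_subspace A' = coord_subspace (A \<inter> A')"
  by (auto simp: coord_subspace_def)

lemma coordinate_space_coord_subspace:
  assumes "A \<subseteq> B" shows "coordinate_space K (vs (coord_subspace A)) A coord"
proof -
  interpret A: vectorspace K "vs (coord_subspace A)"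
    by (rule subspace_is_vs[OF subspace_coord_subspace])
  have sub: "v \<in> carrier V" if "v \<in> coord_subspace A" for v
    using that by (simp add: coord_subspace_def)
  have AB: "b \<in> B" if "b \<in> A" for b
    using that assms by blast
  show ?thesis
  proof unfold_locales
    show "finite A"
      using assms finite_B finite_subset by blast
    show "v = w" if "v \<in> carrier (vs (coord_subspace A))" "w \<in> carrier (vs (coord_subspace A))"
      "\<And>b. b \<in> A \<Longrightarrow> coord v b = coord w b" for v w
    proof (rule coord_inj)
      show "coord v b = coord w b" if b: "b \<in> B" for b
        using b \<open>v \<in> carrier (vs (coord_subspace A))\<close> \<open>w \<in> carrier (vs (coord_subspace A))\<close>
          \<open>\<And>b. b \<in> A \<Longrightarrow> coord v b = coord w b\<close>
        by (cases "b \<in> A") (auto simp: coord_subspace_def)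
    qed (use that sub in auto)
    show "\<exists>v\<in>carrier (vs (coord_subspace A)). \<forall>b\<in>A. coord v b = f b" if f: "f \<in> A \<rightarrow> carrier K" for f
    proof -
      let ?f = "\<lambda>b. if b \<in> A then f b else \<zero>\<^bsub>K\<^esub>"
      have "?f \<in> B \<rightarrow> carrier K"
        using f by auto
      note v = of_coords[OF this]
      have "of_coords ?f \<in> coord_subspace A"
        using v by (auto simp: coord_subspace_def)
      then show ?thesis
        using v(2) AB by (intro bexI[of _ "of_coords ?f"]) auto
    qed
  qed (auto simp: sub AB coord_add coord_smult)
qed

lemma dim_coord_subspace: "A \<subseteq> B \<Longrightarrow> vectorspace.dim K (vs (coord_subspace A)) = card A"
  by (rule coordinate_space.dim_eq_card[OF coordinate_space_coord_subspace])

text \<open>Restriction of vectors to the coordinates in \<open>S\<close> is injective on \<open>F\<close>.\<close>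
lemma dim_subspace_le_card:
  assumes F: "subspace K F V" and S: "S \<subseteq> B"
    and inj: "\<And>f. f \<in> F \<Longrightarrow> \<forall>b\<in>S. coord f b = \<zero>\<^bsub>K\<^esub> \<Longrightarrow> f = \<zero>\<^bsub>V\<^esub>"
  shows "vectorspace.dim K (vs F) \<le> card S"
proof -
  interpret F: vectorspace K "vs F"
    by (rule subspace_is_vs[OF F])
  interpret S: coordinate_space K "vs (coord_subspace S)" S coord
    by (rule coordinate_space_coord_subspace[OF S])
  have Fc: "f \<in> carrier V" if "f \<in> F" for f
    using that subspace_subset[OF F] by blast
  have SB: "b \<in> B" if "b \<in> S" for b
    using that S by blast
  have cl: "coord f \<in> S \<rightarrow> carrier K" if "f \<in> F" for f
    using Fc[OF that] SB by simp
  define T where "T f = S.of_coords (coord f)" for f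
  have T: "T f \<in> carrier (vs (coord_subspace S))" "b \<in> S \<Longrightarrow> coord (T f) b = coord f b" if "f \<in> F" for f b
    unfolding T_def using S.of_coords[OF cl[OF that]] by auto
  have F_add: "f \<oplus>\<^bsub>V\<^esub> g \<in> F" if "f \<in> F" "g \<in> F" for f g
    using F.M.a_closed[of f g] that by simp
  have F_smult: "c \<odot>\<^bsub>V\<^esub> f \<in> F" if "c \<in> carrier K" "f \<in> F" for c f
    using F.smult_closed[of c f] that by simp
  interpret T: linear_map K "vs F" "vs (coord_subspace S)" T
  proof unfold_locales
    have "T (f \<oplus>\<^bsub>V\<^esub> g) = T f \<oplus>\<^bsub>V\<^esub> T g" if fg: "f \<in> F" "g \<in> F" for f g
    proof (rule S.coord_inj)
      show "T f \<oplus>\<^bsub>V\<^esub> T g \<in> carrier (vs (coord_subspace S))"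
        using S.M.a_closed[OF T(1)[OF fg(1)] T(1)[OF fg(2)]] by simp
      show "coord (T (f \<oplus>\<^bsub>V\<^esub> g)) b = coord (T f \<oplus>\<^bsub>V\<^esub> T g) b" if b: "b \<in> S" for b
        using S.coord_add[OF T(1)[OF fg(1)] T(1)[OF fg(2)] b] coord_add[OF Fc[OF fg(1)] Fc[OF fg(2)] SB[OF b]]
        by (simp add: T(2) F_add fg b)
    qed (rule T(1)[OF F_add[OF fg]])
    moreover have "T (c \<odot>\<^bsub>V\<^esub> f) = c \<odot>\<^bsub>V\<^esub> T f" if cf: "c \<in> carrier K" "f \<in> F" for c f
    proof (rule S.coord_inj)
      show "c \<odot>\<^bsub>V\<^esub> T f \<in> carrier (vs (coord_subspace S))"
        using S.smult_closed[OF cf(1) T(1)[OF cf(2)]] by simp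
      show "coord (T (c \<odot>\<^bsub>V\<^esub> f)) b = coord (c \<odot>\<^bsub>V\<^esub> T f) b" if b: "b \<in> S" for b
        using S.coord_smult[OF cf(1) T(1)[OF cf(2)] b] coord_smult[OF cf(1) Fc[OF cf(2)] SB[OF b]]
        by (simp add: T(2) F_smult cf b)
    qed (rule T(1)[OF F_smult[OF cf]])
    ultimately show "T \<in> module_hom K (vs F) (vs (coord_subspace S))"
      using T(1) by (simp add: module_hom_def)
  qed
  have "F.dim \<le> S.dim"
  proof (rule T.dim_le_of_inj[OF subspace_fin_dim[OF finite_dimensional F] S.finite_dimensional])
    fix f assume f: "f \<in> carrier (vs F)" "T f = \<zero>\<^bsub>vs (coord_subspace S)\<^esub>"
    have "coord f b = \<zero>\<^bsub>K\<^esub>" if "b \<in> S" for b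
      using T(2)[of f b] f that coord_zero[OF SB[OF that]] by simp
    then show "f = \<zero>\<^bsub>vs F\<^esub>"
      using inj f(1) by simp
  qed
  then show ?thesis
    by (simp add: S.dim_eq_card)
qed

end

section \<open>The Cheeger constant of the pairing of a graph\<close>

definition neighbours :: "'v graph \<Rightarrow> 'v set \<Rightarrow> 'v set" where
  "neighbours \<Gamma> A = {w \<in> verts \<Gamma>. \<exists>v\<in>A. {v, w} \<in> edges \<Gamma>}"

lemma vertex_boundary_eq: "vertex_boundary \<Gamma> A = neighbours \<Gamma> A - A"
  by (auto simp: vertex_boundary_def neighbours_def)

lemma card_Diff_add: "\<lbrakk>S \<subseteq> A; finite A\<rbrakk> \<Longrightarrow> card (A - S) + card S = card A"
  by (simp add: card_Diff_subset card_mono finite_subset)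

lemma card_neighbours_le:
  assumes fin: "finite (verts \<Gamma>)" and d: "\<forall>v\<in>verts \<Gamma>. valence \<Gamma> v \<le> d" and A: "A \<subseteq> verts \<Gamma>"
  shows "card (neighbours \<Gamma> A) \<le> d * card A"
proof -
  have "neighbours \<Gamma> A = (\<Union>v\<in>A. {w \<in> verts \<Gamma>. {v, w} \<in> edges \<Gamma>})"
    by (auto simp: neighbours_def)
  then have "card (neighbours \<Gamma> A) \<le> (\<Sum>v\<in>A. card {w \<in> verts \<Gamma>. {v, w} \<in> edges \<Gamma>})"
    using card_UN_le[OF finite_subset[OF A fin]] by simp
  also have "\<dots> \<le> (\<Sum>v\<in>A. d)"
    using d A by (intro sum_mono) (auto simp: valence_def)
  finally show ?thesis
    by (simp add: mult.commute)
qed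

text \<open>A vertex that cannot be added to an independent set of the largest size has a neighbour in it.\<close>
lemma maximal_independent_set:
  assumes "finite X"
  obtains D where "D \<subseteq> X" "\<And>v w. v \<in> D \<Longrightarrow> w \<in> D \<Longrightarrow> {v, w} \<notin> edges \<Gamma>"
    "\<And>v. v \<in> X - D \<Longrightarrow> {v} \<notin> edges \<Gamma> \<Longrightarrow> \<exists>w\<in>D. {v, w} \<in> edges \<Gamma>"
proof -
  define P where "P D \<longleftrightarrow> D \<subseteq> X \<and> (\<forall>v\<in>D. \<forall>w\<in>D. {v, w} \<notin> edges \<Gamma>)" for D
  have "P {}"
    by (simp add: P_def)
  moreover have "finite {D. P D}"
    using assms by (auto simp: P_def intro: finite_subset[of _ "Pow X"])
  ultimately obtain D where D: "P D" and max: "\<And>D'. P D' \<Longrightarrow> card D' \<le> card D"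
    using finite_has_maximal[of "card ` {D. P D}"] by (auto dest: order_antisym) (metis nle_le)
  have "\<exists>w\<in>D. {v, w} \<in> edges \<Gamma>" if v: "v \<in> X - D" "{v} \<notin> edges \<Gamma>" for v
  proof (rule ccontr)
    assume "\<not> (\<exists>w\<in>D. {v, w} \<in> edges \<Gamma>)"
    then have "P (insert v D)"
      using D v by (auto simp: P_def insert_commute)
    then have "card (insert v D) \<le> card D"
      by (rule max)
    moreover have "finite D"
      using D assms finite_subset by (auto simp: P_def)
    ultimately show False
      using v(1) by simp
  qed
  with D that show thesis
    by (auto simp: P_def)
qed

lemma graph_cheegerD:
  assumes "ereal \<epsilon> \<le> graph_cheeger \<Gamma>" "A \<subseteq> verts \<Gamma>" "finite A" "real (card A) \<le> real (card (verts \<Gamma>)) / 2"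
  shows "\<epsilon> * real (card A) \<le> real (card (vertex_boundary \<Gamma> A))"
proof (cases "A = {}")
  case False
  have "ereal \<epsilon> \<le> ereal (real (card (vertex_boundary \<Gamma> A)) / real (card A))"
    using assms(1) unfolding graph_cheeger_def
    by (rule order_trans) (rule INF_lower, use assms False in auto)
  then show ?thesis
    using False assms(3) by (simp add: card_gt_0_iff pos_le_divide_eq)
qed simp

text \<open>The combinatorial core of \<open>cheeger_ge\<close>, where \<open>m\<close> is the dimension of \<open>F\<close> and \<open>cod\<close> the codimension
  of \<open>C + F\<close>.

  The sets \<open>U - Z - D\<close> and \<open>Z - U\<close> have at most \<open>cod\<close> elements together. Vertices of \<open>D\<close> have neighbours,
  and only in those two sets, so there are at most \<open>d cod\<close> of them. This bounds \<open>U - Z\<close> by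
  \<open>(d + 1) cod\<close>. The boundary of \<open>U \<inter> Z\<close> lies in \<open>Z - U\<close>. If \<open>U \<inter> Z\<close> contains at most half of the vertices,
  expansion bounds its size by \<open>cod / \<epsilon>\<close>, and with it the size of \<open>U\<close>. Otherwise
  expansion applies to its complement, whose boundary consists of neighbours of the boundary of \<open>U \<inter> Z\<close>; so
  \<open>|Z|\<close> is almost the number of vertices, which is at least \<open>2 m\<close>, and \<open>cod2\<close> applies.\<close>
lemma expansion_bound:
  fixes \<epsilon> cod m :: real
  assumes \<Gamma>: "finite_simplicial_graph \<Gamma>" and d: "\<forall>v\<in>verts \<Gamma>. valence \<Gamma> v \<le> d"
    and \<epsilon>: "0 < \<epsilon>" "ereal \<epsilon> \<le> graph_cheeger \<Gamma>"
    and UZ: "U \<subseteq> verts \<Gamma>" "Z \<subseteq> verts \<Gamma>"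
    and nX: "neighbours \<Gamma> (U - Z) \<subseteq> (U - Z) \<union> (Z - U)" and nY: "neighbours \<Gamma> (U \<inter> Z) \<subseteq> Z"
    and D: "D \<subseteq> U - Z" "\<And>v w. v \<in> D \<Longrightarrow> w \<in> D \<Longrightarrow> {v, w} \<notin> edges \<Gamma>"
    and m: "1 \<le> m" "m \<le> real (card (verts \<Gamma>)) / 2" "m \<le> real (card U)"
    and cod1: "real (card (U - Z - D)) + real (card (Z - U)) \<le> cod"
    and cod2: "real (card Z) - m \<le> cod"
  shows "m \<le> (real d + 1) * (1 + 1 / \<epsilon>) * cod"
proof -
  have fin: "finite (verts \<Gamma>)"
    using \<Gamma> by (simp add: finite_simplicial_graph_def)
  have finS [simp]: "finite S" if "S \<subseteq> verts \<Gamma>" for S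
    using that fin finite_subset by blast
  let ?n = "real (card (verts \<Gamma>))"
  let ?X = "U - Z" and ?Y = "U \<inter> Z" and ?S = "(U - Z - D) \<union> (Z - U)"
  have subs: "?X \<subseteq> verts \<Gamma>" "?Y \<subseteq> verts \<Gamma>" "?S \<subseteq> verts \<Gamma>" "D \<subseteq> verts \<Gamma>"
    using UZ D(1) by auto
  have cS: "real (card ?S) \<le> cod"
  proof -
    have "card ?S \<le> card (U - Z - D) + card (Z - U)"
      by (rule card_Un_le)
    then show ?thesis
      using cod1 by linarith
  qed
  have cod0: "0 \<le> cod"
    using cS by linarith
  \<comment> \<open>Every vertex has a neighbour, so an independent set is covered by the neighbours of the rest.\<close>
  have "D \<subseteq> neighbours \<Gamma> ?S"
  proof
    fix v assume v: "v \<in> D"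
    have "\<epsilon> * real (card {v}) \<le> real (card (vertex_boundary \<Gamma> {v}))"
      using v subs(4) m by (intro graph_cheegerD[OF \<epsilon>(2)]) auto
    then have "vertex_boundary \<Gamma> {v} \<noteq> {}"
      using \<epsilon>(1) by auto
    then obtain w where w: "w \<in> verts \<Gamma>" "{v, w} \<in> edges \<Gamma>"
      by (auto simp: vertex_boundary_def)
    then have "w \<in> neighbours \<Gamma> ?X"
      using v D(1) by (auto simp: neighbours_def)
    then have "w \<in> ?S"
      using nX D(2)[OF v] w(2) by blast
    then show "v \<in> neighbours \<Gamma> ?S"
      using v subs(4) w(2) by (auto simp: neighbours_def insert_commute)
  qed
  then have "card D \<le> card (neighbours \<Gamma> ?S)"
    by (intro card_mono) (auto simp: neighbours_def fin)
  also have "\<dots> \<le> d * card ?S"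
    by (rule card_neighbours_le[OF fin d subs(3)])
  finally have "real (card D) \<le> real d * real (card ?S)"
    by (metis of_nat_le_iff of_nat_mult)
  then have cD: "real (card D) \<le> real d * cod"
    using cS by (meson mult_left_mono of_nat_0_le_iff order_trans)
  have "card ?X \<le> card D + card (U - Z - D)"
    using card_Un_le[of D "U - Z - D"] D(1) by (simp add: Un_absorb1)
  then have cX: "real (card ?X) \<le> (real d + 1) * cod"
    using cD cod1 by (simp add: algebra_simps)
  have bY: "vertex_boundary \<Gamma> ?Y \<subseteq> Z - U"
    using nY by (auto simp: vertex_boundary_eq)
  have cbY: "real (card (vertex_boundary \<Gamma> ?Y)) \<le> cod"
  proof -
    have "card (vertex_boundary \<Gamma> ?Y) \<le> card (Z - U)"
      using UZ(2) by (intro card_mono[OF _ bY]) auto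
    then show ?thesis
      using cod1 by linarith
  qed
  have split: "(real d + 1) * (1 + 1 / \<epsilon>) * cod = (real d + 1) * cod + real d * (cod / \<epsilon>) + cod / \<epsilon>"
    by (simp add: algebra_simps)
  have pos: "0 \<le> real d * (cod / \<epsilon>)" "0 \<le> cod / \<epsilon>" "0 \<le> real d * cod"
    using cod0 \<epsilon>(1) by simp_all
  show ?thesis
  proof (cases "real (card ?Y) \<le> ?n / 2")
    case True
    then have "\<epsilon> * real (card ?Y) \<le> cod"
      using graph_cheegerD[OF \<epsilon>(2) subs(2)] subs(2) cbY by fastforce
    then have "real (card ?Y) \<le> cod / \<epsilon>"
      using \<epsilon>(1) by (simp add: pos_le_divide_eq mult.commute)
    moreover have "card U \<le> card ?X + card ?Y"
      using card_Un_le[of ?X ?Y] by (simp add: Un_Diff_Int)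
    ultimately have "real (card U) \<le> (real d + 1) * cod + cod / \<epsilon>"
      using cX by linarith
    then show ?thesis
      unfolding split using m(3) pos by linarith
  next
    case False
    let ?C = "verts \<Gamma> - ?Y"
    have card_C: "real (card ?C) = ?n - real (card ?Y)"
      using subs(2) fin card_mono[OF fin subs(2)] by (simp add: card_Diff_subset of_nat_diff)
    have "\<epsilon> * real (card ?C) \<le> real (card (vertex_boundary \<Gamma> ?C))"
      using False card_C by (intro graph_cheegerD[OF \<epsilon>(2)]) auto
    also have "\<dots> \<le> real (card (neighbours \<Gamma> (vertex_boundary \<Gamma> ?Y)))"
    proof -
      have "vertex_boundary \<Gamma> ?C \<subseteq> neighbours \<Gamma> (vertex_boundary \<Gamma> ?Y)"
      proof
        fix y assume "y \<in> vertex_boundary \<Gamma> ?C"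
        then obtain x where x: "y \<in> verts \<Gamma>" "y \<in> ?Y" "x \<in> ?C" "{x, y} \<in> edges \<Gamma>"
          by (auto simp: vertex_boundary_def)
        then have "x \<in> vertex_boundary \<Gamma> ?Y"
          unfolding vertex_boundary_def by (auto simp: insert_commute intro!: bexI[of _ y])
        then show "y \<in> neighbours \<Gamma> (vertex_boundary \<Gamma> ?Y)"
          using x unfolding neighbours_def by blast
      qed
      then show ?thesis
        by (auto intro!: card_mono simp: neighbours_def fin)
    qed
    also have "\<dots> \<le> real (d * card (vertex_boundary \<Gamma> ?Y))"
      using card_neighbours_le[OF fin d, of "vertex_boundary \<Gamma> ?Y"] by (simp only: of_nat_le_iff) (auto simp: vertex_boundary_def)
    also have "\<dots> \<le> real d * cod"
      using cbY by (simp add: mult_left_mono)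
    finally have "?n - real (card ?Y) \<le> real d * (cod / \<epsilon>)"
      using \<epsilon>(1) card_C by (simp add: pos_le_divide_eq mult.commute)
    moreover have "card ?Y \<le> card Z"
      using UZ(2) by (intro card_mono) auto
    moreover have "(real d + 1) * cod = real d * cod + cod"
      by (simp add: algebra_simps)
    ultimately show ?thesis
      unfolding split using cod2 m(2) pos by linarith
  qed
qed

text \<open>What is used of the cup product on \<open>H\<^sup>1(A(\<Gamma>), L)\<close>: the vanishing of a product is a condition on the edges
  of the graph.\<close>
locale graph_pairing = coordinate_space L V "verts \<Gamma>" coord + pairing_triple L V W q
  for L :: "('l, 'k) ring_scheme" and V :: "('l, 'a) module" and \<Gamma> :: "'v graph"
    and coord :: "'a \<Rightarrow> 'v \<Rightarrow> 'l" and W :: "('l, 'b) module" and q :: "'a \<Rightarrow> 'a \<Rightarrow> 'b" +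
  assumes simplicial: "finite_simplicial_graph \<Gamma>"
    and q_eq_zero_iff: "\<lbrakk>u \<in> carrier V; v \<in> carrier V\<rbrakk> \<Longrightarrow> q u v = \<zero>\<^bsub>W\<^esub> \<longleftrightarrow>
      (\<forall>a b. {a, b} \<in> edges \<Gamma> \<longrightarrow> coord u a \<otimes>\<^bsub>L\<^esub> coord v b = coord u b \<otimes>\<^bsub>L\<^esub> coord v a)"
begin

sublocale plain_vectorspace L V
  by unfold_locales

lemma edgeD: "{a, b} \<in> edges \<Gamma> \<Longrightarrow> a \<in> verts \<Gamma> \<and> b \<in> verts \<Gamma> \<and> a \<noteq> b"
  using simplicial by (fastforce simp: finite_simplicial_graph_def)

lemma orthogonal_iff:
  assumes "F \<subseteq> carrier V"
  shows "v \<in> orthogonal F \<longleftrightarrow> v \<in> carrier V \<and> (\<forall>f\<in>F. \<forall>a b. {a, b} \<in> edges \<Gamma> \<longrightarrow>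
    coord f a \<otimes>\<^bsub>L\<^esub> coord v b = coord f b \<otimes>\<^bsub>L\<^esub> coord v a)"
proof -
  have "(\<forall>f\<in>F. q f v = \<zero>\<^bsub>W\<^esub>) \<longleftrightarrow> (\<forall>f\<in>F. \<forall>a b. {a, b} \<in> edges \<Gamma> \<longrightarrow>
      coord f a \<otimes>\<^bsub>L\<^esub> coord v b = coord f b \<otimes>\<^bsub>L\<^esub> coord v a)" if "v \<in> carrier V"
    by (rule ball_cong[OF HOL.refl], rule q_eq_zero_iff) (use assms that in auto)
  then show ?thesis
    by (simp only: orthogonal_def mem_Collect_eq cong: conj_cong)
qed

lemma orthogonalD:
  assumes "F \<subseteq> carrier V" "v \<in> orthogonal F" "f \<in> F" "{a, b} \<in> edges \<Gamma>"
  shows "coord f a \<otimes>\<^bsub>L\<^esub> coord v b = coord f b \<otimes>\<^bsub>L\<^esub> coord v a"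
  using orthogonal_iff[OF assms(1), THEN iffD1, OF assms(2)] assms(3,4) by metis

lemma subspace_orthogonal:
  assumes "F \<subseteq> carrier V" shows "subspace L (orthogonal F) V"
proof (rule subspaceI)
  have F: "f \<in> carrier V" if "f \<in> F" for f
    using that assms by blast
  note add = module_hom_add[OF linear_right[OF F]] and smult = module_hom_smult[OF linear_right[OF F]]
  show "\<zero>\<^bsub>V\<^esub> \<in> orthogonal F"
    unfolding orthogonal_iff[OF assms] using F edgeD by (auto simp: coord_zero)
  show "v \<oplus>\<^bsub>V\<^esub> w \<in> orthogonal F" if "v \<in> orthogonal F" "w \<in> orthogonal F" for v w
    using that by (auto simp: orthogonal_def add)
  show "c \<odot>\<^bsub>V\<^esub> v \<in> orthogonal F" if "c \<in> carrier L" "v \<in> orthogonal F" for c v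
    using that by (auto simp: orthogonal_def smult)
qed (auto simp: orthogonal_def)

text \<open>A unit vector at \<open>a\<close> forces the vectors orthogonal to it to vanish at the neighbours of \<open>a\<close>; then both sides of
  the relation vanish on all edges.\<close>
lemma orthogonal_coord_subspace:
  assumes A: "A \<subseteq> verts \<Gamma>"
  shows "orthogonal (coord_subspace A) = coord_subspace (verts \<Gamma> - neighbours \<Gamma> A)" (is "?L = ?R")
proof
  have sub: "coord_subspace A \<subseteq> carrier V"
    by (auto simp: coord_subspace_def)
  show "?L \<subseteq> ?R"
  proof
    fix v assume v: "v \<in> ?L"
    have "coord v b = \<zero>\<^bsub>L\<^esub>" if b: "b \<in> neighbours \<Gamma> A" for b
    proof -
      obtain a where a: "a \<in> A" "{a, b} \<in> edges \<Gamma>"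
        using b by (auto simp: neighbours_def)
      have ab: "a \<in> verts \<Gamma>" "b \<in> verts \<Gamma>" "b \<noteq> a"
        using edgeD[OF a(2)] by auto
      have "unit_vector a \<in> coord_subspace A"
        using a(1) by (auto simp: coord_subspace_def coord_unit_vector)
      then have "coord (unit_vector a) a \<otimes>\<^bsub>L\<^esub> coord v b = coord (unit_vector a) b \<otimes>\<^bsub>L\<^esub> coord v a"
        by (rule orthogonalD[OF sub v _ a(2)])
      then show ?thesis
        using v ab by (simp add: coord_unit_vector orthogonal_def)
    qed
    then show "v \<in> ?R"
      using v by (auto simp: coord_subspace_def orthogonal_def)
  qed
  show "?R \<subseteq> ?L"
  proof
    fix v assume v: "v \<in> ?R"
    have vc: "v \<in> carrier V"
      using v by (simp add: coord_subspace_def)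
    have zero: "coord f a \<otimes>\<^bsub>L\<^esub> coord v b = \<zero>\<^bsub>L\<^esub>" if f: "f \<in> coord_subspace A" and e: "{a, b} \<in> edges \<Gamma>" for f a b
    proof (cases "a \<in> A")
      case True
      then have "b \<in> neighbours \<Gamma> A"
        using e edgeD[OF e] by (auto simp: neighbours_def)
      then show ?thesis
        using v f e edgeD[OF e] by (auto simp: coord_subspace_def)
    next
      case False
      then show ?thesis
        using vc f edgeD[OF e] by (auto simp: coord_subspace_def)
    qed
    have eq: "coord f a \<otimes>\<^bsub>L\<^esub> coord v b = coord f b \<otimes>\<^bsub>L\<^esub> coord v a"
      if f: "f \<in> coord_subspace A" and e: "{a, b} \<in> edges \<Gamma>" for f a b
      using zero[OF f e] zero[OF f, of b a] e by (simp add: insert_commute)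
    show "v \<in> ?L"
      unfolding orthogonal_iff[OF sub] by (intro conjI ballI allI impI vc eq)
  qed
qed

text \<open>With \<open>N\<close> the set of neighbours of \<open>A\<close>, the numerator is \<open>n - |A| - (n - |N|) + |A - N| = |N - A|\<close>.\<close>
lemma cheeger_ratio_coord_subspace:
  assumes A: "A \<subseteq> verts \<Gamma>"
  shows "cheeger_ratio (coord_subspace A) = real (card (vertex_boundary \<Gamma> A)) / real (card A)"
proof -
  have fin: "finite (verts \<Gamma>)"
    by (rule finite_B)
  let ?N = "neighbours \<Gamma> A"
  have N: "?N \<subseteq> verts \<Gamma>" "finite ?N"
    using fin by (auto simp: neighbours_def)
  have inter: "orthogonal (coord_subspace A) \<inter> coord_subspace A = coord_subspace (A - ?N)"
    unfolding orthogonal_coord_subspace[OF A] coord_subspace_inter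
    by (rule arg_cong[of _ _ coord_subspace]) (use A in blast)
  have "card A \<le> card (verts \<Gamma>)" "card ?N \<le> card (verts \<Gamma>)"
    using A N fin by (auto intro: card_mono)
  moreover have "card (A - ?N) + card (A \<inter> ?N) = card A"
    using A fin finite_subset by (metis card_Int_Diff add.commute)
  moreover have "card (?N - A) + card (?N \<inter> A) = card ?N"
    using N by (metis card_Int_Diff add.commute)
  ultimately have "real (card (verts \<Gamma>)) - real (card A) - real (card (verts \<Gamma> - ?N)) + real (card (A - ?N))
      = real (card (?N - A))"
    using N by (simp add: card_Diff_subset of_nat_diff Int_commute)
  moreover have sub: "A - ?N \<subseteq> verts \<Gamma>"
    using A by blast
  ultimately show ?thesis
    unfolding cheeger_ratio_def inter unfolding orthogonal_coord_subspace[OF A] vertex_boundary_eq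
    using A by (simp add: dim_coord_subspace dim_coord_subspace[OF sub] dim_eq_card)
qed

theorem cheeger_le_graph_cheeger: "cheeger \<le> graph_cheeger \<Gamma>"
  unfolding graph_cheeger_def
proof (rule INF_greatest)
  fix A assume "A \<in> {A. A \<subseteq> verts \<Gamma> \<and> A \<noteq> {} \<and> real (card A) \<le> real (card (verts \<Gamma>)) / 2}"
  then have A: "A \<subseteq> verts \<Gamma>" "A \<noteq> {}" "real (card A) \<le> real (card (verts \<Gamma>)) / 2"
    by auto
  have "finite A"
    using A(1) finite_B finite_subset by blast
  have "cheeger \<le> ereal (cheeger_ratio (coord_subspace A))"
    unfolding cheeger_def
    by (rule INF_lower)
      (use A \<open>finite A\<close> subspace_coord_subspace in \<open>simp add: dim_coord_subspace dim_eq_card card_gt_0_iff\<close>)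
  then show "cheeger \<le> ereal (real (card (vertex_boundary \<Gamma> A)) / real (card A))"
    by (simp add: cheeger_ratio_coord_subspace[OF A(1)])
qed

text \<open>For a subspace \<open>F\<close>, with \<open>C\<close> orthogonal to \<open>F\<close>, the numerator of the ratio is the codimension of \<open>C + F\<close>.
  It is bounded below in terms of the support \<open>U\<close> of \<open>F\<close> and the common zeros \<open>Z\<close> of \<open>C\<close>, in two ways. A
  vector of \<open>C + F\<close> vanishes on \<open>Z - U\<close>, and its values on \<open>U - Z\<close> are determined by those on a maximal
  independent set \<open>D\<close>. A vector of \<open>C\<close> vanishes on \<open>Z\<close>, so the codimension is also at least
  \<open>|Z| - dim F\<close>. The dimension of \<open>F\<close> is at most \<open>|U|\<close>.\<close>
theorem cheeger_ge:
  assumes d: "\<forall>v\<in>verts \<Gamma>. valence \<Gamma> v \<le> d" and \<epsilon>: "0 < \<epsilon>" "ereal \<epsilon> \<le> graph_cheeger \<Gamma>"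
  shows "ereal (1 / ((real d + 1) * (1 + 1 / \<epsilon>))) \<le> cheeger"
  unfolding cheeger_def
proof (rule INF_greatest)
  fix F assume "F \<in> {F. subspace L F V \<and> 0 < sdim F \<and> sdim F \<le> sdim (carrier V) / 2}"
  then have F: "subspace L F V" and F_dim: "0 < sdim F" "sdim F \<le> real (card (verts \<Gamma>)) / 2"
    by (auto simp: dim_eq_card)
  have Fc: "F \<subseteq> carrier V"
    by (rule subspace_subset[OF F])
  let ?C = "orthogonal F"
  have C: "subspace L ?C V"
    by (rule subspace_orthogonal[OF Fc])
  have Cc: "?C \<subseteq> carrier V"
    by (rule subspace_subset[OF C])
  have orth: "coord f a \<otimes>\<^bsub>L\<^esub> coord g b = coord f b \<otimes>\<^bsub>L\<^esub> coord g a"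
    if "f \<in> F" "g \<in> ?C" "{a, b} \<in> edges \<Gamma>" for f g a b
    by (rule orthogonalD[OF Fc that(2,1,3)])
  define U where "U = {v \<in> verts \<Gamma>. \<exists>f\<in>F. coord f v \<noteq> \<zero>\<^bsub>L\<^esub>}"
  define Z where "Z = {v \<in> verts \<Gamma>. \<forall>g\<in>?C. coord g v = \<zero>\<^bsub>L\<^esub>}"
  have UZ: "U \<subseteq> verts \<Gamma>" "Z \<subseteq> verts \<Gamma>"
    by (auto simp: U_def Z_def)
  have cF: "coord f v \<in> carrier L" if "f \<in> F" "v \<in> verts \<Gamma>" for f v
    using that Fc by auto
  have cC: "coord g v \<in> carrier L" if "g \<in> ?C" "v \<in> verts \<Gamma>" for g v
    using that Cc by auto
  \<comment> \<open>If \<open>F\<close> does not vanish at \<open>v\<close> and vanishes at the neighbour \<open>w\<close>, or \<open>C\<close> vanishes at \<open>v\<close>, then \<open>C\<close> vanishes at \<open>w\<close>.\<close>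
  have toZ: "w \<in> Z" if v: "v \<in> U" and e: "{v, w} \<in> edges \<Gamma>" and vw: "w \<notin> U \<or> v \<in> Z" for v w
  proof -
    obtain f where f: "f \<in> F" "coord f v \<noteq> \<zero>\<^bsub>L\<^esub>"
      using v U_def by blast
    have vert: "v \<in> verts \<Gamma>" "w \<in> verts \<Gamma>"
      using edgeD[OF e] by auto
    have "coord g w = \<zero>\<^bsub>L\<^esub>" if g: "g \<in> ?C" for g
    proof -
      have "coord f w \<otimes>\<^bsub>L\<^esub> coord g v = \<zero>\<^bsub>L\<^esub>"
        using vw vert f(1) g cF[OF f(1)] cC[OF g] by (auto simp: U_def Z_def)
      then have "coord f v \<otimes>\<^bsub>L\<^esub> coord g w = \<zero>\<^bsub>L\<^esub>"
        using orth[OF f(1) g e] by simp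
      then show ?thesis
        using f(2) cF[OF f(1) vert(1)] cC[OF g vert(2)] integral by blast
    qed
    then show ?thesis
      using vert(2) by (simp add: Z_def)
  qed
  have nY: "neighbours \<Gamma> (U \<inter> Z) \<subseteq> Z"
    using toZ by (auto simp: neighbours_def)
  have nX: "neighbours \<Gamma> (U - Z) \<subseteq> (U - Z) \<union> (Z - U)"
  proof
    fix w assume "w \<in> neighbours \<Gamma> (U - Z)"
    then obtain v where v: "v \<in> U" "v \<notin> Z" "{v, w} \<in> edges \<Gamma>"
      by (auto simp: neighbours_def)
    have "{w, v} \<in> edges \<Gamma>"
      using v(3) by (simp add: insert_commute)
    then show "w \<in> (U - Z) \<union> (Z - U)"
      using toZ[OF v(1,3)] toZ[of w v] v(2) by blast
  qed
  have finX: "finite (U - Z)"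
    using UZ(1) finite_B finite_subset by blast
  have loop: "{v} \<notin> edges \<Gamma>" for v
    using edgeD[of v v] by auto
  obtain D where D: "D \<subseteq> U - Z" "\<And>v w. v \<in> D \<Longrightarrow> w \<in> D \<Longrightarrow> {v, w} \<notin> edges \<Gamma>"
      "\<And>v. v \<in> U - Z - D \<Longrightarrow> \<exists>w\<in>D. {v, w} \<in> edges \<Gamma>"
    using maximal_independent_set[OF finX, of \<Gamma>] loop by metis
  \<comment> \<open>Along an edge inside \<open>U - Z\<close> both spaces lie on the same line, so there zeros propagate.\<close>
  have propagate: "coord h v = \<zero>\<^bsub>L\<^esub>"
    if h: "h \<in> subspace_sum ?C F" "coord h w = \<zero>\<^bsub>L\<^esub>" and e: "{v, w} \<in> edges \<Gamma>" and vw: "v \<in> U - Z" "w \<in> U - Z" for h v w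
  proof -
    obtain g0 where g0: "g0 \<in> ?C" "coord g0 w \<noteq> \<zero>\<^bsub>L\<^esub>"
      using vw(2) UZ(1) by (auto simp: Z_def)
    obtain f0 where f0: "f0 \<in> F" "coord f0 w \<noteq> \<zero>\<^bsub>L\<^esub>"
      using vw(2) by (auto simp: U_def)
    have vert: "v \<in> verts \<Gamma>" "w \<in> verts \<Gamma>"
      using edgeD[OF e] by auto
    obtain g f where gf: "g \<in> ?C" "f \<in> F" "h = g \<oplus>\<^bsub>V\<^esub> f"
      using h(1) by (auto simp: submodule_sum_def)
    note carr = cF[OF f0(1) vert(1)] cF[OF f0(1) vert(2)] cF[OF gf(2) vert(1)] cF[OF gf(2) vert(2)]
      cC[OF g0(1) vert(1)] cC[OF g0(1) vert(2)] cC[OF gf(1) vert(1)] cC[OF gf(1) vert(2)]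
    have hv: "coord h x = coord g x \<oplus>\<^bsub>L\<^esub> coord f x" if "x \<in> verts \<Gamma>" for x
      unfolding gf(3) by (rule coord_add[OF subsetD[OF Cc gf(1)] subsetD[OF Fc gf(2)] that])
    \<comment> \<open>Multiply \<open>h v\<close> by the nonzero scalar \<open>f0 w * g0 w\<close> and move every factor at \<open>v\<close> away from \<open>h\<close>.\<close>
    let ?s = "coord f0 w \<otimes>\<^bsub>L\<^esub> coord g0 w"
    have 1: "?s \<otimes>\<^bsub>L\<^esub> coord f v = (coord f0 w \<otimes>\<^bsub>L\<^esub> coord g0 v) \<otimes>\<^bsub>L\<^esub> coord f w"
    proof -
      have "coord f v \<otimes>\<^bsub>L\<^esub> coord g0 w = coord f w \<otimes>\<^bsub>L\<^esub> coord g0 v"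
        by (rule orth[OF gf(2) g0(1) e])
      then have "coord f0 w \<otimes>\<^bsub>L\<^esub> (coord f v \<otimes>\<^bsub>L\<^esub> coord g0 w) = coord f0 w \<otimes>\<^bsub>L\<^esub> (coord f w \<otimes>\<^bsub>L\<^esub> coord g0 v)"
        by simp
      then show ?thesis
        using carr by (simp add: R.m_ac)
    qed
    have 2: "?s \<otimes>\<^bsub>L\<^esub> coord g v = (coord f0 w \<otimes>\<^bsub>L\<^esub> coord g0 v) \<otimes>\<^bsub>L\<^esub> coord g w"
    proof -
      have "coord f0 v \<otimes>\<^bsub>L\<^esub> coord g w = coord f0 w \<otimes>\<^bsub>L\<^esub> coord g v"
        by (rule orth[OF f0(1) gf(1) e])
      moreover have "coord f0 v \<otimes>\<^bsub>L\<^esub> coord g0 w = coord f0 w \<otimes>\<^bsub>L\<^esub> coord g0 v"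
        by (rule orth[OF f0(1) g0(1) e])
      ultimately have "coord g0 w \<otimes>\<^bsub>L\<^esub> (coord f0 w \<otimes>\<^bsub>L\<^esub> coord g v) = (coord f0 w \<otimes>\<^bsub>L\<^esub> coord g0 v) \<otimes>\<^bsub>L\<^esub> coord g w"
        using carr by (metis R.m_assoc R.m_comm)
      then show ?thesis
        using carr by (simp add: R.m_ac)
    qed
    have "?s \<otimes>\<^bsub>L\<^esub> coord h v = (coord f0 w \<otimes>\<^bsub>L\<^esub> coord g0 v) \<otimes>\<^bsub>L\<^esub> coord h w"
      using 1 2 carr by (simp add: hv vert R.r_distr)
    then have "?s \<otimes>\<^bsub>L\<^esub> coord h v = \<zero>\<^bsub>L\<^esub>"
      using h(2) carr by simp
    moreover have "?s \<noteq> \<zero>\<^bsub>L\<^esub>"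
      using f0(2) g0(2) carr integral by blast
    moreover have "coord h v \<in> carrier L"
      using hv[OF vert(1)] carr by simp
    ultimately show ?thesis
      using carr integral[of ?s "coord h v"] by auto
  qed
  let ?T = "verts \<Gamma> - (U - Z - D) - (Z - U)"
  have sum: "subspace L (subspace_sum ?C F) V"
    by (rule sum_is_subspace[OF C F])
  have "vectorspace.dim L (vs (subspace_sum ?C F)) \<le> card ?T"
  proof (rule dim_subspace_le_card[OF sum])
    fix h assume h: "h \<in> subspace_sum ?C F" and zero: "\<forall>b\<in>?T. coord h b = \<zero>\<^bsub>L\<^esub>"
    obtain g f where gf: "g \<in> ?C" "f \<in> F" "h = g \<oplus>\<^bsub>V\<^esub> f"
      using h by (auto simp: submodule_sum_def)
    show "h = \<zero>\<^bsub>V\<^esub>"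
    proof (rule zeroI)
      show "h \<in> carrier V"
        using h subspace_subset[OF sum] by blast
      fix b assume b: "b \<in> verts \<Gamma>"
      consider "b \<in> ?T" | "b \<in> Z - U" | "b \<in> U - Z - D"
        using b by blast
      then show "coord h b = \<zero>\<^bsub>L\<^esub>"
      proof cases
        case 1
        then show ?thesis using zero by blast
      next
        case 2
        then have "coord g b = \<zero>\<^bsub>L\<^esub>" "coord f b = \<zero>\<^bsub>L\<^esub>"
          using b gf by (auto simp: U_def Z_def)
        moreover have "coord h b = coord g b \<oplus>\<^bsub>L\<^esub> coord f b"
          unfolding gf(3) by (rule coord_add[OF subsetD[OF Cc gf(1)] subsetD[OF Fc gf(2)] b])
        ultimately show ?thesis by simp
      next
        case 3
        then obtain w where w: "w \<in> D" "{b, w} \<in> edges \<Gamma>"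
          using D(3) by blast
        then have "w \<in> ?T" "w \<in> U - Z"
          using D(1) UZ(1) by auto
        then show ?thesis
          using propagate[OF h _ w(2)] 3 zero by blast
      qed
    qed
  qed auto
  moreover have "card ?T + card (U - Z - D) + card (Z - U) = card (verts \<Gamma>)"
  proof -
    have "U - Z - D \<subseteq> verts \<Gamma>" "Z - U \<subseteq> verts \<Gamma> - (U - Z - D)"
      using UZ by auto
    then show ?thesis
      using card_Diff_add[OF _ finite_B, of "U - Z - D"] card_Diff_add[of "Z - U" "verts \<Gamma> - (U - Z - D)"] finite_B
      by simp
  qed
  moreover have "vectorspace.dim L (vs (subspace_sum ?C F)) + vectorspace.dim L (vs (?C \<inter> F))
      = vectorspace.dim L (vs ?C) + vectorspace.dim L (vs F)"
    by (rule dim_sum_add_dim_inter[OF finite_dimensional C F])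
  ultimately have cod1: "real (card (U - Z - D)) + real (card (Z - U))
      \<le> real (card (verts \<Gamma>)) - sdim F - sdim ?C + sdim (?C \<inter> F)"
    by linarith
  have "vectorspace.dim L (vs ?C) \<le> card (verts \<Gamma> - Z)"
  proof (rule dim_subspace_le_card[OF C])
    show "g = \<zero>\<^bsub>V\<^esub>" if "g \<in> ?C" "\<forall>b\<in>verts \<Gamma> - Z. coord g b = \<zero>\<^bsub>L\<^esub>" for g
      using that Cc by (intro zeroI) (auto simp: Z_def)
  qed auto
  moreover have "card (verts \<Gamma> - Z) + card Z = card (verts \<Gamma>)"
    by (rule card_Diff_add[OF UZ(2) finite_B])
  ultimately have cod2: "real (card Z) - sdim F
      \<le> real (card (verts \<Gamma>)) - sdim F - sdim ?C + sdim (?C \<inter> F)"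
    by linarith
  have "vectorspace.dim L (vs F) \<le> card U"
  proof (rule dim_subspace_le_card[OF F UZ(1)])
    show "f = \<zero>\<^bsub>V\<^esub>" if "f \<in> F" "\<forall>b\<in>U. coord f b = \<zero>\<^bsub>L\<^esub>" for f
      using that Fc by (intro zeroI) (auto simp: U_def)
  qed
  then have "sdim F \<le> real (card U)"
    by simp
  moreover have "1 \<le> sdim F"
    using F_dim(1) by simp
  ultimately have bound: "sdim F \<le> (real d + 1) * (1 + 1 / \<epsilon>)
      * (real (card (verts \<Gamma>)) - sdim F - sdim ?C + sdim (?C \<inter> F))"
    using F_dim(2) by (intro expansion_bound[OF simplicial d \<epsilon> UZ nX nY D(1,2) _ _ _ cod1 cod2])
  have pos: "0 < (real d + 1) * (1 + 1 / \<epsilon>)"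
    using \<epsilon>(1) by (simp add: add_pos_pos)
  have "1 / ((real d + 1) * (1 + 1 / \<epsilon>))
      \<le> (real (card (verts \<Gamma>)) - sdim F - sdim ?C + sdim (?C \<inter> F)) / sdim F"
    using bound pos F_dim(1) by (simp add: pos_divide_le_eq pos_le_divide_eq mult.commute mult.left_commute)
  then show "ereal (1 / ((real d + 1) * (1 + 1 / \<epsilon>))) \<le> ereal (cheeger_ratio F)"
    by (simp add: cheeger_ratio_def dim_eq_card)
qed

end

section \<open>Group cohomology in degrees one and two\<close>

lemma tuples_one: "tuples G 1 = (\<lambda>x. [x]) ` carrier G"
  by (auto simp: tuples_def length_Suc_conv)

lemma tuples_two: "tuples G 2 = (\<lambda>(x, y). [x, y]) ` (carrier G \<times> carrier G)"
  by (auto simp: tuples_def length_Suc_conv numeral_2_eq_2 image_iff)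

lemma tuples_three: "tuples G 3 = (\<lambda>(x, y, z). [x, y, z]) ` (carrier G \<times> carrier G \<times> carrier G)"
  by (auto simp: tuples_def length_Suc_conv numeral_3_eq_3 image_iff)

locale group_cohomology = G: group G + L: field L
  for G :: "('g, 'm) monoid_scheme" and L :: "('l, 'k) ring_scheme"
begin

abbreviation C :: "nat \<Rightarrow> ('l, 'g list \<Rightarrow> 'l) module" where
  "C n \<equiv> cochains G L n"

lemma cochains_module: "module L (C n)"
  unfolding cochains_def by (rule L.func_space_is_module)

sublocale C: module L "C n" for n
  by (rule cochains_module)

lemma cochains_simps:
  "carrier (C n) = tuples G n \<rightarrow>\<^sub>E carrier L"
  "\<zero>\<^bsub>C n\<^esub> = (\<lambda>xs\<in>tuples G n. \<zero>\<^bsub>L\<^esub>)"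
  "f \<oplus>\<^bsub>C n\<^esub> g = (\<lambda>xs\<in>tuples G n. f xs \<oplus>\<^bsub>L\<^esub> g xs)"
  "c \<odot>\<^bsub>C n\<^esub> f = (\<lambda>xs\<in>tuples G n. c \<otimes>\<^bsub>L\<^esub> f xs)"
  by (simp_all add: cochains_def L.func_space_def)

lemma one_tuple [simp]: "x \<in> carrier G \<Longrightarrow> [x] \<in> tuples G 1" "x \<in> carrier G \<Longrightarrow> [x] \<in> tuples G (Suc 0)"
  by (simp_all add: tuples_def)

lemma two_tuple [simp]: "\<lbrakk>x \<in> carrier G; y \<in> carrier G\<rbrakk> \<Longrightarrow> [x, y] \<in> tuples G 2"
  by (simp add: tuples_def)

lemma three_tuple [simp]: "\<lbrakk>x \<in> carrier G; y \<in> carrier G; z \<in> carrier G\<rbrakk> \<Longrightarrow> [x, y, z] \<in> tuples G 3"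
  by (simp add: tuples_def)

lemma cochain1_closed [simp]: "\<lbrakk>f \<in> carrier (C 1); x \<in> carrier G\<rbrakk> \<Longrightarrow> f [x] \<in> carrier L"
  by (auto simp: cochains_simps PiE_iff)

lemma cochain2_closed [simp]: "\<lbrakk>f \<in> carrier (C 2); x \<in> carrier G; y \<in> carrier G\<rbrakk> \<Longrightarrow> f [x, y] \<in> carrier L"
  by (auto simp: cochains_simps PiE_iff)

lemma cochain1_eqI:
  assumes "f \<in> carrier (C 1)" "g \<in> carrier (C 1)" "\<And>x. x \<in> carrier G \<Longrightarrow> f [x] = g [x]"
  shows "f = g"
  by (rule PiE_ext) (use assms in \<open>auto simp: cochains_simps tuples_one simp del: One_nat_def\<close>)

lemma cochain2_eqI:
  assumes "f \<in> carrier (C 2)" "g \<in> carrier (C 2)"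
    "\<And>x y. x \<in> carrier G \<Longrightarrow> y \<in> carrier G \<Longrightarrow> f [x, y] = g [x, y]"
  shows "f = g"
  by (rule PiE_ext) (use assms in \<open>auto simp: cochains_simps tuples_two\<close>)

lemma cochain3_eqI:
  assumes "f \<in> carrier (C 3)" "g \<in> carrier (C 3)"
    "\<And>x y z. x \<in> carrier G \<Longrightarrow> y \<in> carrier G \<Longrightarrow> z \<in> carrier G \<Longrightarrow> f [x, y, z] = g [x, y, z]"
  shows "f = g"
  by (rule PiE_ext) (use assms in \<open>auto simp: cochains_simps tuples_three\<close>)

lemma coboundary_0:
  assumes "f \<in> carrier (C 0)" shows "coboundary G L 0 f = \<zero>\<^bsub>C 1\<^esub>"
proof -
  have f: "f [] \<in> carrier L"
    using assms by (auto simp: cochains_simps tuples_def PiE_iff)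
  show ?thesis
    unfolding coboundary_def cochains_simps add_0
    by (rule restrict_ext) (use f in \<open>auto simp: tuples_def length_Suc_conv L.l_minus L.r_neg\<close>)
qed

lemma coboundary_1:
  assumes "f \<in> carrier (C 1)" "x \<in> carrier G" "y \<in> carrier G"
  shows "coboundary G L 1 f [x, y] = f [y] \<ominus>\<^bsub>L\<^esub> f [x \<otimes>\<^bsub>G\<^esub> y] \<oplus>\<^bsub>L\<^esub> f [x]"
proof -
  have xy: "[x, y] \<in> tuples G (1 + 1)"
    using assms by (simp add: tuples_def)
  have sq: "(\<ominus>\<^bsub>L\<^esub> \<one>\<^bsub>L\<^esub>) [^]\<^bsub>L\<^esub> (Suc (Suc 0)) = \<one>\<^bsub>L\<^esub>"
    by (simp add: L.l_minus)
  show ?thesis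
    unfolding coboundary_def restrict_apply'[OF xy]
    using assms sq by (simp add: merge_at_def L.l_minus L.minus_eq del: L.nat_pow_Suc)
qed

lemma coboundary_2:
  assumes "f \<in> carrier (C 2)" "x \<in> carrier G" "y \<in> carrier G" "z \<in> carrier G"
  shows "coboundary G L 2 f [x, y, z]
    = f [y, z] \<oplus>\<^bsub>L\<^esub> (\<ominus>\<^bsub>L\<^esub> f [x \<otimes>\<^bsub>G\<^esub> y, z] \<oplus>\<^bsub>L\<^esub> f [x, y \<otimes>\<^bsub>G\<^esub> z]) \<ominus>\<^bsub>L\<^esub> f [x, y]"
proof -
  have xyz: "[x, y, z] \<in> tuples G (2 + 1)"
    using assms by (simp add: tuples_def)
  have p1: "(\<ominus>\<^bsub>L\<^esub> \<one>\<^bsub>L\<^esub>) [^]\<^bsub>L\<^esub> (1::nat) = \<ominus>\<^bsub>L\<^esub> \<one>\<^bsub>L\<^esub>"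
    by simp
  have p2: "(\<ominus>\<^bsub>L\<^esub> \<one>\<^bsub>L\<^esub>) [^]\<^bsub>L\<^esub> (2::nat) = \<one>\<^bsub>L\<^esub>"
    by (simp add: numeral_2_eq_2 L.l_minus)
  have p3: "(\<ominus>\<^bsub>L\<^esub> \<one>\<^bsub>L\<^esub>) [^]\<^bsub>L\<^esub> (2 + 1::nat) = \<ominus>\<^bsub>L\<^esub> \<one>\<^bsub>L\<^esub>"
    by (simp add: numeral_2_eq_2 L.l_minus)
  have m: "merge_at G 1 [x, y, z] = [x \<otimes>\<^bsub>G\<^esub> y, z]" "merge_at G 2 [x, y, z] = [x, y \<otimes>\<^bsub>G\<^esub> z]"
    by (simp_all add: merge_at_def)
  have "{1..2::nat} = {1, 2}"
    by auto
  then have "(\<Oplus>\<^bsub>L\<^esub>i\<in>{1..2}. ((\<ominus>\<^bsub>L\<^esub> \<one>\<^bsub>L\<^esub>) [^]\<^bsub>L\<^esub> i) \<otimes>\<^bsub>L\<^esub> f (merge_at G i [x, y, z]))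
      = \<ominus>\<^bsub>L\<^esub> f [x \<otimes>\<^bsub>G\<^esub> y, z] \<oplus>\<^bsub>L\<^esub> f [x, y \<otimes>\<^bsub>G\<^esub> z]"
    using assms by (simp add: p1 p2 m L.l_minus del: One_nat_def L.nat_pow_Suc) 
  then show ?thesis
    unfolding coboundary_def restrict_apply'[OF xyz] p3
    using assms by (simp add: L.l_minus L.minus_eq)
qed

lemma coboundary_closed:
  assumes "f \<in> carrier (C n)" shows "coboundary G L n f \<in> carrier (C (n + 1))"
proof -
  have cl: "f xs \<in> carrier L" if "xs \<in> tuples G n" for xs
    using assms that by (auto simp: cochains_simps)
  have t: "tl xs \<in> tuples G n" "butlast xs \<in> tuples G n" if "xs \<in> tuples G (n + 1)" for xs
    using that by (auto simp: tuples_def dest!: in_set_butlastD list.set_sel(2)[rotated] split: list.splits)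
  have mg: "merge_at G i xs \<in> tuples G n" if "xs \<in> tuples G (n + 1)" "i \<in> {1..n}" for i xs
  proof -
    have "set xs \<subseteq> carrier G" "length xs = n + 1" "i - 1 < length xs" "i < length xs"
      using that by (auto simp: tuples_def)
    moreover from this have "xs ! (i - 1) \<in> carrier G" "xs ! i \<in> carrier G"
      using nth_mem by blast+
    ultimately show ?thesis
      using that(2) set_take_subset[of "i - 1" xs] set_drop_subset[of "i + 1" xs]
      by (auto simp: merge_at_def tuples_def)
  qed
  show ?thesis
    unfolding coboundary_def cochains_simps using cl t mg
    by (intro restrict_PiE_iff[THEN iffD2] ballI L.a_closed L.m_closed L.finsum_closed L.nat_pow_closed) auto
qed

text \<open>The degree \<open>1\<close> has to stay in this form for the rules about cochains of degree one to apply.\<close>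
declare One_nat_def [simp del]

lemma cochain_add_apply: "xs \<in> tuples G n \<Longrightarrow> (f \<oplus>\<^bsub>C n\<^esub> g) xs = f xs \<oplus>\<^bsub>L\<^esub> g xs"
  by (simp add: cochains_simps)

lemma cochain_smult_apply: "xs \<in> tuples G n \<Longrightarrow> (c \<odot>\<^bsub>C n\<^esub> f) xs = c \<otimes>\<^bsub>L\<^esub> f xs"
  by (simp add: cochains_simps)

lemma cochain_zero_apply: "xs \<in> tuples G n \<Longrightarrow> \<zero>\<^bsub>C n\<^esub> xs = \<zero>\<^bsub>L\<^esub>"
  by (simp add: cochains_simps)

lemma coboundary_1_closed: "f \<in> carrier (C 1) \<Longrightarrow> coboundary G L 1 f \<in> carrier (C 2)"
  using coboundary_closed[of f 1] by (simp add: numeral_2_eq_2)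

lemma coboundary_2_closed: "f \<in> carrier (C 2) \<Longrightarrow> coboundary G L 2 f \<in> carrier (C 3)"
  using coboundary_closed[of f 2] by simp

lemma coboundary_1_hom: "coboundary G L 1 \<in> module_hom L (C 1) (C 2)"
  unfolding module_hom_def
proof (intro CollectI conjI allI impI Pi_I; (elim conjE)?)
  fix f g assume f: "f \<in> carrier (C 1)" and g: "g \<in> carrier (C 1)"
  show "coboundary G L 1 (f \<oplus>\<^bsub>C 1\<^esub> g) = coboundary G L 1 f \<oplus>\<^bsub>C 2\<^esub> coboundary G L 1 g"
    by (rule cochain2_eqI)
      (use f g in \<open>simp_all add: coboundary_1_closed coboundary_1 cochain_add_apply L.minus_eq L.minus_add L.a_ac
        del: One_nat_def\<close>)
next
  fix c f assume c: "c \<in> carrier L" and f: "f \<in> carrier (C 1)"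
  show "coboundary G L 1 (c \<odot>\<^bsub>C 1\<^esub> f) = c \<odot>\<^bsub>C 2\<^esub> coboundary G L 1 f"
    by (rule cochain2_eqI)
      (use c f in \<open>simp_all add: coboundary_1_closed coboundary_1 cochain_smult_apply L.minus_eq L.r_distr L.r_minus
        del: One_nat_def\<close>)
qed (rule coboundary_1_closed)

lemma coboundary_2_hom: "coboundary G L 2 \<in> module_hom L (C 2) (C 3)"
  unfolding module_hom_def
proof (intro CollectI conjI allI impI Pi_I; (elim conjE)?)
  fix f g assume f: "f \<in> carrier (C 2)" and g: "g \<in> carrier (C 2)"
  show "coboundary G L 2 (f \<oplus>\<^bsub>C 2\<^esub> g) = coboundary G L 2 f \<oplus>\<^bsub>C 3\<^esub> coboundary G L 2 g"
    by (rule cochain3_eqI)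
      (use f g in \<open>simp_all add: coboundary_2_closed coboundary_2 cochain_add_apply L.minus_eq L.minus_add L.a_ac\<close>)
next
  fix c f assume c: "c \<in> carrier L" and f: "f \<in> carrier (C 2)"
  show "coboundary G L 2 (c \<odot>\<^bsub>C 2\<^esub> f) = c \<odot>\<^bsub>C 3\<^esub> coboundary G L 2 f"
    by (rule cochain3_eqI)
      (use c f in \<open>simp_all add: coboundary_2_closed coboundary_2 cochain_smult_apply L.minus_eq L.r_distr L.r_minus\<close>)
qed (rule coboundary_2_closed)

sublocale d1: mod_hom L "C 1" "C 2" "coboundary G L 1"
  by unfold_locales (rule coboundary_1_hom)

sublocale d2: mod_hom L "C 2" "C 3" "coboundary G L 2"
  by unfold_locales (rule coboundary_2_hom)

text \<open>A constant \<open>c\<close> has coboundary \<open>c - c\<close>, the coefficients being trivial. As a consequence a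
  cohomology class of degree one is a singleton, and \<open>H\<^sup>1\<close> is the space of cocycles itself.\<close>
lemma coboundaries_1: "coboundaries G L 1 = {\<zero>\<^bsub>C 1\<^esub>}"
proof -
  have "coboundaries G L 1 = coboundary G L 0 ` carrier (C 0)"
    by (simp add: One_nat_def)
  also have "\<dots> = (\<lambda>_. \<zero>\<^bsub>C 1\<^esub>) ` carrier (C 0)"
    by (rule image_cong[OF HOL.refl coboundary_0])
  also have "\<dots> = {\<zero>\<^bsub>C 1\<^esub>}"
    using C.M.zero_closed[of 0] unfolding image_constant_conv by auto
  finally show ?thesis .
qed

lemma coboundaries_2: "coboundaries G L 2 = d1.im"
  using coboundaries.simps(2)[of G L 1] by (simp only: Suc_1 d1.im_def)

lemma cocycles_1: "cocycles G L 1 = d1.ker"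
  by (simp only: cocycles_def d1.ker_def one_add_one)

lemma cocycles_2: "cocycles G L 2 = d2.ker"
  by (simp add: cocycles_def d2.ker_def)

text \<open>Cocycles of degree one are the homomorphisms to the additive group of the field.\<close>
lemma cocycles_1_iff:
  "f \<in> cocycles G L 1 \<longleftrightarrow> f \<in> carrier (C 1) \<and> (\<forall>x\<in>carrier G. \<forall>y\<in>carrier G. f [x \<otimes>\<^bsub>G\<^esub> y] = f [x] \<oplus>\<^bsub>L\<^esub> f [y])"
proof (cases "f \<in> carrier (C 1)")
  case True
  have "coboundary G L 1 f = \<zero>\<^bsub>C 2\<^esub> \<longleftrightarrow> (\<forall>x\<in>carrier G. \<forall>y\<in>carrier G. coboundary G L 1 f [x, y] = \<zero>\<^bsub>L\<^esub>)"
    (is "?L \<longleftrightarrow> ?R")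
  proof
    show ?R if ?L
      using that by (simp add: cochain_zero_apply del: One_nat_def)
    show ?L if ?R
      by (rule cochain2_eqI) (use that True in \<open>simp_all add: coboundary_1_closed cochain_zero_apply del: One_nat_def\<close>)
  qed
  also have "\<dots> \<longleftrightarrow> (\<forall>x\<in>carrier G. \<forall>y\<in>carrier G. f [x \<otimes>\<^bsub>G\<^esub> y] = f [x] \<oplus>\<^bsub>L\<^esub> f [y])"
  proof (intro ball_cong HOL.refl)
    fix x y assume xy: "x \<in> carrier G" "y \<in> carrier G"
    have cl: "f [x] \<in> carrier L" "f [y] \<in> carrier L" "f [x \<otimes>\<^bsub>G\<^esub> y] \<in> carrier L"
      using True xy by (simp_all del: One_nat_def)
    have "f [y] \<ominus>\<^bsub>L\<^esub> f [x \<otimes>\<^bsub>G\<^esub> y] \<oplus>\<^bsub>L\<^esub> f [x] = (f [x] \<oplus>\<^bsub>L\<^esub> f [y]) \<ominus>\<^bsub>L\<^esub> f [x \<otimes>\<^bsub>G\<^esub> y]"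
      using cl by (simp add: L.minus_eq L.a_ac)
    then show "coboundary G L 1 f [x, y] = \<zero>\<^bsub>L\<^esub> \<longleftrightarrow> f [x \<otimes>\<^bsub>G\<^esub> y] = f [x] \<oplus>\<^bsub>L\<^esub> f [y]"
      unfolding coboundary_1[OF True xy] using cl by auto
  qed
  finally show ?thesis
    using True by (simp add: cocycles_def numeral_2_eq_2)
qed (simp add: cocycles_def)

lemma im_d1_subset_ker_d2: "d1.im \<subseteq> d2.ker"
proof
  fix k assume "k \<in> d1.im"
  then obtain f where f: "f \<in> carrier (C 1)" "k = coboundary G L 1 f"
    by (auto simp: d1.im_def)
  have k: "k \<in> carrier (C 2)"
    unfolding f(2) by (rule coboundary_1_closed[OF f(1)])
  have "coboundary G L 2 k = \<zero>\<^bsub>C 3\<^esub>"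
  proof (rule cochain3_eqI)
    fix x y z assume xyz: "x \<in> carrier G" "y \<in> carrier G" "z \<in> carrier G"
    define a b c ab bc abc where defs: "a = f [x]" "b = f [y]" "c = f [z]" "ab = f [x \<otimes>\<^bsub>G\<^esub> y]"
      "bc = f [y \<otimes>\<^bsub>G\<^esub> z]" "abc = f [x \<otimes>\<^bsub>G\<^esub> y \<otimes>\<^bsub>G\<^esub> z]"
    have cl: "a \<in> carrier L" "b \<in> carrier L" "c \<in> carrier L" "ab \<in> carrier L" "bc \<in> carrier L" "abc \<in> carrier L"
      using f(1) xyz by (simp_all add: defs del: One_nat_def)
    have "coboundary G L 2 k [x, y, z] = (c \<ominus>\<^bsub>L\<^esub> bc \<oplus>\<^bsub>L\<^esub> b) \<oplus>\<^bsub>L\<^esub>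
        (\<ominus>\<^bsub>L\<^esub> (c \<ominus>\<^bsub>L\<^esub> abc \<oplus>\<^bsub>L\<^esub> ab) \<oplus>\<^bsub>L\<^esub> (bc \<ominus>\<^bsub>L\<^esub> abc \<oplus>\<^bsub>L\<^esub> a)) \<ominus>\<^bsub>L\<^esub> (b \<ominus>\<^bsub>L\<^esub> ab \<oplus>\<^bsub>L\<^esub> a)"
      unfolding coboundary_2[OF k xyz] unfolding f(2)
      using f(1) xyz by (simp add: coboundary_1 defs G.m_assoc del: One_nat_def)
    also have "\<dots> = \<zero>\<^bsub>L\<^esub>"
      using cl by algebra
    finally show "coboundary G L 2 k [x, y, z] = \<zero>\<^bsub>C 3\<^esub> [x, y, z]"
      using xyz by (simp add: cochain_zero_apply)
  qed (use k in \<open>simp_all add: coboundary_2_closed\<close>)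
  then show "k \<in> d2.ker"
    using k by (simp add: d2.ker_def)
qed

abbreviation H1 :: "('l, ('g list \<Rightarrow> 'l) set) module" where
  "H1 \<equiv> cohomology G L 1"

abbreviation H2 :: "('l, ('g list \<Rightarrow> 'l) set) module" where
  "H2 \<equiv> cohomology G L 2"

abbreviation class2 :: "('g list \<Rightarrow> 'l) \<Rightarrow> ('g list \<Rightarrow> 'l) set" where
  "class2 k \<equiv> coboundaries G L 2 +>\<^bsub>C 2\<^esub> k"

text \<open>Cohomology is a quotient of the module of cocycles, whereas the cup product uses cosets in the module of
  cochains.\<close>
lemma coset_carrier_update: "N +>\<^bsub>M\<lparr>carrier := Z\<rparr>\<^esub> v = N +>\<^bsub>M\<^esub> v"
  by (simp add: a_r_coset_def r_coset_def)

sublocale Q1: module_quotient L "(C 1)\<lparr>carrier := cocycles G L 1\<rparr>" "coboundaries G L 1"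
proof (intro module_quotient.intro module_quotient_axioms.intro)
  show M: "module L ((C 1)\<lparr>carrier := cocycles G L 1\<rparr>)"
    unfolding cocycles_1 by (rule C.submodule_is_module[OF d1.ker_is_submodule])
  interpret M: module L "(C 1)\<lparr>carrier := cocycles G L 1\<rparr>"
    by (rule M)
  have "\<zero>\<^bsub>C 1\<^esub> \<in> cocycles G L 1"
    using M.M.zero_closed by simp
  then show "submodule L (coboundaries G L 1) ((C 1)\<lparr>carrier := cocycles G L 1\<rparr>)"
    unfolding coboundaries_1 by (intro submodule.intro M) auto
qed

sublocale Q2: module_quotient L "(C 2)\<lparr>carrier := cocycles G L 2\<rparr>" "coboundaries G L 2"
proof (intro module_quotient.intro module_quotient_axioms.intro)
  show "module L ((C 2)\<lparr>carrier := cocycles G L 2\<rparr>)"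
    unfolding cocycles_2 by (rule C.submodule_is_module[OF d2.ker_is_submodule])
  show "submodule L (coboundaries G L 2) ((C 2)\<lparr>carrier := cocycles G L 2\<rparr>)"
    unfolding cocycles_2 coboundaries_2
    by (rule C.nested_submodules[OF d2.ker_is_submodule d1.im_is_submodule im_d1_subset_ker_d2])
qed

lemma H1_vectorspace: "vectorspace L H1"
  using Q1.quotient_module_is_module L.field_axioms by (simp add: cohomology_def vectorspace_def)

lemma H2_vectorspace: "vectorspace L H2"
  using Q2.quotient_module_is_module L.field_axioms by (simp add: cohomology_def vectorspace_def)

lemma cocycle_1_closed: "f \<in> cocycles G L 1 \<Longrightarrow> f \<in> carrier (C 1)"
  by (simp add: cocycles_def)

lemma class1: "f \<in> cocycles G L 1 \<Longrightarrow> coboundaries G L 1 +>\<^bsub>C 1\<^esub> f = {f}"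
  using cocycle_1_closed by (simp add: coboundaries_1 a_r_coset_def r_coset_def)

lemma H1_carrier: "carrier H1 = (\<lambda>f. {f}) ` cocycles G L 1"
  using Q1.quotient_carrier by (simp add: cohomology_def coset_carrier_update class1)

lemma cocycle_1_add: "f \<in> cocycles G L 1 \<Longrightarrow> g \<in> cocycles G L 1 \<Longrightarrow> f \<oplus>\<^bsub>C 1\<^esub> g \<in> cocycles G L 1"
  using Q1.M.a_closed[of f g] by simp

lemma cocycle_1_smult: "c \<in> carrier L \<Longrightarrow> f \<in> cocycles G L 1 \<Longrightarrow> c \<odot>\<^bsub>C 1\<^esub> f \<in> cocycles G L 1"
  using Q1.smult_closed[of c f] by simp

lemma H1_add: "f \<in> cocycles G L 1 \<Longrightarrow> g \<in> cocycles G L 1 \<Longrightarrow> {f} \<oplus>\<^bsub>H1\<^esub> {g} = {f \<oplus>\<^bsub>C 1\<^esub> g}"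
  using Q1.quotient_add[of f g] by (simp add: cohomology_def coset_carrier_update class1 cocycle_1_add)

lemma H1_smult: "c \<in> carrier L \<Longrightarrow> f \<in> cocycles G L 1 \<Longrightarrow> c \<odot>\<^bsub>H1\<^esub> {f} = {c \<odot>\<^bsub>C 1\<^esub> f}"
  using Q1.quotient_smult[of c f] by (simp add: cohomology_def coset_carrier_update class1 cocycle_1_smult)

lemma class2_closed: "k \<in> cocycles G L 2 \<Longrightarrow> class2 k \<in> carrier H2"
  using Q2.quotient_carrier by (simp add: cohomology_def coset_carrier_update)

lemma class2_add:
  "k \<in> cocycles G L 2 \<Longrightarrow> l \<in> cocycles G L 2 \<Longrightarrow> class2 k \<oplus>\<^bsub>H2\<^esub> class2 l = class2 (k \<oplus>\<^bsub>C 2\<^esub> l)"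
  using Q2.quotient_add[of k l] by (simp add: cohomology_def coset_carrier_update)

lemma class2_smult:
  "c \<in> carrier L \<Longrightarrow> k \<in> cocycles G L 2 \<Longrightarrow> c \<odot>\<^bsub>H2\<^esub> class2 k = class2 (c \<odot>\<^bsub>C 2\<^esub> k)"
  using Q2.quotient_smult[of c k] by (simp add: cohomology_def coset_carrier_update)

lemma class2_eq_zero: "k \<in> cocycles G L 2 \<Longrightarrow> class2 k = \<zero>\<^bsub>H2\<^esub> \<longleftrightarrow> k \<in> coboundaries G L 2"
  using Q2.quotient_projection_eq_zero[of k] by (simp add: cohomology_def coset_carrier_update)

abbreviation cup1 :: "('g list \<Rightarrow> 'l) \<Rightarrow> ('g list \<Rightarrow> 'l) \<Rightarrow> 'g list \<Rightarrow> 'l" where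
  "cup1 \<equiv> cochain_cup G L 1 1"

lemma split_pair: "take 1 [x, y] = [x]" "drop 1 [x, y] = [y]"
  by (simp_all add: One_nat_def)

lemma cup1_apply: "x \<in> carrier G \<Longrightarrow> y \<in> carrier G \<Longrightarrow> cup1 f g [x, y] = f [x] \<otimes>\<^bsub>L\<^esub> g [y]"
  by (simp add: cochain_cup_def split_pair)

lemma cup1_closed: "f \<in> carrier (C 1) \<Longrightarrow> g \<in> carrier (C 1) \<Longrightarrow> cup1 f g \<in> carrier (C 2)"
  unfolding cochain_cup_def one_add_one cochains_simps(1)[of 2] restrict_PiE_iff by (auto simp: tuples_two split_pair)

lemma cup1_cocycle:
  assumes f: "f \<in> cocycles G L 1" and g: "g \<in> cocycles G L 1"
  shows "cup1 f g \<in> cocycles G L 2"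
proof -
  have fg: "f \<in> carrier (C 1)" "g \<in> carrier (C 1)"
    using f g cocycle_1_closed by auto
  have c: "cup1 f g \<in> carrier (C 2)"
    by (rule cup1_closed[OF fg])
  have "coboundary G L 2 (cup1 f g) = \<zero>\<^bsub>C 3\<^esub>"
  proof (rule cochain3_eqI)
    fix x y z assume xyz: "x \<in> carrier G" "y \<in> carrier G" "z \<in> carrier G"
    have cl: "f [x] \<in> carrier L" "f [y] \<in> carrier L" "g [y] \<in> carrier L" "g [z] \<in> carrier L"
      using fg xyz by simp_all
    have "f [x \<otimes>\<^bsub>G\<^esub> y] = f [x] \<oplus>\<^bsub>L\<^esub> f [y]" "g [y \<otimes>\<^bsub>G\<^esub> z] = g [y] \<oplus>\<^bsub>L\<^esub> g [z]"
      using f g xyz by (simp_all add: cocycles_1_iff)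
    then have "coboundary G L 2 (cup1 f g) [x, y, z] = f [y] \<otimes>\<^bsub>L\<^esub> g [z] \<oplus>\<^bsub>L\<^esub>
        (\<ominus>\<^bsub>L\<^esub> ((f [x] \<oplus>\<^bsub>L\<^esub> f [y]) \<otimes>\<^bsub>L\<^esub> g [z]) \<oplus>\<^bsub>L\<^esub> f [x] \<otimes>\<^bsub>L\<^esub> (g [y] \<oplus>\<^bsub>L\<^esub> g [z])) \<ominus>\<^bsub>L\<^esub> f [x] \<otimes>\<^bsub>L\<^esub> g [y]"
      using xyz by (simp add: coboundary_2[OF c xyz] cup1_apply)
    also have "\<dots> = \<zero>\<^bsub>L\<^esub>"
      using cl by algebra
    finally show "coboundary G L 2 (cup1 f g) [x, y, z] = \<zero>\<^bsub>C 3\<^esub> [x, y, z]"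
      using xyz by (simp add: cochain_zero_apply)
  qed (use c in \<open>simp_all add: coboundary_2_closed\<close>)
  then show ?thesis
    using c by (simp add: cocycles_def)
qed

lemma cup_classes: "cup G L 1 1 {f} {g} = class2 (cup1 f g)"
  by (simp add: cup_def one_add_one)

text \<open>The coboundary of minus the product of two homomorphisms is their symmetrised cup product.\<close>
lemma cup_anticommute:
  assumes f: "f \<in> cocycles G L 1" and g: "g \<in> cocycles G L 1"
  shows "cup1 f g \<oplus>\<^bsub>C 2\<^esub> cup1 g f \<in> coboundaries G L 2"
proof -
  define h where "h = (\<lambda>xs\<in>tuples G 1. \<ominus>\<^bsub>L\<^esub> (f xs \<otimes>\<^bsub>L\<^esub> g xs))"
  have fg: "f \<in> carrier (C 1)" "g \<in> carrier (C 1)"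
    using f g cocycle_1_closed by auto
  have h: "h \<in> carrier (C 1)"
    unfolding h_def cochains_simps restrict_PiE_iff using fg by (auto simp: tuples_one)
  have h_apply: "h [x] = \<ominus>\<^bsub>L\<^esub> (f [x] \<otimes>\<^bsub>L\<^esub> g [x])" if "x \<in> carrier G" for x
    using that by (simp add: h_def)
  have "coboundary G L 1 h = cup1 f g \<oplus>\<^bsub>C 2\<^esub> cup1 g f"
  proof (rule cochain2_eqI)
    fix x y assume xy: "x \<in> carrier G" "y \<in> carrier G"
    have cl: "f [x] \<in> carrier L" "f [y] \<in> carrier L" "g [x] \<in> carrier L" "g [y] \<in> carrier L"
      using fg xy by simp_all
    have "f [x \<otimes>\<^bsub>G\<^esub> y] = f [x] \<oplus>\<^bsub>L\<^esub> f [y]" "g [x \<otimes>\<^bsub>G\<^esub> y] = g [x] \<oplus>\<^bsub>L\<^esub> g [y]"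
      using f g xy by (simp_all add: cocycles_1_iff)
    then have "coboundary G L 1 h [x, y] = \<ominus>\<^bsub>L\<^esub> (f [y] \<otimes>\<^bsub>L\<^esub> g [y])
        \<ominus>\<^bsub>L\<^esub> (\<ominus>\<^bsub>L\<^esub> ((f [x] \<oplus>\<^bsub>L\<^esub> f [y]) \<otimes>\<^bsub>L\<^esub> (g [x] \<oplus>\<^bsub>L\<^esub> g [y]))) \<oplus>\<^bsub>L\<^esub> \<ominus>\<^bsub>L\<^esub> (f [x] \<otimes>\<^bsub>L\<^esub> g [x])"
      using xy by (simp add: coboundary_1[OF h xy] h_apply)
    also have "\<dots> = f [x] \<otimes>\<^bsub>L\<^esub> g [y] \<oplus>\<^bsub>L\<^esub> g [x] \<otimes>\<^bsub>L\<^esub> f [y]"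
      using cl by algebra
    finally show "coboundary G L 1 h [x, y] = (cup1 f g \<oplus>\<^bsub>C 2\<^esub> cup1 g f) [x, y]"
      using xy by (simp add: cochain_add_apply cup1_apply)
  qed (use h fg in \<open>simp_all add: coboundary_1_closed cup1_closed\<close>)
  then show ?thesis
    using h unfolding coboundaries_2 d1.im_def by (metis imageI)
qed

lemma cup1_add_left:
  assumes "f \<in> carrier (C 1)" "f' \<in> carrier (C 1)" "g \<in> carrier (C 1)"
  shows "cup1 (f \<oplus>\<^bsub>C 1\<^esub> f') g = cup1 f g \<oplus>\<^bsub>C 2\<^esub> cup1 f' g"
  by (rule cochain2_eqI) (use assms in \<open>simp_all add: cup1_closed cup1_apply cochain_add_apply L.l_distr\<close>)

lemma cup1_add_right:
  assumes "f \<in> carrier (C 1)" "g \<in> carrier (C 1)" "g' \<in> carrier (C 1)"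
  shows "cup1 f (g \<oplus>\<^bsub>C 1\<^esub> g') = cup1 f g \<oplus>\<^bsub>C 2\<^esub> cup1 f g'"
  by (rule cochain2_eqI) (use assms in \<open>simp_all add: cup1_closed cup1_apply cochain_add_apply L.r_distr\<close>)

lemma cup1_smult_left:
  assumes "c \<in> carrier L" "f \<in> carrier (C 1)" "g \<in> carrier (C 1)"
  shows "cup1 (c \<odot>\<^bsub>C 1\<^esub> f) g = c \<odot>\<^bsub>C 2\<^esub> cup1 f g"
  by (rule cochain2_eqI) (use assms in \<open>simp_all add: cup1_closed cup1_apply cochain_smult_apply L.m_assoc\<close>)

lemma cup1_smult_right:
  assumes "c \<in> carrier L" "f \<in> carrier (C 1)" "g \<in> carrier (C 1)"
  shows "cup1 f (c \<odot>\<^bsub>C 1\<^esub> g) = c \<odot>\<^bsub>C 2\<^esub> cup1 f g"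
  by (rule cochain2_eqI) (use assms in \<open>simp_all add: cup1_closed cup1_apply cochain_smult_apply L.m_lcomm\<close>)

theorem cup_pairing_triple:
  assumes "vectorspace.fin_dim L H1"
  shows "pairing_triple L H1 H2 (cup G L 1 1)"
proof -
  interpret V: vectorspace L H1 by (rule H1_vectorspace)
  interpret W: vectorspace L H2 by (rule H2_vectorspace)
  have cl: "f \<in> carrier (C 1)" if "f \<in> cocycles G L 1" for f
    using that by (rule cocycle_1_closed)
  show ?thesis
  proof (intro pairing_triple.intro pairing_triple_axioms.intro H1_vectorspace H2_vectorspace assms)
    fix u assume "u \<in> carrier H1"
    then obtain f where f: "f \<in> cocycles G L 1" "u = {f}"
      by (auto simp: H1_carrier)
    show "(\<lambda>v. cup G L 1 1 v u) \<in> module_hom L H1 H2"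
      unfolding module_hom_def f(2)
      using f(1) by (auto simp: H1_carrier cup_classes H1_add H1_smult class2_closed class2_add class2_smult
        cup1_cocycle cup1_add_left cup1_smult_left cl)
    show "cup G L 1 1 u \<in> module_hom L H1 H2"
      unfolding module_hom_def f(2)
      using f(1) by (auto simp: H1_carrier cup_classes H1_add H1_smult class2_closed class2_add class2_smult
        cup1_cocycle cup1_add_right cup1_smult_right cl)
  next
    have "cup G L 1 1 u v = \<ominus>\<^bsub>H2\<^esub> cup G L 1 1 v u" if uv: "u \<in> carrier H1" "v \<in> carrier H1" for u v
    proof -
      obtain f g where fg: "f \<in> cocycles G L 1" "u = {f}" "g \<in> cocycles G L 1" "v = {g}"
        using uv by (auto simp: H1_carrier)
      have k: "cup1 f g \<in> cocycles G L 2" "cup1 g f \<in> cocycles G L 2"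
        using fg cup1_cocycle by auto
      then have "cup1 f g \<oplus>\<^bsub>C 2\<^esub> cup1 g f \<in> cocycles G L 2"
        using Q2.M.a_closed[of "cup1 f g" "cup1 g f"] by simp
      then have "class2 (cup1 f g) \<oplus>\<^bsub>H2\<^esub> class2 (cup1 g f) = \<zero>\<^bsub>H2\<^esub>"
        using cup_anticommute[OF fg(1,3)] k by (simp add: class2_add class2_eq_zero)
      then show ?thesis
        unfolding fg(2,4) cup_classes using k class2_closed W.M.minus_equality by metis
    qed
    then show "(\<forall>u\<in>carrier H1. \<forall>v\<in>carrier H1. cup G L 1 1 u v = cup G L 1 1 v u) \<or>
       (\<forall>u\<in>carrier H1. \<forall>v\<in>carrier H1. cup G L 1 1 u v = \<ominus>\<^bsub>H2\<^esub> cup G L 1 1 v u)"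
      by blast
  qed
qed

end

section \<open>Cohomology of right-angled Artin groups\<close>

context simplicial_graph
begin

lemma raag_hom_exists:
  assumes K: "group K" and f: "f \<in> verts \<Gamma> \<rightarrow> carrier K"
    and comm: "\<And>a b. {a, b} \<in> edges \<Gamma> \<Longrightarrow> f a \<otimes>\<^bsub>K\<^esub> f b = f b \<otimes>\<^bsub>K\<^esub> f a"
  obtains h where "h \<in> hom G K" "\<And>v. v \<in> verts \<Gamma> \<Longrightarrow> h (elt [(v, True)]) = f v"
proof -
  interpret K: group K by (rule K)
  have "K.evaluate f r = \<one>\<^bsub>K\<^esub>" if "r \<in> relators" for r
  proof -
    obtain a b where ab: "r = commutator_word a b" "{a, b} \<in> edges \<Gamma>"
      using \<open>r \<in> relators\<close> unfolding raag_relators_def by blast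
    have fc: "f a \<in> carrier K" "f b \<in> carrier K"
      using edgeD[OF ab(2)] f by auto
    have "K.evaluate f r = (f a \<otimes>\<^bsub>K\<^esub> f b) \<otimes>\<^bsub>K\<^esub> inv\<^bsub>K\<^esub> (f b \<otimes>\<^bsub>K\<^esub> f a)"
      using fc by (simp add: ab(1) commutator_word_def K.m_assoc K.inv_mult_group)
    then show ?thesis
      using fc by (simp add: comm[OF ab(2)])
  qed
  then obtain h where h: "h \<in> hom (presented_group (verts \<Gamma>) relators) K"
      "\<And>w. w \<in> words (verts \<Gamma>) \<Longrightarrow> h (word_class (verts \<Gamma>) relators w) = K.evaluate f w"
    using K.presented_group_hom[OF f] by metis
  have "h (elt [(v, True)]) = f v" if "v \<in> verts \<Gamma>" for v
    using h(2)[of "[(v, True)]"] that f by (auto simp: Pi_iff)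
  with h(1) that show thesis
    by (simp add: raag_eq)
qed

lemma raag_hom_unique:
  assumes K: "group K" and h: "h \<in> hom G K" "h' \<in> hom G K"
    and eq: "\<And>v. v \<in> verts \<Gamma> \<Longrightarrow> h (elt [(v, True)]) = h' (elt [(v, True)])" and x: "x \<in> carrier G"
  shows "h x = h' x"
proof -
  interpret K: group K by (rule K)
  obtain w where w: "w \<in> words (verts \<Gamma>)" "x = elt w"
    using x by (rule raag_carrierE)
  have cong: "K.evaluate (\<lambda>v. h (elt [(v, True)])) w = K.evaluate (\<lambda>v. h' (elt [(v, True)])) w"
    using w(1) by (induction w) (auto simp: eq)
  show ?thesis
    using hom_presented_group_eq_evaluate[OF K, of h "verts \<Gamma>" relators w]
      hom_presented_group_eq_evaluate[OF K, of h' "verts \<Gamma>" relators w] h w cong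
    by (simp add: raag_eq)
qed

end

text \<open>The triple \<open>(a, b, c)\<close> stands for the upper unitriangular matrix with \<open>a\<close> and \<open>b\<close> next to the diagonal and \<open>c\<close> in the
  corner.\<close>
definition heisenberg :: "('l, 'k) ring_scheme \<Rightarrow> ('l \<times> 'l \<times> 'l) monoid" where
  "heisenberg L = \<lparr>carrier = carrier L \<times> carrier L \<times> carrier L,
    monoid.mult = (\<lambda>(a, b, c) (a', b', c'). (a \<oplus>\<^bsub>L\<^esub> a', b \<oplus>\<^bsub>L\<^esub> b', c \<oplus>\<^bsub>L\<^esub> c' \<oplus>\<^bsub>L\<^esub> a \<otimes>\<^bsub>L\<^esub> b')),
    one = (\<zero>\<^bsub>L\<^esub>, \<zero>\<^bsub>L\<^esub>, \<zero>\<^bsub>L\<^esub>)\<rparr>"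

lemma (in cring) heisenberg_group: "group (heisenberg R)"
proof (rule groupI)
  fix x assume "x \<in> carrier (heisenberg R)"
  then obtain a b c where x: "x = (a, b, c)" "a \<in> carrier R" "b \<in> carrier R" "c \<in> carrier R"
    by (auto simp: heisenberg_def)
  have "\<ominus> c \<oplus> a \<otimes> b \<oplus> c \<oplus> \<ominus> a \<otimes> b = \<zero>"
    using x by algebra
  then show "\<exists>y\<in>carrier (heisenberg R). y \<otimes>\<^bsub>heisenberg R\<^esub> x = \<one>\<^bsub>heisenberg R\<^esub>"
    using x by (intro bexI[of _ "(\<ominus> a, \<ominus> b, \<ominus> c \<oplus> a \<otimes> b)"]) (simp_all add: heisenberg_def l_neg)
next
  fix x y z assume "x \<in> carrier (heisenberg R)" "y \<in> carrier (heisenberg R)" "z \<in> carrier (heisenberg R)"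
  then show "x \<otimes>\<^bsub>heisenberg R\<^esub> y \<otimes>\<^bsub>heisenberg R\<^esub> z = x \<otimes>\<^bsub>heisenberg R\<^esub> (y \<otimes>\<^bsub>heisenberg R\<^esub> z)"
    by (auto simp: heisenberg_def l_distr r_distr a_ac)
qed (auto simp: heisenberg_def)

locale raag_cohomology = simplicial_graph \<Gamma> + L: field L
  for \<Gamma> :: "'v graph" and L :: "('l, 'k) ring_scheme"
begin

sublocale coh: group_cohomology G L
  by (intro group_cohomology.intro is_group L.field_axioms)

lemma add_monoid_group: "group (add_monoid L)"
  by (rule L.a_group)

lemma cocycle_hom:
  assumes "f \<in> cocycles G L 1" shows "(\<lambda>x. f [x]) \<in> hom G (add_monoid L)"
  using assms coh.cochain1_closed[OF coh.cocycle_1_closed[OF assms]]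
  by (auto simp: hom_def coh.cocycles_1_iff)

lemma cocycle_eqI:
  assumes f: "f \<in> cocycles G L 1" "g \<in> cocycles G L 1"
    and eq: "\<And>v. v \<in> verts \<Gamma> \<Longrightarrow> f [elt [(v, True)]] = g [elt [(v, True)]]"
  shows "f = g"
  using raag_hom_unique[OF add_monoid_group cocycle_hom[OF f(1)] cocycle_hom[OF f(2)] eq]
  by (intro coh.cochain1_eqI coh.cocycle_1_closed f)

lemma cocycle_exists:
  assumes c: "c \<in> verts \<Gamma> \<rightarrow> carrier L"
  shows "\<exists>f\<in>cocycles G L 1. \<forall>v\<in>verts \<Gamma>. f [elt [(v, True)]] = c v"
proof -
  have "c a \<otimes>\<^bsub>add_monoid L\<^esub> c b = c b \<otimes>\<^bsub>add_monoid L\<^esub> c a" if "{a, b} \<in> edges \<Gamma>" for a b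
    using edgeD[OF that] c by (auto simp: L.a_comm Pi_iff)
  moreover have "c \<in> verts \<Gamma> \<rightarrow> carrier (add_monoid L)"
    using c by simp
  ultimately obtain h where h: "h \<in> hom G (add_monoid L)" "\<And>v. v \<in> verts \<Gamma> \<Longrightarrow> h (elt [(v, True)]) = c v"
    using raag_hom_exists[OF add_monoid_group] by blast
  define f where "f = (\<lambda>xs\<in>tuples G 1. h (hd xs))"
  have fx: "f [x] = h x" if "x \<in> carrier G" for x
    using that by (simp add: f_def)
  have hx: "h x \<in> carrier L" if "x \<in> carrier G" for x
    using hom_in_carrier[OF h(1) that] by simp
  have "f \<in> carrier (coh.C 1)"
    unfolding f_def coh.cochains_simps restrict_PiE_iff using hx by (auto simp: tuples_one)
  moreover have "f [x \<otimes>\<^bsub>G\<^esub> y] = f [x] \<oplus>\<^bsub>L\<^esub> f [y]" if "x \<in> carrier G" "y \<in> carrier G" for x y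
    using hom_mult[OF h(1) that] that by (simp add: fx)
  ultimately have "f \<in> cocycles G L 1"
    by (simp add: coh.cocycles_1_iff)
  then show ?thesis
    using h(2) by (intro bexI[of _ f]) (simp_all add: fx)
qed

text \<open>If \<open>f \<smile> g\<close> is the coboundary of \<open>h\<close>, then \<open>f(x) g(y) = h(y) - h(x y) + h(x)\<close>, which is symmetric
  for commuting \<open>x\<close> and \<open>y\<close>. Conversely, the relation on edges says that the elements \<open>(f\<^sub>v, g\<^sub>v, 0)\<close> of the
  Heisenberg group commute for adjacent vertices, so they define a homomorphism; minus its third component has
  coboundary \<open>f \<smile> g\<close>.\<close>
theorem cup_is_coboundary_iff:
  assumes f: "f \<in> cocycles G L 1" and g: "g \<in> cocycles G L 1"
  shows "coh.cup1 f g \<in> coboundaries G L 2 \<longleftrightarrow> (\<forall>a b. {a, b} \<in> edges \<Gamma> \<longrightarrow>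
    f [elt [(a, True)]] \<otimes>\<^bsub>L\<^esub> g [elt [(b, True)]] = f [elt [(b, True)]] \<otimes>\<^bsub>L\<^esub> g [elt [(a, True)]])"
proof
  have fc: "f [x] \<in> carrier L" "g [x] \<in> carrier L" if "x \<in> carrier G" for x
    using that f g coh.cocycle_1_closed by auto
  assume "coh.cup1 f g \<in> coboundaries G L 2"
  then obtain h where "coh.cup1 f g = coboundary G L 1 h" "h \<in> carrier (coh.C 1)"
    unfolding coh.coboundaries_2 coh.d1.im_def by (rule imageE)
  then have h: "h \<in> carrier (coh.C 1)" "coboundary G L 1 h = coh.cup1 f g"
    by simp_all
  show "\<forall>a b. {a, b} \<in> edges \<Gamma> \<longrightarrow>
    f [elt [(a, True)]] \<otimes>\<^bsub>L\<^esub> g [elt [(b, True)]] = f [elt [(b, True)]] \<otimes>\<^bsub>L\<^esub> g [elt [(a, True)]]"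
  proof (intro allI impI)
    fix a b assume e: "{a, b} \<in> edges \<Gamma>"
    let ?x = "elt [(a, True)]" and ?y = "elt [(b, True)]"
    have xy: "?x \<in> carrier G" "?y \<in> carrier G"
      using edgeD[OF e] by simp_all
    have hc: "h [?x] \<in> carrier L" "h [?y] \<in> carrier L" "h [?x \<otimes>\<^bsub>G\<^esub> ?y] \<in> carrier L"
      using h(1) xy by simp_all
    have "f [?x] \<otimes>\<^bsub>L\<^esub> g [?y] = h [?y] \<ominus>\<^bsub>L\<^esub> h [?x \<otimes>\<^bsub>G\<^esub> ?y] \<oplus>\<^bsub>L\<^esub> h [?x]"
      using coh.coboundary_1[OF h(1) xy] coh.cup1_apply[OF xy] h(2) by simp
    also have "\<dots> = h [?x] \<ominus>\<^bsub>L\<^esub> h [?x \<otimes>\<^bsub>G\<^esub> ?y] \<oplus>\<^bsub>L\<^esub> h [?y]"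
      using hc by (simp add: L.minus_eq L.a_ac)
    also have "\<dots> = f [?y] \<otimes>\<^bsub>L\<^esub> g [?x]"
      unfolding generators_commute[OF e]
      using coh.coboundary_1[OF h(1) xy(2,1)] coh.cup1_apply[OF xy(2,1)] h(2) by simp
    finally show "f [?x] \<otimes>\<^bsub>L\<^esub> g [?y] = f [?y] \<otimes>\<^bsub>L\<^esub> g [?x]" .
  qed
next
  have fc: "f [x] \<in> carrier L" "g [x] \<in> carrier L" if "x \<in> carrier G" for x
    using that f g coh.cocycle_1_closed by auto
  assume edges: "\<forall>a b. {a, b} \<in> edges \<Gamma> \<longrightarrow>
    f [elt [(a, True)]] \<otimes>\<^bsub>L\<^esub> g [elt [(b, True)]] = f [elt [(b, True)]] \<otimes>\<^bsub>L\<^esub> g [elt [(a, True)]]"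
  let ?K = "heisenberg L"
  have K: "group ?K"
    by (rule L.heisenberg_group)
  define p where "p v = (f [elt [(v, True)]], g [elt [(v, True)]], \<zero>\<^bsub>L\<^esub>)" for v
  have p: "p \<in> verts \<Gamma> \<rightarrow> carrier ?K"
    using fc by (auto simp: p_def heisenberg_def)
  have comm: "p a \<otimes>\<^bsub>?K\<^esub> p b = p b \<otimes>\<^bsub>?K\<^esub> p a" if e: "{a, b} \<in> edges \<Gamma>" for a b
    using edgeD[OF e] fc by (simp add: p_def heisenberg_def L.a_comm edges[rule_format, OF e])
  obtain h where h: "h \<in> hom G ?K" "\<And>v. v \<in> verts \<Gamma> \<Longrightarrow> h (elt [(v, True)]) = p v"
    using raag_hom_exists[OF K p comm] by blast
  define h1 h2 h3 where h123: "h1 x = fst (h x)" "h2 x = fst (snd (h x))" "h3 x = snd (snd (h x))" for x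
  have h_eq: "h x = (h1 x, h2 x, h3 x)" for x
    by (simp add: h123)
  have hc: "h1 x \<in> carrier L" "h2 x \<in> carrier L" "h3 x \<in> carrier L" if "x \<in> carrier G" for x
    using hom_in_carrier[OF h(1) that] by (auto simp: h_eq heisenberg_def)
  have h_mult: "h1 (x \<otimes>\<^bsub>G\<^esub> y) = h1 x \<oplus>\<^bsub>L\<^esub> h1 y" "h2 (x \<otimes>\<^bsub>G\<^esub> y) = h2 x \<oplus>\<^bsub>L\<^esub> h2 y"
      "h3 (x \<otimes>\<^bsub>G\<^esub> y) = h3 x \<oplus>\<^bsub>L\<^esub> h3 y \<oplus>\<^bsub>L\<^esub> h1 x \<otimes>\<^bsub>L\<^esub> h2 y" if "x \<in> carrier G" "y \<in> carrier G" for x y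
    using hom_mult[OF h(1) that] by (simp_all add: h_eq heisenberg_def)
  have "h1 \<in> hom G (add_monoid L)" "h2 \<in> hom G (add_monoid L)"
    using hc h_mult by (auto simp: hom_def)
  moreover have "h1 (elt [(v, True)]) = f [elt [(v, True)]]" "h2 (elt [(v, True)]) = g [elt [(v, True)]]"
    if "v \<in> verts \<Gamma>" for v
    using h(2)[OF that] by (simp_all add: h_eq p_def)
  ultimately have h1: "h1 x = f [x]" and h2: "h2 x = g [x]" if "x \<in> carrier G" for x
    using raag_hom_unique[OF add_monoid_group _ cocycle_hom[OF f] _ that, of h1]
      raag_hom_unique[OF add_monoid_group _ cocycle_hom[OF g] _ that, of h2] by blast+
  define k where "k = (\<lambda>xs\<in>tuples G 1. \<ominus>\<^bsub>L\<^esub> h3 (hd xs))"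
  have k: "k \<in> carrier (coh.C 1)"
    unfolding k_def coh.cochains_simps restrict_PiE_iff using hc by (auto simp: tuples_one)
  have kx: "k [x] = \<ominus>\<^bsub>L\<^esub> h3 x" if "x \<in> carrier G" for x
    using that by (simp add: k_def)
  have "coboundary G L 1 k = coh.cup1 f g"
  proof (rule coh.cochain2_eqI)
    fix x y assume xy: "x \<in> carrier G" "y \<in> carrier G"
    have cl: "h3 x \<in> carrier L" "h3 y \<in> carrier L" "f [x] \<in> carrier L" "g [y] \<in> carrier L"
      using hc fc xy by auto
    have "coboundary G L 1 k [x, y] = \<ominus>\<^bsub>L\<^esub> h3 y \<ominus>\<^bsub>L\<^esub> (\<ominus>\<^bsub>L\<^esub> (h3 x \<oplus>\<^bsub>L\<^esub> h3 y \<oplus>\<^bsub>L\<^esub> f [x] \<otimes>\<^bsub>L\<^esub> g [y])) \<oplus>\<^bsub>L\<^esub> \<ominus>\<^bsub>L\<^esub> h3 x"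
      using xy by (simp add: coh.coboundary_1[OF k xy] kx h_mult h1 h2)
    also have "\<dots> = f [x] \<otimes>\<^bsub>L\<^esub> g [y]"
      using cl by algebra
    finally show "coboundary G L 1 k [x, y] = coh.cup1 f g [x, y]"
      by (simp add: coh.cup1_apply[OF xy])
  qed (use k f g coh.cocycle_1_closed in \<open>simp_all add: coh.coboundary_1_closed coh.cup1_closed\<close>)
  then show "coh.cup1 f g \<in> coboundaries G L 2"
    using k unfolding coh.coboundaries_2 coh.d1.im_def by (metis imageI)
qed

text \<open>A class \<open>u\<close> of degree one has a single element, a homomorphism, which is evaluated at the generator
  \<open>v\<close>.\<close>
definition generator_value :: "('v word set list \<Rightarrow> 'l) set \<Rightarrow> 'v \<Rightarrow> 'l" where
  "generator_value u v = the_elem u [elt [(v, True)]]"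

lemma generator_value_simp [simp]: "generator_value {f} v = f [elt [(v, True)]]"
  by (simp add: generator_value_def)

sublocale H: coordinate_space L coh.H1 "verts \<Gamma>" generator_value
proof (intro coordinate_space.intro coordinate_space_axioms.intro coh.H1_vectorspace finite_verts)
  fix u v b c assume u: "u \<in> carrier coh.H1" and b: "b \<in> verts \<Gamma>"
  obtain f where f: "f \<in> cocycles G L 1" "u = {f}"
    using u by (auto simp: coh.H1_carrier)
  have x: "elt [(b, True)] \<in> carrier G"
    using b by simp
  show "generator_value u b \<in> carrier L"
    using coh.cochain1_closed[OF coh.cocycle_1_closed[OF f(1)] x] f(2) by simp
  show "generator_value (c \<odot>\<^bsub>coh.H1\<^esub> u) b = c \<otimes>\<^bsub>L\<^esub> generator_value u b" if "c \<in> carrier L"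
    using that f x by (simp add: coh.H1_smult coh.cochain_smult_apply)
  show "generator_value (u \<oplus>\<^bsub>coh.H1\<^esub> v) b = generator_value u b \<oplus>\<^bsub>L\<^esub> generator_value v b"
    if v: "v \<in> carrier coh.H1"
  proof -
    obtain g where "g \<in> cocycles G L 1" "v = {g}"
      using v by (auto simp: coh.H1_carrier)
    then show ?thesis
      using f x by (simp add: coh.H1_add coh.cochain_add_apply)
  qed
next
  fix u v assume "u \<in> carrier coh.H1" "v \<in> carrier coh.H1"
    and eq: "\<And>b. b \<in> verts \<Gamma> \<Longrightarrow> generator_value u b = generator_value v b"
  then obtain f g where fg: "f \<in> cocycles G L 1" "u = {f}" "g \<in> cocycles G L 1" "v = {g}"
    by (auto simp: coh.H1_carrier)
  then show "u = v"
    using cocycle_eqI[OF fg(1,3)] eq by simp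
next
  fix c assume "c \<in> verts \<Gamma> \<rightarrow> carrier L"
  from cocycle_exists[OF this] obtain f where "f \<in> cocycles G L 1" "\<forall>v\<in>verts \<Gamma>. f [elt [(v, True)]] = c v"
    by blast
  then show "\<exists>v\<in>carrier coh.H1. \<forall>b\<in>verts \<Gamma>. generator_value v b = c b"
    by (intro bexI[of _ "{f}"]) (auto simp: coh.H1_carrier)
qed

sublocale P: graph_pairing L coh.H1 \<Gamma> generator_value coh.H2 "cup G L 1 1"
proof (intro graph_pairing.intro graph_pairing_axioms.intro H.coordinate_space_axioms
    coh.cup_pairing_triple H.finite_dimensional simplicial)
  fix u v assume "u \<in> carrier coh.H1" "v \<in> carrier coh.H1"
  then obtain f g where fg: "f \<in> cocycles G L 1" "u = {f}" "g \<in> cocycles G L 1" "v = {g}"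
    by (auto simp: coh.H1_carrier)
  show "cup G L 1 1 u v = \<zero>\<^bsub>coh.H2\<^esub> \<longleftrightarrow> (\<forall>a b. {a, b} \<in> edges \<Gamma> \<longrightarrow>
      generator_value u a \<otimes>\<^bsub>L\<^esub> generator_value v b = generator_value u b \<otimes>\<^bsub>L\<^esub> generator_value v a)"
    unfolding fg(2,4) generator_value_simp coh.cup_classes coh.class2_eq_zero[OF coh.cup1_cocycle[OF fg(1,3)]]
    by (rule cup_is_coboundary_iff[OF fg(1,3)])
qed

lemma cohomology_cheeger_le: "cohomology_cheeger G L \<le> graph_cheeger \<Gamma>"
  unfolding cohomology_cheeger_def by (rule P.cheeger_le_graph_cheeger)

lemma cohomology_cheeger_ge:
  assumes "\<forall>v\<in>verts \<Gamma>. valence \<Gamma> v \<le> d" "0 < \<epsilon>" "ereal \<epsilon> \<le> graph_cheeger \<Gamma>"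
  shows "ereal (1 / ((real d + 1) * (1 + 1 / \<epsilon>))) \<le> cohomology_cheeger G L"
  unfolding cohomology_cheeger_def by (rule P.cheeger_ge[OF assms])

end

section \<open>Expander families\<close>

lemma tendsto_enat_infinity_iff:
  "((\<lambda>i. enat (f i)) \<longlonglongrightarrow> \<infinity>) \<longleftrightarrow> filterlim f at_top sequentially"
proof
  assume "(\<lambda>i. enat (f i)) \<longlonglongrightarrow> \<infinity>"
  then have less: "\<forall>\<^sub>F i in sequentially. enat n < enat (f i)" for n
    by (rule order_tendstoD) simp
  have "\<forall>\<^sub>F i in sequentially. n \<le> f i" for n
    by (rule eventually_mono[OF less[of n]]) simp
  then show "filterlim f at_top sequentially"
    by (simp add: filterlim_at_top)
next
  assume f: "filterlim f at_top sequentially"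
  show "(\<lambda>i. enat (f i)) \<longlonglongrightarrow> \<infinity>"
  proof (rule order_tendstoI)
    fix a :: enat assume "a < \<infinity>"
    then obtain n where "a = enat n"
      by (cases a) auto
    moreover have "\<forall>\<^sub>F i in sequentially. Suc n \<le> f i"
      using f by (simp add: filterlim_at_top)
    ultimately show "\<forall>\<^sub>F i in sequentially. a < enat (f i)"
      by (auto elim: eventually_mono)
  qed simp
qed

theorem theorem1p2:
  fixes \<Gamma> :: "nat \<Rightarrow> 'v graph"
    and L :: "('l, 'k) ring_scheme"
  assumes "\<And>i. finite_simplicial_graph (\<Gamma> i)"
    and "field L"
  shows "graph_expander_family \<Gamma> \<longleftrightarrow>
    (\<lambda>i. group_rank (raag (\<Gamma> i))) \<longlonglongrightarrow> \<infinity> \<and>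
    (\<exists>M::nat. \<forall>i. \<forall>x\<in>carrier (raag (\<Gamma> i)). x \<noteq> \<one>\<^bsub>raag (\<Gamma> i)\<^esub> \<longrightarrow>
       group_rank ((raag (\<Gamma> i))\<lparr>carrier := centralizer (raag (\<Gamma> i)) x\<rparr>) \<le> enat M) \<and>
    0 < (INF i. cohomology_cheeger (raag (\<Gamma> i)) L)"
proof -
  interpret A: raag_cohomology "\<Gamma> i" L for i
    using assms by (intro raag_cohomology.intro simplicial_graph.intro)
  have rank: "(\<lambda>i. group_rank (raag (\<Gamma> i))) \<longlonglongrightarrow> \<infinity>
      \<longleftrightarrow> filterlim (\<lambda>i. card (verts (\<Gamma> i))) at_top sequentially"
    by (simp add: A.group_rank_raag tendsto_enat_infinity_iff)
  show ?thesis
  proof (intro iffI conjI)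
    assume exp: "graph_expander_family \<Gamma>"
    then obtain d where d: "\<And>i. \<forall>v\<in>verts (\<Gamma> i). valence (\<Gamma> i) v \<le> d"
      unfolding graph_expander_family_def by blast
    show "(\<lambda>i. group_rank (raag (\<Gamma> i))) \<longlonglongrightarrow> \<infinity>"
      using exp by (simp add: rank graph_expander_family_def)
    show "\<exists>M::nat. \<forall>i. \<forall>x\<in>carrier (raag (\<Gamma> i)). x \<noteq> \<one>\<^bsub>raag (\<Gamma> i)\<^esub> \<longrightarrow>
       group_rank ((raag (\<Gamma> i))\<lparr>carrier := centralizer (raag (\<Gamma> i)) x\<rparr>) \<le> enat M"
      using A.group_rank_centralizer_le[OF d] by blast
    have "0 < (INF i. graph_cheeger (\<Gamma> i))"
      using exp by (simp add: graph_expander_family_def)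
    \<comment> \<open>The infimum may be infinite, so pass to a real number below it.\<close>
    from ereal_dense2[OF this] obtain \<epsilon> where \<epsilon>: "0 < ereal \<epsilon>" "ereal \<epsilon> < (INF i. graph_cheeger (\<Gamma> i))"
      by blast
    have le: "ereal \<epsilon> \<le> graph_cheeger (\<Gamma> i)" for i
      using less_INF_D[OF \<epsilon>(2) UNIV_I] by (rule less_imp_le)
    have pos: "0 < \<epsilon>"
      using \<epsilon>(1) by simp
    have "0 < real d + 1" "0 < 1 + 1 / \<epsilon>"
      using pos by (simp_all add: add_nonneg_pos add_pos_pos)
    then have "0 < 1 / ((real d + 1) * (1 + 1 / \<epsilon>))"
      by simp
    then have "0 < ereal (1 / ((real d + 1) * (1 + 1 / \<epsilon>)))"
      by simp
    also have "\<dots> \<le> (INF i. cohomology_cheeger (raag (\<Gamma> i)) L)"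
      by (rule INF_greatest) (rule A.cohomology_cheeger_ge[OF d pos le])
    finally show "0 < (INF i. cohomology_cheeger (raag (\<Gamma> i)) L)" .
  next
    assume *: "(\<lambda>i. group_rank (raag (\<Gamma> i))) \<longlonglongrightarrow> \<infinity> \<and>
    (\<exists>M::nat. \<forall>i. \<forall>x\<in>carrier (raag (\<Gamma> i)). x \<noteq> \<one>\<^bsub>raag (\<Gamma> i)\<^esub> \<longrightarrow>
       group_rank ((raag (\<Gamma> i))\<lparr>carrier := centralizer (raag (\<Gamma> i)) x\<rparr>) \<le> enat M) \<and>
    0 < (INF i. cohomology_cheeger (raag (\<Gamma> i)) L)"
    then obtain M where M: "\<And>i x. x \<in> carrier (raag (\<Gamma> i)) \<Longrightarrow> x \<noteq> \<one>\<^bsub>raag (\<Gamma> i)\<^esub> \<Longrightarrow>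
       group_rank ((raag (\<Gamma> i))\<lparr>carrier := centralizer (raag (\<Gamma> i)) x\<rparr>) \<le> enat M"
      by blast
    have "valence (\<Gamma> i) v \<le> M" if v: "v \<in> verts (\<Gamma> i)" for i v
    proof -
      have "enat (valence (\<Gamma> i) v) \<le> enat M"
        using A.valence_le_group_rank_centralizer[OF v] M[OF A.elt_closed A.generator_nontrivial[OF v]] v
        by (meson order_trans Cons_in_lists_iff SigmaI UNIV_I lists.Nil)
      then show ?thesis by simp
    qed
    moreover have "0 < (INF i. graph_cheeger (\<Gamma> i))"
      using * INF_mono'[of "\<lambda>i. cohomology_cheeger (raag (\<Gamma> i)) L" "\<lambda>i. graph_cheeger (\<Gamma> i)" UNIV]
        A.cohomology_cheeger_le by (blast intro: less_le_trans)
    ultimately show "graph_expander_family \<Gamma>"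
      using * unfolding graph_expander_family_def rank by blast
  qed
qed

end
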